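(* Let $\Omega\subset\mathbb{R}^N$, $N\ge 2$, be a bounded smooth domain. For every $p>N$ let $q(p)\in[1,\infty)$ be given, and let $u_{p,q(p)}$ be a positive Sobolev extremal function corresponding to $\lambda_{p,q(p)}$. Suppose that $$\lim_{p\to\infty}\frac{q(p)}{p}=\infty .$$ Let $p_n\to\infty$ be a sequence such that $u_{p_n,q(p_n)}$ converges uniformly in $\overline\Omega$ to a function $u_\infty\in C_0(\overline\Omega)\cap W^{1,\infty}(\Omega)$, and set $M:=\{x\in\Omega:u_\infty(x)=1\}$. Then $u_\infty$ is a viscosity solution to the problem $$\begin{cases}-\Delta_\infty u=0 & \text{in }\Omega\setminus M\\ u=0 & \text{on }\partial\Omega\\ u=1 & \text{in } M.\end{cases}$$ Moreover, $$u_\infty=\frac{d_\Omega}{\|d_\Omega\|_\infty}\quad\text{if and only if}\quad M=M_\Omega=\Sigma_\Omega,$$ where $M_\Omega:=\{x\in\Omega:d_\Omega(x)=\|d_\Omega\|_\infty\}$ and $\Sigma_\Omega:=\{x\in\Omega: d_\Omega\text{ is not differentiable at }x\}$.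
   Context: $\|\cdot\|_r$ is the standard norm of $L^r(\Omega)$, $1\le r\le\infty$. $C_0(\overline\Omega)$ is the set of continuous functions on $\overline\Omega$ vanishing on $\partial\Omega$. For $p>N$ and $1\le q<\infty$, $$\lambda_{p,q}:=\inf\{\|\nabla u\|_p^p: u\in W_0^{1,p}(\Omega),\ \|u\|_q=1\}.$$ The infimum is attained. A Sobolev extremal function corresponding to $\lambda_{p,q}$ is a positive minimizer $u_{p,q}$, i.e. $u_{p,q}\in W_0^{1,p}(\Omega)$, $u_{p,q}>0$ in $\Omega$, $\|u_{p,q}\|_q=1$ and $\|\nabla u_{p,q}\|_p^p=\lambda_{p,q}$ (it need not be unique when $q>p$; $u_{p,q(p)}$ denotes any choice). Functions in $W_0^{1,p}(\Omega)$, $p>N$, are identified with their continuous representatives on $\overline\Omega$. $d_\Omega(x):=\inf_{y\in\partial\Omega}|x-y|$, $x\in\overline\Omega$, is the distance to the boundary. The infinity Laplacian is $\Delta_\infty\phi:=\sum_{i,j=1}^N \phi_{x_i}\phi_{x_j}\phi_{x_ix_j}$. Let $D\subset\mathbb{R}^N$ be a bounded open set and $u\in C(D)$. $u$ is a viscosity supersolution of $-\Delta_\infty u=0$ in $D$ if for each $x_0\in D$, each ball $B(x_0)\subset D$ centered at $x_0$, and each $\phi\in C^2(B(x_0))$ with $\phi(x)-u(x)<0=\phi(x_0)-u(x_0)$ for all $x\in B(x_0)\setminus\{x_0\}$, one has $-\Delta_\infty\phi(x_0)\ge 0$. It is a viscosity subsolution if for each such $x_0$, $B(x_0)$ and each $\phi\in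 C^2(B(x_0))$ with $\phi(x)-u(x)>0=\phi(x_0)-u(x_0)$ for all $x\in B(x_0)\setminus\{x_0\}$, one has $-\Delta_\infty\phi(x_0)\le 0$. $u$ is infinity harmonic in $D$ if it is both. A viscosity solution to the displayed problem is a function $u\in C(\overline\Omega)$ that is infinity harmonic in the open set $\Omega\setminus M$, with $u=0$ on $\partial\Omega$ and $u=1$ on $M$. *)

theory Defs
  imports "HOL-Analysis.Analysis" "HOL-Probability.Essential_Supremum"
begin

definition partial_deriv :: "'n \<Rightarrow> (real^'n \<Rightarrow> real) \<Rightarrow> real^'n \<Rightarrow> real"
  where "partial_deriv i f x = frechet_derivative f (at x) (axis i 1)"

definition grad :: "(real^'n \<Rightarrow> real) \<Rightarrow> real^'n \<Rightarrow> real^'n"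
  where "grad f x = (\<chi> i. partial_deriv i f x)"

text \<open>The class \<open>C\<^sup>k(S)\<close>; only meant for open \<open>S\<close>, since derivatives are full ones
  (\<open>at x\<close>, not \<open>at x within S\<close>). The values of \<open>f\<close> outside \<open>S\<close> are then irrelevant.\<close>

primrec Ck_on :: "nat \<Rightarrow> (real^'n) set \<Rightarrow> (real^'n \<Rightarrow> real) \<Rightarrow> bool"
  where
    "Ck_on 0 S f \<longleftrightarrow> continuous_on S f"
  | "Ck_on (Suc k) S f \<longleftrightarrow>
       (\<forall>x\<in>S. f differentiable (at x)) \<and> (\<forall>i. Ck_on k S (partial_deriv i f))"

definition smooth_fun_on :: "(real^'n) set \<Rightarrow> (real^'n \<Rightarrow> real) \<Rightarrow> bool"
  where "smooth_fun_on S f \<longleftrightarrow> (\<forall>k. Ck_on k S f)"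

text \<open>Locally, up to a rigid motion, \<open>\<Omega>\<close> is the region above the graph of a smooth function
  of \<open>N - 1\<close> variables: \<open>e\<close> is the vertical direction, and \<open>\<gamma>\<close> is evaluated only at the
  orthogonal projection of \<open>x\<close> onto the hyperplane orthogonal to \<open>e\<close>.\<close>

definition smooth_boundary :: "(real^'n) set \<Rightarrow> bool"
  where "smooth_boundary \<Omega> \<longleftrightarrow>
    (\<forall>x0\<in>frontier \<Omega>. \<exists>r>0. \<exists>e \<gamma>. norm e = 1 \<and> smooth_fun_on UNIV \<gamma> \<and>
       \<Omega> \<inter> ball x0 r = {x \<in> ball x0 r. \<gamma> (x - (x \<bullet> e) *\<^sub>R e) < x \<bullet> e})"

definition bounded_smooth_domain :: "(real^'n) set \<Rightarrow> bool"
  where "bounded_smooth_domain \<Omega> \<longleftrightarrow>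
    open \<Omega> \<and> connected \<Omega> \<and> \<Omega> \<noteq> {} \<and> bounded \<Omega> \<and> smooth_boundary \<Omega>"

definition C0_closure :: "(real^'n) set \<Rightarrow> (real^'n \<Rightarrow> real) set"
  where "C0_closure \<Omega> = {u. continuous_on (closure \<Omega>) u \<and> (\<forall>x\<in>frontier \<Omega>. u x = 0)}"

text \<open>Norms are real-valued, hence only meaningful on the corresponding space.\<close>

definition Lp_space :: "real \<Rightarrow> (real^'n) set \<Rightarrow> (real^'n \<Rightarrow> 'b::real_normed_vector) set"
  where "Lp_space r \<Omega> = {f. f \<in> borel_measurable (lebesgue_on \<Omega>) \<and>
    integrable (lebesgue_on \<Omega>) (\<lambda>x. norm (f x) powr r)}"

definition Lp_norm :: "real \<Rightarrow> (real^'n) set \<Rightarrow> (real^'n \<Rightarrow> 'b::real_normed_vector) \<Rightarrow> real"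
  where "Lp_norm r \<Omega> f = (LINT x|lebesgue_on \<Omega>. norm (f x) powr r) powr (1 / r)"

definition Linf_space :: "(real^'n) set \<Rightarrow> (real^'n \<Rightarrow> 'b::real_normed_vector) set"
  where "Linf_space \<Omega> = {f. f \<in> borel_measurable (lebesgue_on \<Omega>) \<and>
    esssup (lebesgue_on \<Omega>) (\<lambda>x. ereal (norm (f x))) < \<infinity>}"

definition Linf_norm :: "(real^'n) set \<Rightarrow> (real^'n \<Rightarrow> 'b::real_normed_vector) \<Rightarrow> real"
  where "Linf_norm \<Omega> f = real_of_ereal (esssup (lebesgue_on \<Omega>) (\<lambda>x. ereal (norm (f x))))"

definition test_functions :: "(real^'n) set \<Rightarrow> (real^'n \<Rightarrow> real) set"
  where "test_functions \<Omega> = {\<phi>. smooth_fun_on UNIV \<phi> \<and>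
    compact (closure {x. \<phi> x \<noteq> 0}) \<and> closure {x. \<phi> x \<noteq> 0} \<subseteq> \<Omega>}"

definition locally_integrable ::
  "(real^'n) set \<Rightarrow> (real^'n \<Rightarrow> 'b::{banach, second_countable_topology}) \<Rightarrow> bool"
  where "locally_integrable \<Omega> f \<longleftrightarrow> (\<forall>K. compact K \<and> K \<subseteq> \<Omega> \<longrightarrow> set_integrable lebesgue K f)"

text \<open>A relation, because the weak gradient is determined only almost everywhere.\<close>

definition has_weak_gradient ::
  "(real^'n) set \<Rightarrow> (real^'n \<Rightarrow> real) \<Rightarrow> (real^'n \<Rightarrow> real^'n) \<Rightarrow> bool"
  where "has_weak_gradient \<Omega> u g \<longleftrightarrow> locally_integrable \<Omega> u \<and> locally_integrable \<Omega> g \<and>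
    (\<forall>\<phi>\<in>test_functions \<Omega>. \<forall>i.
       (LINT x|lebesgue_on \<Omega>. u x * partial_deriv i \<phi> x) =
       - (LINT x|lebesgue_on \<Omega>. g x $ i * \<phi> x))"

definition W1_inf :: "(real^'n) set \<Rightarrow> (real^'n \<Rightarrow> real) set"
  where "W1_inf \<Omega> = {u. u \<in> Linf_space \<Omega> \<and> (\<exists>g\<in>Linf_space \<Omega>. has_weak_gradient \<Omega> u g)}"

text \<open>The closure of the test functions in the norm of \<open>W\<^sup>1\<^sup>,\<^sup>p(\<Omega>)\<close>.\<close>

definition W1p_0 :: "real \<Rightarrow> (real^'n) set \<Rightarrow> (real^'n \<Rightarrow> real) set"
  where "W1p_0 p \<Omega> = {u. u \<in> Lp_space p \<Omega> \<and>
    (\<exists>g\<in>Lp_space p \<Omega>. has_weak_gradient \<Omega> u g \<and>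
      (\<exists>\<phi>::nat \<Rightarrow> real^'n \<Rightarrow> real. (\<forall>k. \<phi> k \<in> test_functions \<Omega>) \<and>
         (\<lambda>k. Lp_norm p \<Omega> (\<lambda>x. \<phi> k x - u x)) \<longlonglongrightarrow> 0 \<and>
         (\<lambda>k. Lp_norm p \<Omega> (\<lambda>x. grad (\<phi> k) x - g x)) \<longlonglongrightarrow> 0))}"

definition sobolev_lambda :: "(real^'n) set \<Rightarrow> real \<Rightarrow> real \<Rightarrow> real"
  where "sobolev_lambda \<Omega> p q =
    Inf {Lp_norm p \<Omega> g powr p | u g.
           u \<in> W1p_0 p \<Omega> \<and> has_weak_gradient \<Omega> u g \<and> Lp_norm q \<Omega> u = 1}"

text \<open>Continuity on the closure singles out the representative used for \<open>p > N\<close>.\<close>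

definition sobolev_extremal ::
  "(real^'n) set \<Rightarrow> real \<Rightarrow> real \<Rightarrow> (real^'n \<Rightarrow> real) \<Rightarrow> bool"
  where "sobolev_extremal \<Omega> p q u \<longleftrightarrow>
    u \<in> W1p_0 p \<Omega> \<and> continuous_on (closure \<Omega>) u \<and> (\<forall>x\<in>\<Omega>. 0 < u x) \<and>
    Lp_norm q \<Omega> u = 1 \<and>
    (\<exists>g. has_weak_gradient \<Omega> u g \<and> Lp_norm p \<Omega> g powr p = sobolev_lambda \<Omega> p q)"

definition inf_laplacian :: "(real^'n \<Rightarrow> real) \<Rightarrow> real^'n \<Rightarrow> real"
  where "inf_laplacian \<phi> x = (\<Sum>i\<in>UNIV. \<Sum>j\<in>UNIV.
    partial_deriv i \<phi> x * partial_deriv j \<phi> x * partial_deriv j (partial_deriv i \<phi>) x)"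

definition inf_supersolution :: "(real^'n) set \<Rightarrow> (real^'n \<Rightarrow> real) \<Rightarrow> bool"
  where "inf_supersolution D u \<longleftrightarrow> continuous_on D u \<and>
    (\<forall>x0\<in>D. \<forall>r>0. \<forall>\<phi>. ball x0 r \<subseteq> D \<and> Ck_on 2 (ball x0 r) \<phi> \<and> \<phi> x0 - u x0 = 0 \<and>
       (\<forall>x\<in>ball x0 r - {x0}. \<phi> x - u x < 0) \<longrightarrow> - inf_laplacian \<phi> x0 \<ge> 0)"

definition inf_subsolution :: "(real^'n) set \<Rightarrow> (real^'n \<Rightarrow> real) \<Rightarrow> bool"
  where "inf_subsolution D u \<longleftrightarrow> continuous_on D u \<and>
    (\<forall>x0\<in>D. \<forall>r>0. \<forall>\<phi>. ball x0 r \<subseteq> D \<and> Ck_on 2 (ball x0 r) \<phi> \<and> \<phi> x0 - u x0 = 0 \<and>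
       (\<forall>x\<in>ball x0 r - {x0}. \<phi> x - u x > 0) \<longrightarrow> - inf_laplacian \<phi> x0 \<le> 0)"

definition infinity_harmonic :: "(real^'n) set \<Rightarrow> (real^'n \<Rightarrow> real) \<Rightarrow> bool"
  where "infinity_harmonic D u \<longleftrightarrow> inf_supersolution D u \<and> inf_subsolution D u"

definition viscosity_solution_problem ::
  "(real^'n) set \<Rightarrow> (real^'n) set \<Rightarrow> (real^'n \<Rightarrow> real) \<Rightarrow> bool"
  where "viscosity_solution_problem \<Omega> M u \<longleftrightarrow> continuous_on (closure \<Omega>) u \<and>
    open (\<Omega> - M) \<and> infinity_harmonic (\<Omega> - M) u \<and> (\<forall>x\<in>frontier \<Omega>. u x = 0) \<and> (\<forall>x\<in>M. u x = 1)"

definition dist_bd :: "(real^'n) set \<Rightarrow> real^'n \<Rightarrow> real"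
  where "dist_bd \<Omega> x = infdist x (frontier \<Omega>)"

definition dist_max_set :: "(real^'n) set \<Rightarrow> (real^'n) set"
  where "dist_max_set \<Omega> = {x\<in>\<Omega>. dist_bd \<Omega> x = Linf_norm \<Omega> (dist_bd \<Omega>)}"

definition dist_ridge_set :: "(real^'n) set \<Rightarrow> (real^'n) set"
  where "dist_ridge_set \<Omega> = {x\<in>\<Omega>. \<not> dist_bd \<Omega> differentiable (at x)}"

end

theory Submission
  imports Defs "HOL-Computational_Algebra.Polynomial"
begin

text \<open>The limit \<open>u\<close> inherits both viscosity inequalities directly from minimality, without passing through
  the Euler--Lagrange equation. Suppose a test function violates one of them at \<open>x\<^sub>0\<close>. It may be replaced by
  a polynomial \<open>v\<close> that touches \<open>u\<close> strictly, and only at \<open>x\<^sub>0\<close>. Pushing \<open>u\<^sub>p\<close> across \<open>v\<close> near \<open>x\<^sub>0\<close> lowers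
  the Dirichlet energy, by convexity, by at least the integral of \<open>p \<Delta>\<^sub>p v\<close> against the
  perturbation, while the \<open>L\<^sup>q\<close> norm does not decrease (pushing up) or decreases only by a term of order
  \<open>q \<theta>\<^sup>q\<close>, \<open>\<theta> < 1\<close> (pushing down, away from \<open>M\<close>); since \<open>q/p \<rightarrow> \<infinity>\<close> this contradicts minimality.

  With \<open>R = \<parallel>d\<parallel>\<^sub>\<infinity>\<close>, testing with a cone gives \<open>limsup \<lambda>\<^sup>1\<^sup>/\<^sup>p \<le> 1/R\<close>, so comparing averages over translated
  boxes shows that \<open>u\<close>, extended by zero, is Lipschitz with constant \<open>1/R\<close>. If \<open>M\<close>, the maximum set and the ridge of \<open>d\<close>
  coincide, every point lies on a segment of length \<open>R\<close> from the boundary to \<open>M\<close>, along which \<open>u\<close> must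
  then be linear; hence \<open>u = d/R\<close>. Conversely, if \<open>u = d/R\<close>, a point outside \<open>M\<close> with two nearest boundary points
  would violate the subsolution property, so \<open>d\<close> is differentiable off \<open>M\<close>.\<close>

section \<open>Smooth functions and test functions\<close>

text \<open>An extremal is accessible only as a limit of test functions whose energies approach
  \<lambda>, so every comparison is made on smooth approximants at fixed p and then passed to the
  limit. This shapes the tools: the perturbation must itself be a test function, hence a smooth
  positive part with slope in [0,1] instead of a maximum, and v must be smooth on the whole space,
  hence a polynomial. The decisive point is that the energy gained and the norm lost are both linear
  in the integral H of the perturbation. For large p the gain is at least p m^(p-4) H, with m a
  lower bound of |grad v|; pushing down costs at most \<lambda> q \<theta>^(q-1) H with \<lambda>
  \<le> B L^p. After H cancels, the contradiction needs (L/m)^p q \<theta>^q to tend to 0. As L/m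
  may be large, the decay in q has to beat every exponential in p, which is what the growth of q/p
  provides. The Lipschitz bound must hold for the Euclidean distance although the domain may fail to
  be convex. Extension by zero lets segments leave the domain, and box averages make the bound
  depend on gradients only through the total energy.\<close>

lemma partial_deriv_eqI:
  "(f has_derivative f') (at x) \<Longrightarrow> partial_deriv i f x = f' (axis i 1)"
  by (simp add: partial_deriv_def frechet_derivative_at[symmetric])

lemma has_derivative_partial:
  fixes f :: "real^'n \<Rightarrow> real"
  assumes "f differentiable (at x)"
  shows "(f has_derivative (\<lambda>h. \<Sum>i\<in>UNIV. h $ i * partial_deriv i f x)) (at x)"
proof -
  let ?D = "frechet_derivative f (at x)"
  have D: "(f has_derivative ?D) (at x)" using assms frechet_derivative_works by blast
  interpret D: bounded_linear ?D by (rule has_derivative_bounded_linear[OF D])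
  have "?D h = (\<Sum>i\<in>UNIV. h $ i * partial_deriv i f x)" for h
  proof -
    have "?D h = ?D (\<Sum>i\<in>UNIV. h $ i *\<^sub>R axis i 1)"
      using basis_expansion[of h] by (simp add: scalar_mult_eq_scaleR)
    also have "\<dots> = (\<Sum>i\<in>UNIV. h $ i * ?D (axis i 1))" by (simp add: D.sum D.scaleR)
    finally show ?thesis by (simp add: partial_deriv_def)
  qed
  then have "?D = (\<lambda>h. \<Sum>i\<in>UNIV. h $ i * partial_deriv i f x)" by auto
  then show ?thesis using D by simp
qed

lemma has_derivative_grad:
  "f differentiable (at x) \<Longrightarrow> (f has_derivative (\<lambda>h. grad f x \<bullet> h)) (at x)"
  using has_derivative_partial[of f x]
  by (simp add: grad_def inner_vec_def mult.commute)

lemma grad_eqI: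
  assumes "(f has_derivative (\<lambda>h. a \<bullet> h)) (at x)"
  shows "grad f x = a"
  by (simp add: vec_eq_iff grad_def partial_deriv_eqI[OF assms] inner_axis)

lemma Ck_on_Suc_imp: "Ck_on (Suc k) S f \<Longrightarrow> Ck_on k S f"
proof (induction k arbitrary: f)
  case 0
  then show ?case
    by (auto intro!: continuous_at_imp_continuous_on differentiable_imp_continuous_within)
qed auto

lemma Ck_on_UNIV_const: "Ck_on k UNIV (\<lambda>x::real^'n. c)"
proof (induction k arbitrary: c)
  case (Suc k)
  have "partial_deriv i (\<lambda>x::real^'n. c) = (\<lambda>x. 0)" for i
    by (rule ext, rule partial_deriv_eqI[THEN trans]) (auto intro: derivative_eq_intros)
  then show ?case using Suc by auto
qed simp

lemma Ck_on_UNIV_inner: "Ck_on k UNIV (\<lambda>x::real^'n. x \<bullet> c)"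
proof (cases k)
  case (Suc j)
  have "partial_deriv i (\<lambda>x::real^'n. x \<bullet> c) = (\<lambda>x. axis i 1 \<bullet> c)" for i
    by (rule ext, rule partial_deriv_eqI) (auto intro!: derivative_eq_intros)
  then show ?thesis using Suc Ck_on_UNIV_const by (auto intro!: derivative_intros)
qed (auto intro!: continuous_intros)

lemma partial_deriv_add:
  "f differentiable (at x) \<Longrightarrow> g differentiable (at x) \<Longrightarrow>
    partial_deriv i (\<lambda>x. f x + g x) x = partial_deriv i f x + partial_deriv i g x"
  unfolding frechet_derivative_works
  by (rule partial_deriv_eqI[THEN trans], rule has_derivative_add) (auto simp: partial_deriv_def)

lemma partial_deriv_mult:
  "f differentiable (at x) \<Longrightarrow> g differentiable (at x) \<Longrightarrow>
    partial_deriv i (\<lambda>x. f x * g x) x = f x * partial_deriv i g x + partial_deriv i f x * g x"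
  unfolding frechet_derivative_works
  by (rule partial_deriv_eqI[THEN trans], rule has_derivative_mult) (auto simp: partial_deriv_def)

lemma partial_deriv_compose:
  assumes "f differentiable (at x)" "(h has_real_derivative d) (at (f x))"
  shows "partial_deriv i (\<lambda>x. h (f x)) x = d * partial_deriv i f x"
    and "(\<lambda>x. h (f x)) differentiable (at x)"
proof -
  have "((\<lambda>x. h (f x)) has_derivative (\<lambda>y. d * frechet_derivative f (at x) y)) (at x)"
    using assms(1)[unfolded frechet_derivative_works] assms(2)
    by (auto simp: has_field_derivative_def intro: has_derivative_compose)
  then show "partial_deriv i (\<lambda>x. h (f x)) x = d * partial_deriv i f x"
    "(\<lambda>x. h (f x)) differentiable (at x)"
    by (auto simp: partial_deriv_eqI partial_deriv_def[of i f] differentiable_def)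
qed

lemma Ck_on_UNIV_add:
  "Ck_on k UNIV f \<Longrightarrow> Ck_on k UNIV g \<Longrightarrow> Ck_on k UNIV (\<lambda>x. f x + g x)"
proof (induction k arbitrary: f g)
  case (Suc k)
  then have "partial_deriv i (\<lambda>x. f x + g x) = (\<lambda>x. partial_deriv i f x + partial_deriv i g x)" for i
    by (intro ext partial_deriv_add) auto
  with Suc show ?case by auto
qed (auto intro: continuous_intros)

lemma Ck_on_UNIV_mult:
  "Ck_on k UNIV f \<Longrightarrow> Ck_on k UNIV g \<Longrightarrow> Ck_on k UNIV (\<lambda>x. f x * g x)"
proof (induction k arbitrary: f g)
  case (Suc k)
  then have "partial_deriv i (\<lambda>x. f x * g x) = (\<lambda>x. f x * partial_deriv i g x + partial_deriv i f x * g x)" for i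
    by (intro ext partial_deriv_mult) auto
  moreover have "Ck_on k UNIV f" "Ck_on k UNIV g" using Suc Ck_on_Suc_imp by blast+
  ultimately show ?case using Suc by (auto intro!: Ck_on_UNIV_add)
qed (auto intro: continuous_intros)

text \<open>The outer function enters as the whole sequence of its derivatives, so that the
  induction can pass to the shifted sequence. Derivatives are asked for only at values of
  \<open>f\<close>, which admits functions smooth on a half-line, such as the square root of a
  positive \<open>f\<close>.\<close>

lemma Ck_on_UNIV_compose:
  assumes "\<And>j x. (h j has_real_derivative h (Suc j) (f x)) (at (f x))"
    and "Ck_on k UNIV f"
  shows "Ck_on k UNIV (\<lambda>x. h (0::nat) (f x))"
  using assms
proof (induction k arbitrary: h)
  case 0
  have "isCont (h 0) (f x)" for x using 0(1) DERIV_isCont by blast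
  then have "continuous_on (range f) (h 0)" by (auto simp: continuous_at_imp_continuous_on)
  then show ?case using 0 by (auto intro: continuous_on_compose2)
next
  case (Suc k)
  have diff: "f differentiable (at x)" for x using Suc.prems(2) by auto
  have p: "partial_deriv i (\<lambda>x. h 0 (f x)) = (\<lambda>x. h (Suc 0) (f x) * partial_deriv i f x)" for i
    by (intro ext partial_deriv_compose(1) diff Suc.prems(1))
  have "Ck_on k UNIV (\<lambda>x. h (Suc 0) (f x))"
    using Suc.IH[of "\<lambda>j. h (Suc j)"] Suc.prems Ck_on_Suc_imp by blast
  then show ?case
    using Suc.prems partial_deriv_compose(2)[OF diff Suc.prems(1)]
    by (auto simp: p intro!: Ck_on_UNIV_mult)
qed

lemma smooth_const: "smooth_fun_on UNIV (\<lambda>x::real^'n. c)"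
  and smooth_inner: "smooth_fun_on UNIV (\<lambda>x::real^'n. x \<bullet> a)"
  and smooth_add: "smooth_fun_on UNIV f \<Longrightarrow> smooth_fun_on UNIV g \<Longrightarrow> smooth_fun_on UNIV (\<lambda>x. f x + g x)"
  and smooth_mult: "smooth_fun_on UNIV f \<Longrightarrow> smooth_fun_on UNIV g \<Longrightarrow> smooth_fun_on UNIV (\<lambda>x. f x * g x)"
  by (auto simp: smooth_fun_on_def Ck_on_UNIV_const Ck_on_UNIV_inner Ck_on_UNIV_add Ck_on_UNIV_mult)

lemma smooth_compose:
  assumes "\<And>j x. (h j has_real_derivative h (Suc j) (f x)) (at (f x))"
    and "smooth_fun_on UNIV f"
  shows "smooth_fun_on UNIV (\<lambda>x. h (0::nat) (f x))"
  using assms by (auto simp: smooth_fun_on_def intro: Ck_on_UNIV_compose)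

lemma smooth_diff:
  assumes "smooth_fun_on UNIV f" "smooth_fun_on UNIV g"
  shows "smooth_fun_on UNIV (\<lambda>x. f x - g x)"
  using smooth_add[OF assms(1) smooth_mult[OF smooth_const[of "-1"] assms(2)]] by simp

lemma smooth_sum:
  "finite A \<Longrightarrow> (\<And>a. a \<in> A \<Longrightarrow> smooth_fun_on UNIV (f a)) \<Longrightarrow> smooth_fun_on UNIV (\<lambda>x. \<Sum>a\<in>A. f a x)"
  by (induction A rule: finite_induct) (auto intro: smooth_const smooth_add)

lemma smooth_prod:
  "finite A \<Longrightarrow> (\<And>a. a \<in> A \<Longrightarrow> smooth_fun_on UNIV (f a)) \<Longrightarrow> smooth_fun_on UNIV (\<lambda>x. \<Prod>a\<in>A. f a x)"
  by (induction A rule: finite_induct) (auto intro: smooth_const smooth_mult)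

lemma smooth_dist2: "smooth_fun_on UNIV (\<lambda>x::real^'n. (norm (x - a))\<^sup>2)"
proof -
  have "(norm (x - a))\<^sup>2 = (\<Sum>i\<in>UNIV. (x \<bullet> axis i 1 - a $ i) * (x \<bullet> axis i 1 - a $ i))" for x
    by (simp only: power2_norm_eq_inner inner_axis) (simp add: inner_vec_def)
  then show ?thesis
    by (auto intro!: smooth_sum smooth_mult smooth_diff smooth_inner smooth_const)
qed

lemma smooth_imp_differentiable: "smooth_fun_on UNIV f \<Longrightarrow> f differentiable (at x)"
  unfolding smooth_fun_on_def using Ck_on.simps(2)[of 0 UNIV f] by blast

lemma smooth_partial: "smooth_fun_on UNIV f \<Longrightarrow> smooth_fun_on UNIV (partial_deriv i f)"
  by (auto simp: smooth_fun_on_def) (metis Ck_on.simps(2))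

lemma smooth_imp_continuous: "smooth_fun_on UNIV f \<Longrightarrow> continuous_on A f"
  unfolding smooth_fun_on_def using Ck_on.simps(1) continuous_on_subset by blast

lemma smooth_continuous_grad: "smooth_fun_on UNIV f \<Longrightarrow> continuous_on A (grad f)"
  unfolding grad_def by (intro continuous_on_vec_lambda smooth_imp_continuous smooth_partial)

section \<open>A flat function and a smooth positive part\<close>

definition flat_exp :: "real \<Rightarrow> real"
  where "flat_exp t = (if t > 0 then exp (- 1 / t) else 0)"

text \<open>For t > 0 the j-th derivative of exp (-1/t) is P(1/t) exp (-1/t) for a polynomial P;
  differentiating once more replaces P(s) by s^2 (P(s) - P'(s)).\<close>

primrec flat_poly :: "nat \<Rightarrow> real poly"
  where "flat_poly 0 = 1"
  | "flat_poly (Suc j) = [:0, 0, 1:] * (flat_poly j - pderiv (flat_poly j))"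

definition flat_exp_deriv :: "nat \<Rightarrow> real \<Rightarrow> real"
  where "flat_exp_deriv j t = poly (flat_poly j) (1 / t) * flat_exp t"

lemma poly_div_exp_tendsto_0: "((\<lambda>s. poly P s / exp s) \<longlongrightarrow> (0::real)) at_top"
proof -
  have "((\<lambda>s. \<Sum>i\<le>degree P. coeff P i * (s ^ i / exp s)) \<longlongrightarrow> (\<Sum>i\<le>degree P. coeff P i * 0)) at_top"
    by (intro tendsto_intros tendsto_power_div_exp_0)
  then show ?thesis by (simp add: poly_altdef sum_divide_distrib)
qed

lemma flat_exp_deriv_has_derivative:
  "(flat_exp_deriv j has_real_derivative flat_exp_deriv (Suc j) t) (at t)"
proof -
  consider "t > 0" | "t < 0" | "t = 0" by linarith
  then show ?thesis
  proof cases
    case 1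
    have "((\<lambda>t. poly (flat_poly j) (1 / t) * exp (- 1 / t)) has_real_derivative flat_exp_deriv (Suc j) t) (at t)"
      using 1 by (auto intro!: derivative_eq_intros poly_DERIV[THEN DERIV_chain2]
          simp: flat_exp_deriv_def flat_exp_def field_simps power2_eq_square)
    moreover have "eventually (\<lambda>s. s > 0) (nhds t)"
      using 1 eventually_nhds_in_open[of "{0<..}" t] by simp
    ultimately show ?thesis
      by (subst DERIV_cong_ev[OF refl _ refl])
        (auto elim!: eventually_mono simp: flat_exp_deriv_def flat_exp_def)
  next
    case 2
    then have "eventually (\<lambda>s. s < 0) (nhds t)"
      using eventually_nhds_in_open[of "{..<0}" t] by simp
    then have "eventually (\<lambda>s. flat_exp_deriv j s = 0) (nhds t)"
      by (auto elim!: eventually_mono simp: flat_exp_deriv_def flat_exp_def)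
    then show ?thesis using 2
      by (subst DERIV_cong_ev[OF refl _ refl, where g = "\<lambda>_. 0"])
        (auto simp: flat_exp_deriv_def flat_exp_def)
  next
    case 3
    \<comment> \<open>For h > 0 the difference quotient at 0 is s P(s) exp (-s) with s = 1/h; the
      additional factor s, from the division by h, is the \<open>pCons 0\<close>.\<close>
    let ?P = "pCons 0 (flat_poly j)"
    have "((\<lambda>h. poly ?P (inverse h) / exp (inverse h)) \<longlongrightarrow> 0) (at_right 0)"
      by (rule filterlim_compose[OF poly_div_exp_tendsto_0 filterlim_inverse_at_top_right])
    moreover have "eventually (\<lambda>h. poly ?P (inverse h) / exp (inverse h) = flat_exp_deriv j h / h) (at_right 0)"
      using eventually_at_right_less[of "0::real"]
      by eventually_elim (simp add: flat_exp_deriv_def flat_exp_def field_simps exp_minus)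
    ultimately have r: "((\<lambda>h. flat_exp_deriv j h / h) \<longlongrightarrow> 0) (at_right 0)"
      by (rule Lim_transform_eventually)
    have l: "((\<lambda>h. flat_exp_deriv j h / h) \<longlongrightarrow> 0) (at_left 0)"
      by (rule tendsto_eventually) (auto simp: eventually_at_left_field flat_exp_deriv_def flat_exp_def
          intro!: exI[of _ "-1"])
    have "((\<lambda>h. flat_exp_deriv j h / h) \<longlongrightarrow> 0) (at 0)"
      using r l filterlim_split_at by blast
    then show ?thesis unfolding DERIV_def 3 by (simp add: flat_exp_deriv_def flat_exp_def)
  qed
qed

lemma flat_exp_deriv_0: "flat_exp_deriv 0 = flat_exp"
  by (auto simp: flat_exp_deriv_def)

lemma smooth_flat_exp: "smooth_fun_on UNIV f \<Longrightarrow> smooth_fun_on UNIV (\<lambda>x. flat_exp (f x))"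
  using smooth_compose[of flat_exp_deriv f] flat_exp_deriv_has_derivative by (simp add: flat_exp_deriv_0)

text \<open>A smooth stand-in for max(t, 0). The factor t makes the slope (1 + s) exp (-s) with s =
  1/t, hence between 0 and 1; this is what turns a truncation into a convex combination of
  gradients.\<close>

definition soft_pos :: "real \<Rightarrow> real"
  where "soft_pos t = t * flat_exp t"

definition soft_pos' :: "real \<Rightarrow> real"
  where "soft_pos' t = (if t > 0 then (1 + 1 / t) * exp (- 1 / t) else 0)"

lemma soft_pos_has_derivative: "(soft_pos has_real_derivative soft_pos' t) (at t)"
proof -
  have "(flat_exp has_real_derivative flat_exp_deriv (Suc 0) t) (at t)"
    using flat_exp_deriv_has_derivative[of 0 t] by (simp add: flat_exp_deriv_0)
  from DERIV_mult[OF DERIV_ident this]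
  have "((\<lambda>t. t * flat_exp t) has_real_derivative 1 * flat_exp t + flat_exp_deriv (Suc 0) t * t) (at t)" .
  moreover have "1 * flat_exp t + flat_exp_deriv (Suc 0) t * t = soft_pos' t"
    by (auto simp: flat_exp_deriv_def flat_exp_def soft_pos'_def field_simps pderiv_1)
  ultimately show ?thesis by (simp add: soft_pos_def[abs_def])
qed

lemma soft_pos'_bounds: "0 \<le> soft_pos' t" "soft_pos' t \<le> 1"
proof -
  show "0 \<le> soft_pos' t" by (auto simp: soft_pos'_def)
  show "soft_pos' t \<le> 1"
  proof (cases "t > 0")
    case True
    have "(1 + 1/t) * exp (-1/t) \<le> exp (1/t) * exp (-1/t)"
      by (intro mult_right_mono exp_ge_add_one_self) auto
    also have "\<dots> = 1" by (simp flip: exp_add)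
    finally show ?thesis by (simp add: soft_pos'_def)
  qed (auto simp: soft_pos'_def)
qed

lemma smooth_soft_pos: "smooth_fun_on UNIV f \<Longrightarrow> smooth_fun_on UNIV (\<lambda>x. soft_pos (f x))"
  unfolding soft_pos_def by (intro smooth_mult smooth_flat_exp)

lemma soft_pos_nonneg: "0 \<le> soft_pos t"
  and soft_pos_pos: "0 < t \<Longrightarrow> 0 < soft_pos t"
  and soft_pos_0: "t \<le> 0 \<Longrightarrow> soft_pos t = 0"
  by (auto simp: soft_pos_def flat_exp_def)

lemma soft_pos_ge: "t - 1 \<le> soft_pos t"
proof (cases "t > 0")
  case True
  have "t * (1 + (- 1 / t)) \<le> t * exp (- 1 / t)"
    using True by (intro mult_left_mono exp_ge_add_one_self) auto
  then show ?thesis using True by (simp add: soft_pos_def flat_exp_def right_diff_distrib)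
qed (auto simp: soft_pos_def flat_exp_def)

lemma soft_pos_lipschitz: "\<bar>soft_pos s - soft_pos t\<bar> \<le> \<bar>s - t\<bar>"
  using field_differentiable_bound[of UNIV soft_pos soft_pos' 1 s t]
    soft_pos_has_derivative soft_pos'_bounds by auto

lemma continuous_on_soft_pos: "continuous_on A soft_pos"
  using soft_pos_has_derivative DERIV_continuous_on by (metis has_field_derivative_at_within)

lemma has_derivative_outside_closed:
  assumes "closed K" "\<And>x. x \<notin> K \<Longrightarrow> f x = (0::real)" "x \<notin> K"
  shows "(f has_derivative (\<lambda>h. 0)) (at x)"
proof -
  have "((\<lambda>x. 0) has_derivative (\<lambda>h. 0)) (at x)" by simp
  then show ?thesis
    by (rule has_derivative_transform_within_open[OF _ open_Compl[OF assms(1)]])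
      (use assms(2,3) in auto)
qed

lemma test_functionI:
  assumes "smooth_fun_on UNIV \<psi>" "compact K" "K \<subseteq> \<Omega>" "\<And>x. x \<notin> K \<Longrightarrow> \<psi> x = 0"
  shows "\<psi> \<in> test_functions \<Omega>"
proof -
  have "closure {x. \<psi> x \<noteq> 0} \<subseteq> K"
    using assms by (intro closure_minimal) (auto intro: compact_imp_closed)
  then show ?thesis
    using assms compact_Int_closed[of K "closure {x. \<psi> x \<noteq> 0}"]
    by (auto simp: test_functions_def Int_absorb1)
qed

lemma test_functionE:
  assumes "\<psi> \<in> test_functions \<Omega>"
  obtains K where "smooth_fun_on UNIV \<psi>" "compact K" "K \<subseteq> \<Omega>" "\<And>x. x \<notin> K \<Longrightarrow> \<psi> x = 0"
    "\<And>x. x \<notin> K \<Longrightarrow> grad \<psi> x = 0"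
proof
  let ?K = "closure {x. \<psi> x \<noteq> 0}"
  show "smooth_fun_on UNIV \<psi>" "compact ?K" "?K \<subseteq> \<Omega>" using assms by (auto simp: test_functions_def)
  show 0: "\<psi> x = 0" if "x \<notin> ?K" for x
    using that closure_subset[of "{x. \<psi> x \<noteq> 0}"] by blast
  show "grad \<psi> x = 0" if "x \<notin> ?K" for x
  proof (rule grad_eqI)
    have "(\<psi> has_derivative (\<lambda>h. 0)) (at x)"
      by (rule has_derivative_outside_closed[OF closed_closure 0 that])
    then show "(\<psi> has_derivative (\<lambda>h. 0 \<bullet> h)) (at x)" by simp
  qed
qed

section \<open>Integration by parts and convexity of the energy\<close>

lemma integrable_lebesgue_on_continuous:
  fixes f :: "'a::euclidean_space \<Rightarrow> 'b::euclidean_space"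
  assumes "bounded S" "S \<in> sets lebesgue" "continuous_on (closure S) f"
  shows "integrable (lebesgue_on S) f"
proof -
  have "compact (f ` closure S)"
    using assms by (intro compact_continuous_image) auto
  then obtain B where B: "\<And>x. x \<in> closure S \<Longrightarrow> norm (f x) \<le> B"
    using compact_imp_bounded bounded_iff by (metis image_eqI)
  have "S \<in> lmeasurable" using assms bounded_set_imp_lmeasurable by blast
  then interpret finite_measure "lebesgue_on S" by (rule finite_measure_lebesgue_on)
  show ?thesis
  proof (rule integrable_const_bound)
    show "AE x in lebesgue_on S. norm (f x) \<le> B"
      using B closure_subset by (intro AE_I2) auto
    show "f \<in> borel_measurable (lebesgue_on S)"
      using assms continuous_on_subset closure_subset by (blast intro: continuous_imp_measurable_on_sets_lebesgue)
  qed
qed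

lemma partial_deriv_along:
  assumes "f differentiable (at (x + t *\<^sub>R axis i 1))"
  shows "((\<lambda>t. f (x + t *\<^sub>R axis i 1)) has_real_derivative partial_deriv i f (x + t *\<^sub>R axis i 1)) (at t)"
proof -
  let ?D = "frechet_derivative f (at (x + t *\<^sub>R axis i 1))"
  have D: "(f has_derivative ?D) (at (x + t *\<^sub>R axis i 1))"
    using assms frechet_derivative_works by blast
  have "((\<lambda>t. x + t *\<^sub>R axis i 1) has_derivative (\<lambda>s. s *\<^sub>R axis i 1)) (at t)"
    by (auto intro!: derivative_eq_intros)
  from has_derivative_compose[OF this D]
  have "((\<lambda>t. f (x + t *\<^sub>R axis i 1)) has_derivative (\<lambda>s. ?D (s *\<^sub>R axis i 1))) (at t)" .
  moreover have "?D (s *\<^sub>R axis i 1) = partial_deriv i f (x + t *\<^sub>R axis i 1) * s" for s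
    using linear_frechet_derivative[OF assms] by (simp add: linear_scale partial_deriv_def)
  ultimately show ?thesis by (simp add: has_field_derivative_def mult_commute_abs)
qed

lemma integral_UNIV_translate:
  fixes f :: "'a::euclidean_space \<Rightarrow> real"
  assumes "continuous_on UNIV f" "\<And>x. x \<notin> cbox a b \<Longrightarrow> f x = 0"
    and "cbox (a - c) (b - c) \<subseteq> cbox a' b'"
  shows "integral (cbox a' b') (\<lambda>x. f (x + c)) = integral (cbox a b) f"
proof -
  have "integral (cbox a' b') (\<lambda>x. f (x + c)) = integral (cbox (a - c) (b - c)) (\<lambda>x. f (x + c))"
  proof (rule integral_spike_set)
    have "f (x + c) = 0" if "x \<notin> cbox (a - c) (b - c)" for x
    proof (rule assms(2))
      show "x + c \<notin> cbox a b" using that by (auto simp: mem_box inner_diff_left inner_add_left algebra_simps)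
    qed
    then have "{x \<in> cbox a' b' - cbox (a - c) (b - c). f (x + c) \<noteq> 0} = {}" by auto
    then show "negligible {x \<in> cbox a' b' - cbox (a - c) (b - c). f (x + c) \<noteq> 0}"
      by (metis negligible_empty)
    have "{x \<in> cbox (a - c) (b - c) - cbox a' b'. f (x + c) \<noteq> 0} = {}" using assms(3) by auto
    then show "negligible {x \<in> cbox (a - c) (b - c) - cbox a' b'. f (x + c) \<noteq> 0}"
      by (metis negligible_empty)
  qed
  then show ?thesis by (simp add: integral_shift_cbox)
qed

text \<open>The integral of \<open>f\<close> over a large box does not change when \<open>f\<close> is shifted along the
  \<open>i\<close>-th axis; differentiate under the integral sign.\<close>

lemma integral_partial_deriv_eq_0:
  fixes f :: "real^'n \<Rightarrow> real"
  assumes df: "\<And>x. f differentiable (at x)" and c: "continuous_on UNIV (partial_deriv i f)"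
    and S: "bounded S" "S \<in> sets lebesgue" and K: "closed K" "K \<subseteq> S" "\<And>x. x \<notin> K \<Longrightarrow> f x = 0"
  shows "(LINT x|lebesgue_on S. partial_deriv i f x) = 0"
proof -
  let ?e = "axis i 1 :: real^'n"
  obtain a where a: "S \<subseteq> cbox (-a) a" using bounded_subset_cbox_symmetric[OF S(1)] by blast
  \<comment> \<open>A margin of 1 in every coordinate keeps the shifted support inside the larger
    box for all |t| < 1, so \<open>A\<close> is constant near 0.\<close>
  let ?o = "1 :: real^'n"
  let ?a = "- a - ?o" and ?b = "a + ?o"
  have out: "f x = 0" if "x \<notin> cbox (-a) a" for x using that a K by blast
  have cf: "continuous_on UNIV f"
    using df by (auto intro!: continuous_at_imp_continuous_on differentiable_imp_continuous_within)
  define A where "A t = integral (cbox ?a ?b) (\<lambda>x. f (x + t *\<^sub>R ?e))" for t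
  have A_const: "A t = integral (cbox (-a) a) f" if "\<bar>t\<bar> < 1" for t
    unfolding A_def
  proof (rule integral_UNIV_translate[OF cf out])
    have "\<bar>t * ?e $ j\<bar> \<le> 1" for j using that by (auto simp: axis_def)
    then show "cbox (- a - t *\<^sub>R ?e) (a - t *\<^sub>R ?e) \<subseteq> cbox ?a ?b"
      by (auto simp: subset_iff mem_box_cart) (smt (verit, best))+
  qed
  have "(A has_real_derivative integral (cbox ?a ?b) (\<lambda>x. partial_deriv i f (x + 0 *\<^sub>R ?e))) (at 0 within UNIV)"
    unfolding A_def
  proof (rule leibniz_rule_field_derivative)
    show "continuous_on (UNIV \<times> cbox ?a ?b) (\<lambda>(t, x). partial_deriv i f (x + t *\<^sub>R ?e))"
      unfolding case_prod_beta by (intro continuous_on_compose2[OF c] continuous_intros) auto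
    show "(\<lambda>x. f (x + t *\<^sub>R ?e)) integrable_on cbox ?a ?b" for t
      by (intro integrable_continuous continuous_on_compose2[OF cf] continuous_intros) auto
  qed (auto intro!: partial_deriv_along df)
  moreover have "(A has_real_derivative 0) (at 0)"
  proof (subst DERIV_cong_ev[OF refl _ refl])
    show "\<forall>\<^sub>F t in nhds 0. A t = integral (cbox (-a) a) f"
      using A_const by (auto simp: eventually_nhds_metric dist_real_def intro!: exI[of _ 1])
  qed simp
  ultimately have 0: "integral (cbox ?a ?b) (partial_deriv i f) = 0"
    using DERIV_unique by fastforce
  have "a \<le> ?b" "?a \<le> -a" by (auto simp: less_eq_vec_def)
  then have "cbox (-a) a \<subseteq> cbox ?a ?b"
    by (auto simp: less_eq_vec_def mem_box_cart) (smt (verit))+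
  then have Sab: "S \<subseteq> cbox ?a ?b" using a by auto
  have z: "partial_deriv i f x = 0" if "x \<notin> K" for x
    using partial_deriv_eqI[OF has_derivative_outside_closed[OF K(1,3) that]] .
  have "(LINT x|lebesgue_on S. partial_deriv i f x) = (LINT x|lebesgue_on (cbox ?a ?b). (if x \<in> S then partial_deriv i f x else 0))"
    using integral_restrict[OF Sab S(2), of "partial_deriv i f"] by simp
  also have "(\<lambda>x. if x \<in> S then partial_deriv i f x else 0) = partial_deriv i f"
    by (rule ext) (use z K in auto)
  also have "(LINT x|lebesgue_on (cbox ?a ?b). partial_deriv i f x) = integral (cbox ?a ?b) (partial_deriv i f)"
    by (intro lebesgue_integral_eq_integral integrable_lebesgue_on_continuous)
      (auto intro: continuous_on_subset[OF c])
  finally show ?thesis using 0 by simp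
qed

section \<open>Convexity inequalities for powers of the norm\<close>

lemma powr_above_tangent:
  fixes x y p :: real
  assumes "x \<ge> 0" "y \<ge> 0" "p > 1"
  shows "x powr p + p * x powr (p - 1) * (y - x) \<le> y powr p"
proof -
  consider "x = 0" | "x > 0" "y = 0" | "x > 0" "y > 0" using assms by linarith
  then show ?thesis
  proof cases
    case 2
    have "x powr (p - 1) * x = x powr p" using 2 by (simp add: powr_diff)
    then have "x powr p + p * x powr (p - 1) * (y - x) = (1 - p) * x powr p"
      using 2 by (simp add: left_diff_distrib mult.assoc)
    also have "\<dots> \<le> 0" using assms by (intro mult_nonpos_nonneg) auto
    finally show ?thesis using 2 by simp
  next
    case 3
    have "p * x powr (p - 1) * (y - x) \<le> y powr p - x powr p"
      using 3 assms powr_convex[of p]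
      by (intro convex_on_imp_above_tangent[where A = "{0<..}"])
        (auto intro!: derivative_eq_intros simp: interior_open)
    then show ?thesis by simp
  qed (use assms in auto)
qed

text \<open>Cauchy-Schwarz reduces this to the scalar tangent inequality between the norms of a and
  b.\<close>

lemma norm_powr_above_tangent:
  fixes a b :: "'a::real_inner"
  assumes "p > 1"
  shows "norm a powr p + p * norm a powr (p - 2) * (a \<bullet> (b - a)) \<le> norm b powr p"
proof -
  have "a \<bullet> (b - a) \<le> norm a * (norm b - norm a)"
    using norm_cauchy_schwarz[of a b]
    by (simp add: inner_diff_right right_diff_distrib flip: power2_norm_eq_inner power2_eq_square)
  then have "p * norm a powr (p - 2) * (a \<bullet> (b - a)) \<le> p * norm a powr (p - 2) * (norm a * (norm b - norm a))"
    using assms by (intro mult_left_mono) auto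
  also have "\<dots> = p * norm a powr (p - 1) * (norm b - norm a)"
  proof (cases "a = 0")
    case False
    then have "norm a powr (p - 2) * norm a = norm a powr (p - 1)"
      by (simp add: powr_diff powr_numeral power2_eq_square)
    then show ?thesis by (simp add: mult.assoc[symmetric])
  qed simp
  finally have "p * norm a powr (p - 2) * (a \<bullet> (b - a)) \<le> p * norm a powr (p - 1) * (norm b - norm a)" .
  moreover have "norm a powr p + p * norm a powr (p - 1) * (norm b - norm a) \<le> norm b powr p"
    using assms by (intro powr_above_tangent) auto
  ultimately show ?thesis by linarith
qed

text \<open>Add the tangent inequalities at the intermediate point, weighted by 1 - t and t: the
  linear parts cancel.\<close>

lemma norm_powr_convex:
  fixes a b :: "'a::real_inner"
  assumes "p > 1" "0 \<le> t" "t \<le> 1"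
  shows "norm (a + t *\<^sub>R (b - a)) powr p \<le> (1 - t) * norm a powr p + t * norm b powr p"
proof -
  define w where "w = a + t *\<^sub>R (b - a)"
  define T where "T z = p * norm w powr (p - 2) * (w \<bullet> (z - w))" for z
  have "(1 - t) * (norm w powr p + T a) + t * (norm w powr p + T b)
      \<le> (1 - t) * norm a powr p + t * norm b powr p"
    unfolding T_def using assms by (intro add_mono mult_left_mono norm_powr_above_tangent) auto
  moreover have "(1 - t) *\<^sub>R (a - w) + t *\<^sub>R (b - w) = 0"
    by (simp add: w_def algebra_simps)
  then have "(1 - t) * (w \<bullet> (a - w)) + t * (w \<bullet> (b - w)) = 0"
    by (metis inner_add_right inner_scaleR_right inner_zero_right)
  then have "(1 - t) * T a + t * T b = 0" unfolding T_def by algebra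
  ultimately show ?thesis unfolding w_def[symmetric] by (simp add: algebra_simps)
qed

text \<open>Convexity applied to a / (1 - t) and b / t. For small t the factor of the first term is
  close to 1, so that an L^p-small change of a gradient raises the energy arbitrarily
  little.\<close>

lemma norm_powr_add_le:
  fixes a b :: "'a::real_inner"
  assumes "p > 1" "0 < t" "t < 1"
  shows "norm (a + b) powr p \<le> (1 - t) powr (1 - p) * norm a powr p + t powr (1 - p) * norm b powr p"
proof -
  have [simp]: "1 / (1 - t) - t / (1 - t) = 1" using assms by (simp add: divide_simps)
  have "a + b = (1 / (1 - t)) *\<^sub>R a + t *\<^sub>R ((1 / t) *\<^sub>R b - (1 / (1 - t)) *\<^sub>R a)"
    using assms by (simp add: scaleR_diff_right flip: scaleR_diff_left)
  then have "norm (a + b) powr p \<le> (1 - t) * norm ((1 / (1 - t)) *\<^sub>R a) powr p + t * norm ((1 / t) *\<^sub>R b) powr p"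
    using norm_powr_convex[of p t "(1 / (1 - t)) *\<^sub>R a" "(1 / t) *\<^sub>R b"] assms by simp
  also have "\<dots> = (1 - t) powr (1 - p) * norm a powr p + t powr (1 - p) * norm b powr p"
    using assms by (simp add: powr_mult powr_divide powr_diff)
  finally show ?thesis .
qed

text \<open>Takes the place of Hoelder's inequality. Below the threshold \<alpha> the first term
  suffices, above it the second. In the limit of large p the threshold becomes the Lipschitz
  constant.\<close>

lemma le_add_powr:
  fixes t \<alpha> p :: real
  assumes "\<alpha> > 0" "t \<ge> 0" "p \<ge> 1"
  shows "t \<le> \<alpha> + \<alpha> powr (1 - p) * t powr p"
proof (cases "t \<le> \<alpha>")
  case False
  then have "t = t powr p * t powr (1 - p)" using assms by (simp flip: powr_add)
  also have "\<dots> \<le> t powr p * \<alpha> powr (1 - p)"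
    using False assms by (intro mult_left_mono powr_mono2') auto
  finally show ?thesis using assms by (simp add: mult.commute)
qed (use assms in \<open>simp add: add_increasing2\<close>)

section \<open>Weak gradients and Sobolev extremals\<close>

lemma Lp_norm_powr: "p > 0 \<Longrightarrow> Lp_norm p \<Omega> f powr p = (LINT x|lebesgue_on \<Omega>. norm (f x) powr p)"
  by (simp add: Lp_norm_def powr_powr)

lemma test_function_integrable:
  fixes f :: "real^'n \<Rightarrow> 'b::euclidean_space"
  assumes "bounded \<Omega>" "open \<Omega>" "continuous_on UNIV f"
  shows "integrable (lebesgue_on \<Omega>) f"
  using assms continuous_on_subset[OF assms(3)]
  by (intro integrable_lebesgue_on_continuous) (auto intro: borel_open)

lemma continuous_imp_locally_integrable:
  fixes f :: "real^'n \<Rightarrow> 'b::euclidean_space"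
  assumes "continuous_on UNIV f"
  shows "locally_integrable \<Omega> f"
  unfolding locally_integrable_def
proof (intro allI impI)
  fix K assume K: "compact K \<and> K \<subseteq> \<Omega>"
  then have m: "K \<in> sets lebesgue" by (auto intro: fmeasurableD lmeasurable_compact)
  have "integrable (lebesgue_on K) f"
    using K assms by (intro integrable_lebesgue_on_continuous)
      (auto intro: m compact_imp_bounded continuous_on_subset)
  with m show "set_integrable lebesgue K f"
    by (simp add: set_integrable_def integrable_restrict_space)
qed

lemma integration_by_parts:
  fixes f :: "real^'n \<Rightarrow> real"
  assumes \<Omega>: "bounded \<Omega>" "open \<Omega>" and \<phi>: "\<phi> \<in> test_functions \<Omega>"
    and f: "\<And>x. f differentiable (at x)" "continuous_on UNIV (partial_deriv i f)"
  shows "(LINT x|lebesgue_on \<Omega>. f x * partial_deriv i \<phi> x) = - (LINT x|lebesgue_on \<Omega>. partial_deriv i f x * \<phi> x)"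
proof -
  obtain K where K: "smooth_fun_on UNIV \<phi>" "compact K" "K \<subseteq> \<Omega>" "\<And>x. x \<notin> K \<Longrightarrow> \<phi> x = 0"
    using test_functionE[OF \<phi>] by metis
  have "continuous_on UNIV f"
    using f by (auto intro!: continuous_at_imp_continuous_on differentiable_imp_continuous_within)
  moreover have "continuous_on UNIV \<phi>" "continuous_on UNIV (partial_deriv i \<phi>)"
    using K by (auto intro!: smooth_imp_continuous smooth_partial)
  ultimately have c: "continuous_on UNIV f" "continuous_on UNIV \<phi>" "continuous_on UNIV (partial_deriv i \<phi>)" .
  have p: "partial_deriv i (\<lambda>x. f x * \<phi> x) = (\<lambda>x. f x * partial_deriv i \<phi> x + partial_deriv i f x * \<phi> x)"
    by (intro ext partial_deriv_mult f smooth_imp_differentiable[OF K(1)])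
  have "(LINT x|lebesgue_on \<Omega>. partial_deriv i (\<lambda>x. f x * \<phi> x) x) = 0"
  proof (rule integral_partial_deriv_eq_0)
    show "(\<lambda>x. f x * \<phi> x) differentiable (at x)" for x
      by (intro differentiable_mult f smooth_imp_differentiable[OF K(1)])
    show "continuous_on UNIV (partial_deriv i (\<lambda>x. f x * \<phi> x))"
      unfolding p by (intro continuous_intros c f)
    show "closed K" "K \<subseteq> \<Omega>" "\<And>x. x \<notin> K \<Longrightarrow> f x * \<phi> x = 0"
      using K by (auto intro: compact_imp_closed)
  qed (use \<Omega> in \<open>auto intro: borel_open\<close>)
  then show ?thesis unfolding p using \<Omega> f c
    by (subst (asm) Bochner_Integration.integral_add)
      (auto intro!: test_function_integrable continuous_intros)
qed

lemma test_function_weak_gradient: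
  assumes \<Omega>: "bounded \<Omega>" "open \<Omega>" and \<psi>: "\<psi> \<in> test_functions \<Omega>"
  shows "has_weak_gradient \<Omega> \<psi> (grad \<psi>)"
proof -
  have s: "smooth_fun_on UNIV \<psi>" using \<psi> by (auto simp: test_functions_def)
  have "(LINT x|lebesgue_on \<Omega>. \<psi> x * partial_deriv i \<phi> x) = - (LINT x|lebesgue_on \<Omega>. grad \<psi> x $ i * \<phi> x)"
    if "\<phi> \<in> test_functions \<Omega>" for i \<phi>
    using integration_by_parts[OF \<Omega> that, of \<psi> i] s
    by (simp add: grad_def smooth_imp_differentiable smooth_imp_continuous smooth_partial)
  with s show ?thesis
    by (auto simp: has_weak_gradient_def intro!: continuous_imp_locally_integrable
        smooth_imp_continuous smooth_continuous_grad)
qed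

lemma continuous_on_norm_powr:
  "p > 0 \<Longrightarrow> continuous_on A f \<Longrightarrow> continuous_on A (\<lambda>x. norm (f x) powr (p::real))"
  by (intro continuous_on_powr' continuous_intros) auto

lemma test_function_W1p_0:
  assumes \<Omega>: "bounded \<Omega>" "open \<Omega>" and \<psi>: "\<psi> \<in> test_functions \<Omega>" and p: "p > 1"
  shows "\<psi> \<in> W1p_0 p \<Omega>"
proof -
  have s: "smooth_fun_on UNIV \<psi>" using \<psi> by (auto simp: test_functions_def)
  have c: "continuous_on UNIV \<psi>" "continuous_on UNIV (grad \<psi>)"
    using s smooth_imp_continuous smooth_continuous_grad by blast+
  have "\<psi> \<in> Lp_space p \<Omega>" "grad \<psi> \<in> Lp_space p \<Omega>"
    using c p \<Omega> test_function_integrable[OF \<Omega> c(1)] test_function_integrable[OF \<Omega> c(2)]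
      test_function_integrable[OF \<Omega> continuous_on_norm_powr[OF _ c(1)]]
      test_function_integrable[OF \<Omega> continuous_on_norm_powr[OF _ c(2)]]
    by (auto simp: Lp_space_def)
  moreover have "Lp_norm p \<Omega> (\<lambda>x. \<psi> x - \<psi> x) = 0" "Lp_norm p \<Omega> (\<lambda>x. grad \<psi> x - grad \<psi> x) = 0"
    by (simp_all add: Lp_norm_def)
  ultimately show ?thesis
    unfolding W1p_0_def using test_function_weak_gradient[OF \<Omega> \<psi>] \<psi>
    by (auto intro!: bexI[of _ "grad \<psi>"] exI[of _ "\<lambda>_. \<psi>"])
qed

lemma test_function_scale:
  assumes "\<psi> \<in> test_functions \<Omega>"
  shows "(\<lambda>x. c * \<psi> x) \<in> test_functions \<Omega>"
  using assms by (elim test_functionE) (rule test_functionI, auto intro: smooth_mult smooth_const)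

lemma grad_scale: "f differentiable (at x) \<Longrightarrow> grad (\<lambda>x. c * f x) x = c *\<^sub>R grad f x"
  using has_derivative_mult_right[OF has_derivative_grad, of f x c]
  by (intro grad_eqI) simp

text \<open>The scale-invariant form of the minimum, by normalising \<psi>. If the L^q integral
  vanishes no normalisation exists, but then the left side is 0 because \<open>0 powr r\<close> is
  0.\<close>

lemma sobolev_lambda_le:
  assumes \<Omega>: "bounded \<Omega>" "open \<Omega>" and p: "p > 1" and "q > 0" and \<psi>: "\<psi> \<in> test_functions \<Omega>"
  shows "sobolev_lambda \<Omega> p q * (LINT x|lebesgue_on \<Omega>. norm (\<psi> x) powr q) powr (p / q)
    \<le> (LINT x|lebesgue_on \<Omega>. norm (grad \<psi> x) powr p)"
proof (cases "(LINT x|lebesgue_on \<Omega>. norm (\<psi> x) powr q) = 0")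
  case False
  define I where "I = (LINT x|lebesgue_on \<Omega>. norm (\<psi> x) powr q)"
  have I: "I > 0" using False unfolding I_def by (simp add: order_less_le)
  define c where "c = I powr (- 1 / q)"
  have c: "c > 0" using I by (simp add: c_def)
  define \<theta> where "\<theta> x = c * \<psi> x" for x
  have s: "smooth_fun_on UNIV \<psi>" using \<psi> by (auto simp: test_functions_def)
  have \<theta>: "\<theta> \<in> test_functions \<Omega>" unfolding \<theta>_def by (rule test_function_scale[OF \<psi>])
  have g\<theta>: "grad \<theta> x = c *\<^sub>R grad \<psi> x" for x
    unfolding \<theta>_def by (intro grad_scale smooth_imp_differentiable s)
  have "(LINT x|lebesgue_on \<Omega>. norm (\<theta> x) powr q) = c powr q * I"
    using c by (simp add: \<theta>_def abs_mult powr_mult I_def)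
  also have "c powr q = I powr (- 1)" using \<open>q > 0\<close> by (simp only: c_def powr_powr) simp
  also have "I powr (- 1) * I = 1" using I by (simp add: powr_minus)
  finally have "Lp_norm q \<Omega> \<theta> = 1" by (simp add: Lp_norm_def)
  then have "sobolev_lambda \<Omega> p q \<le> Lp_norm p \<Omega> (grad \<theta>) powr p"
    unfolding sobolev_lambda_def
    using test_function_W1p_0[OF \<Omega> \<theta> p] test_function_weak_gradient[OF \<Omega> \<theta>]
    by (intro cInf_lower bdd_belowI[of _ 0]) auto
  also have "\<dots> = c powr p * (LINT x|lebesgue_on \<Omega>. norm (grad \<psi> x) powr p)"
    using c p by (simp add: Lp_norm_powr g\<theta> powr_mult)
  also have "c powr p = I powr (- (p / q))" by (simp add: c_def powr_powr)
  finally show ?thesis unfolding I_def[symmetric] using I by (simp add: powr_minus field_simps)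
qed (use p in simp)

section \<open>Uniqueness of weak gradients\<close>

lemma box_test_function:
  fixes a b :: "real^'n"
  assumes "cbox a b \<subseteq> \<Omega>"
  obtains \<phi> :: "nat \<Rightarrow> real^'n \<Rightarrow> real" where "\<And>j. \<phi> j \<in> test_functions \<Omega>" "\<And>j x. 0 \<le> \<phi> j x" "\<And>j x. \<phi> j x \<le> 1"
    "\<And>x. (\<lambda>j. \<phi> j x) \<longlonglongrightarrow> indicator (box a b) x"
    "\<And>j x. x \<notin> cbox a b \<Longrightarrow> \<phi> j x = 0"
proof
  define \<phi> where "\<phi> j x = (\<Prod>k\<in>UNIV. flat_exp (real j * (x $ k - a $ k)) * flat_exp (real j * (b $ k - x $ k)))"
    for j :: nat and x
  have fe: "0 \<le> flat_exp t" "flat_exp t \<le> 1" for t by (auto simp: flat_exp_def)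
  show "0 \<le> \<phi> j x" "\<phi> j x \<le> 1" for j x
    unfolding \<phi>_def using fe by (auto intro!: prod_nonneg prod_le_1 mult_le_one)
  show 0: "\<phi> j x = 0" if out: "x \<notin> cbox a b" for j x
  proof -
    obtain k where "\<not> (a $ k \<le> x $ k \<and> x $ k \<le> b $ k)" using out unfolding mem_box_cart by blast
    then have "flat_exp (real j * (x $ k - a $ k)) * flat_exp (real j * (b $ k - x $ k)) = 0"
      by (auto simp: flat_exp_def zero_less_mult_iff)
    then show ?thesis unfolding \<phi>_def by (intro prod_zero) (auto intro!: bexI[of _ k])
  qed
  have "smooth_fun_on UNIV (\<lambda>x. \<Prod>k\<in>UNIV. flat_exp (real j * (x \<bullet> axis k 1 - a $ k)) * flat_exp (real j * (b $ k - x \<bullet> axis k 1)))" for j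
    by (intro smooth_prod smooth_mult smooth_flat_exp smooth_diff smooth_const smooth_inner) auto
  then have "smooth_fun_on UNIV (\<phi> j)" for j by (simp add: inner_axis \<phi>_def[abs_def])
  then show "\<phi> j \<in> test_functions \<Omega>" for j
    using assms 0 by (intro test_functionI[of _ "cbox a b"]) auto
  have fl: "(\<lambda>j. flat_exp (real j * t)) \<longlonglongrightarrow> (if t > 0 then 1 else 0)" for t
  proof (cases "t > 0")
    case True
    have "(\<lambda>j. exp (- (1 / t) * inverse (real (Suc j)))) \<longlonglongrightarrow> exp (- (1 / t) * 0)"
      by (intro tendsto_intros LIMSEQ_inverse_real_of_nat)
    then have "(\<lambda>j. flat_exp (real (Suc j) * t)) \<longlonglongrightarrow> 1"
      using True by (simp add: flat_exp_def divide_inverse mult.commute del: of_nat_Suc)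
    then show ?thesis using LIMSEQ_imp_Suc[of "\<lambda>j. flat_exp (real j * t)" 1] True by simp
  next
    case False
    then have "flat_exp (real j * t) = 0" for j by (auto simp: flat_exp_def zero_less_mult_iff)
    with False show ?thesis by simp
  qed
  show "(\<lambda>j. \<phi> j x) \<longlonglongrightarrow> indicator (box a b) x" for x
  proof -
    have "(\<lambda>j. \<phi> j x) \<longlonglongrightarrow> (\<Prod>k\<in>UNIV. (if x $ k - a $ k > 0 then 1 else 0) * (if b $ k - x $ k > 0 then 1 else 0))"
      unfolding \<phi>_def by (intro tendsto_prod tendsto_mult fl)
    also have "(\<Prod>k\<in>UNIV. (if x $ k - a $ k > 0 then 1 else 0) * (if b $ k - x $ k > 0 then 1 else 0::real)) = indicator (box a b) x"
    proof (cases "x \<in> box a b")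
      case False
      then obtain k where "\<not> (a $ k < x $ k \<and> x $ k < b $ k)" by (auto simp: mem_box_cart)
      then show ?thesis using False by (auto intro!: prod_zero bexI[of _ k])
    qed (simp add: mem_box_cart)
    finally show ?thesis .
  qed
qed

text \<open>Boxes are an intersection-stable generator of the Borel sets, so the integrals vanish
  over all Borel sets, and a density with that property is zero almost everywhere.\<close>

lemma AE_zero_if_box_integrals_zero:
  fixes h :: "'a::euclidean_space \<Rightarrow> real"
  assumes h: "integrable lebesgue h"
    and box: "\<And>a b. (LINT x|lebesgue. indicator (box a b) x * h x) = 0"
  shows "AE x in lebesgue. h x = 0"
proof -
  \<comment> \<open>\<open>h\<close> is measurable only for the completed measure, whereas the
    induction over generated sets concerns Borel sets; a Borel representative takes its
    place.\<close>
  obtain f where f: "f \<in> borel_measurable lborel" "AE x in lborel. h x = f x"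
    using completion_ex_borel_measurable_real[of h lborel] h by (auto simp: borel_measurable_integrable)
  have AE: "AE x in lebesgue. h x = f x" using f(2) by (rule AE_completion)
  have "integrable lebesgue f"
    using h AE f(1) by (subst integrable_cong_AE[of _ _ h]) (auto simp: borel_measurable_integrable measurable_completion elim: AE_mp)
  then have fi: "integrable lborel f" using f(1) by (simp add: integrable_completion)
  have eq: "(LINT x|lborel. indicator A x * f x) = (LINT x|lebesgue. indicator A x * h x)" if "A \<in> sets borel" for A
  proof -
    have "(LINT x|lborel. indicator A x * f x) = (LINT x|lebesgue. indicator A x * f x)"
      using that f(1) by (subst integral_completion) auto
    also have "\<dots> = (LINT x|lebesgue. indicator A x * h x)"
      using that f(1) h AE by (intro integral_cong_AE) (auto simp: borel_measurable_integrable measurable_completion intro!: borel_measurable_times elim: AE_mp)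
    finally show ?thesis .
  qed
  let ?G = "range (\<lambda>(a, b). box a b :: 'a set)"
  have ii: "integrable lborel (\<lambda>x. indicator A x * f x)" if "A \<in> sets borel" for A
    using integrable_real_mult_indicator[of A lborel f] that fi by (simp add: mult.commute)
  have "(LINT x|lborel. indicator A x * f x) = 0" if "A \<in> sets borel" for A
  proof -
    have bs: "sigma_sets UNIV ?G = sets borel" by (simp add: borel_eq_box)
    have "Int_stable ?G" by (auto simp: Int_stable_def box_Int_box)
    moreover have "?G \<subseteq> Pow UNIV" by simp
    moreover have "A \<in> sigma_sets UNIV ?G" using that bs by simp
    ultimately show ?thesis
    proof (induction rule: sigma_sets_induct_disjoint)
      case (basic A)
      then show ?case using box eq by auto
    next
      case (compl A)
      \<comment> \<open>Passing to complements requires the integral over the whole space to vanish;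
        it is the limit of the integrals over growing boxes.\<close>
      let ?B = "\<lambda>n::nat. box (- real n *\<^sub>R One) (real n *\<^sub>R One) :: 'a set"
      have "(\<lambda>n. LINT x|lborel. indicator (?B n) x * f x) \<longlonglongrightarrow> (LINT x|lborel. f x)"
      proof (rule integral_dominated_convergence[where w = "\<lambda>x. \<bar>f x\<bar>"])
        show "AE x in lborel. (\<lambda>n. indicator (?B n) x * f x) \<longlonglongrightarrow> f x"
        proof (rule AE_I2, rule tendsto_eventually)
          fix x :: 'a
          obtain n where n: "norm x < real n" using reals_Archimedean2 by blast
          have "x \<in> ?B m" if "m \<ge> n" for m
          proof -
            have "\<bar>x \<bullet> i\<bar> < real m" if "i \<in> Basis" for i
              using Basis_le_norm[OF that, of x] n \<open>m \<ge> n\<close> by linarith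
            then show ?thesis by (auto simp: mem_box abs_less_iff minus_less_iff)
          qed
          then show "\<forall>\<^sub>F n in sequentially. indicator (?B n) x * f x = f x"
            unfolding eventually_sequentially by (intro exI[of _ n]) simp
        qed
      qed (use f fi in \<open>auto simp: abs_mult indicator_def\<close>)
      moreover have "(LINT x|lborel. indicator (?B n) x * f x) = 0" for n using box eq by auto
      ultimately have "(LINT x|lborel. f x) = 0" using LIMSEQ_unique[OF _ tendsto_const] by fastforce
      moreover have "(\<lambda>x. indicator (UNIV - A) x * f x) = (\<lambda>x. f x - indicator A x * f x)"
        by (auto simp: indicator_def)
      ultimately show ?case using compl fi ii bs by simp
    next
      case (union A)
      have m: "A i \<in> sets borel" for i using union bs by auto
      have "(LINT x:(\<Union>i. A i)|lborel. f x) = (\<Sum>i. LINT x:A i|lborel. f x)"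
        using union m ii[of "\<Union>i. A i"]
        by (intro lebesgue_integral_countable_add) (auto simp: set_integrable_def disjoint_family_on_def)
      then show ?case using union by (simp add: set_lebesgue_integral_def)
    qed auto
  qed
  then have "AE x in lborel. f x = 0"
    using density_unique_real[of lborel f "\<lambda>_. 0"] fi by (simp add: set_lebesgue_integral_def)
  then show ?thesis using AE_completion[of _ lborel] AE by force
qed

text \<open>Being extremal speaks of two weak gradients: the one approximated by gradients of test
  functions, and the one whose energy is \<lambda>. This lemma identifies them. Smooth
  approximations of box indicators serve as test functions.\<close>

lemma weak_gradient_unique:
  fixes u :: "real^'n \<Rightarrow> real"
  assumes \<Omega>: "open \<Omega>" and g: "has_weak_gradient \<Omega> u g" "has_weak_gradient \<Omega> u g'"
  shows "AE x in lebesgue_on \<Omega>. g x = g' x"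
proof -
  have S: "\<Omega> \<in> sets lebesgue" using \<Omega> by (simp add: borel_open)
  have loc: "set_integrable lebesgue K g" "set_integrable lebesgue K g'" if "compact K" "K \<subseteq> \<Omega>" for K
    using g that by (auto simp: has_weak_gradient_def locally_integrable_def)
  have box0: "(LINT x|lebesgue. indicator (box a b) x * (g x $ i - g' x $ i)) = 0"
    if ab: "cbox a b \<subseteq> \<Omega>" for a b i
  proof -
    let ?K = "cbox a b"
    obtain \<phi> :: "nat \<Rightarrow> real^'n \<Rightarrow> real" where \<phi>: "\<And>j. \<phi> j \<in> test_functions \<Omega>" "\<And>j x. 0 \<le> \<phi> j x" "\<And>j x. \<phi> j x \<le> 1"
      "\<And>x. (\<lambda>j. \<phi> j x) \<longlonglongrightarrow> indicator (box a b) x" "\<And>j x. x \<notin> cbox a b \<Longrightarrow> \<phi> j x = 0"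
      using box_test_function[OF ab] by blast
    have \<phi>m[measurable]: "\<phi> j \<in> borel_measurable lebesgue" for j
      using \<phi>(1)[of j] by (intro measurable_completion) (auto intro!: borel_measurable_continuous_onI smooth_imp_continuous simp: test_functions_def)
    define H where "H x = indicator ?K x * (g x $ i - g' x $ i)" for x
    have "integrable lebesgue (\<lambda>x. (indicator ?K x *\<^sub>R g x) $ i)" "integrable lebesgue (\<lambda>x. (indicator ?K x *\<^sub>R g' x) $ i)"
      using loc[of ?K] ab unfolding set_integrable_def
      by (auto intro!: integrable_bounded_linear[OF bounded_linear_vec_nth] simp del: vector_scaleR_component)
    then have gi: "integrable lebesgue (\<lambda>x. indicator ?K x * g x $ i)" "integrable lebesgue (\<lambda>x. indicator ?K x * g' x $ i)"
      by simp_all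
    then have Hi: "integrable lebesgue H" unfolding H_def right_diff_distrib by (rule Bochner_Integration.integrable_diff)
    have bnd: "integrable lebesgue (\<lambda>x. f x * \<phi> j x)" if "integrable lebesgue f" for f j
      using \<phi>(2,3)[of j] by (intro Bochner_Integration.integrable_bound[OF that])
        (auto simp: abs_mult mult_left_le intro!: borel_measurable_times borel_measurable_integrable[OF that] \<phi>m)
    have "(LINT x|lebesgue. H x * \<phi> j x) = 0" for j
    proof -
      have conv: "(LINT x|lebesgue. indicator ?K x * G x $ i * \<phi> j x) = (LINT x|lebesgue_on \<Omega>. G x $ i * \<phi> j x)" for G
      proof -
        have "(\<lambda>x. indicator ?K x * G x $ i * \<phi> j x) = (\<lambda>x. if x \<in> \<Omega> then G x $ i * \<phi> j x else 0)"
          by (rule ext) (use \<phi>(5) ab in \<open>auto simp: indicator_def\<close>)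
        then show ?thesis using Lebesgue_Measure.integral_restrict_UNIV[OF S, of "\<lambda>x. G x $ i * \<phi> j x"] by simp
      qed
      have "(LINT x|lebesgue_on \<Omega>. g x $ i * \<phi> j x) = (LINT x|lebesgue_on \<Omega>. g' x $ i * \<phi> j x)"
      proof -
        have "(LINT x|lebesgue_on \<Omega>. u x * partial_deriv i (\<phi> j) x) = - (LINT x|lebesgue_on \<Omega>. G x $ i * \<phi> j x)"
          if "has_weak_gradient \<Omega> u G" for G
          using that \<phi>(1) by (auto simp: has_weak_gradient_def)
        from this[OF g(1)] this[OF g(2)] show ?thesis by linarith
      qed
      then have "(LINT x|lebesgue. indicator ?K x * g x $ i * \<phi> j x) - (LINT x|lebesgue. indicator ?K x * g' x $ i * \<phi> j x) = 0"
        unfolding conv by simp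
      then show ?thesis
        by (subst (asm) Bochner_Integration.integral_diff[symmetric])
          (auto simp: H_def left_diff_distrib right_diff_distrib intro: bnd[OF gi(1)] bnd[OF gi(2)])
    qed
    moreover have "(\<lambda>j. LINT x|lebesgue. H x * \<phi> j x) \<longlonglongrightarrow> (LINT x|lebesgue. H x * indicator (box a b) x)"
    proof (rule integral_dominated_convergence[where w = "\<lambda>x. \<bar>H x\<bar>"])
      show "AE x in lebesgue. (\<lambda>j. H x * \<phi> j x) \<longlonglongrightarrow> H x * indicator (box a b) x"
        by (intro AE_I2 tendsto_intros \<phi>)
    qed (use \<phi>(2,3) Hi in \<open>auto simp: abs_mult mult_left_le borel_measurable_integrable
        intro!: borel_measurable_times borel_measurable_indicator\<close>)
    ultimately have "(LINT x|lebesgue. H x * indicator (box a b) x) = 0"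
      using LIMSEQ_unique[OF _ tendsto_const] by fastforce
    moreover have "H x * indicator (box a b) x = indicator (box a b) x * (g x $ i - g' x $ i)" for x
      using box_subset_cbox[of a b] by (auto simp: H_def indicator_def)
    ultimately show ?thesis by simp
  qed
  have box1: "AE x in lebesgue. x \<in> cbox c d \<longrightarrow> g x = g' x" if cd: "cbox c d \<subseteq> \<Omega>" for c d
  proof -
    have "AE x in lebesgue. indicator (box c d) x * (g x $ i - g' x $ i) = 0" for i
    proof (rule AE_zero_if_box_integrals_zero)
      have "set_integrable lebesgue (box c d) (\<lambda>x. g x - g' x)"
        by (rule set_integrable_subset[of _ "cbox c d"])
          (use loc[OF compact_cbox cd] box_subset_cbox in \<open>auto intro: set_integral_diff\<close>)
      from integrable_bounded_linear[OF bounded_linear_vec_nth this[unfolded set_integrable_def], of i]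
      show "integrable lebesgue (\<lambda>x. indicator (box c d) x * (g x $ i - g' x $ i))" by simp
      show "(LINT x|lebesgue. indicator (box a b) x * (indicator (box c d) x * (g x $ i - g' x $ i))) = 0" for a b
      proof -
        \<comment> \<open>An intersection of two open boxes is again an open box, and if nonempty
          its closure stays inside the larger closed box, hence inside the domain.\<close>
        obtain a' b' where e: "box a b \<inter> box c d = box a' b'" using box_Int_box by blast
        show ?thesis
        proof (cases "box a' b' = {}")
          case True
          then have "indicator (box a b) x * (indicator (box c d) x * (g x $ i - g' x $ i)) = 0" for x
            using e by (auto simp: indicator_def)
          then show ?thesis by (simp only: Bochner_Integration.integral_zero)
        next
          case False
          then have "cbox a' b' = closure (box a' b')" by (simp add: closure_box)
          also have "\<dots> \<subseteq> cbox c d" using e box_subset_cbox by (intro closure_minimal) auto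
          finally have "cbox a' b' \<subseteq> \<Omega>" using cd by blast
          then have "(LINT x|lebesgue. indicator (box a' b') x * (g x $ i - g' x $ i)) = 0" by (rule box0)
          then show ?thesis by (simp add: e[symmetric] indicator_inter_arith mult.assoc)
        qed
      qed
    qed
    then have "AE x in lebesgue. \<forall>i\<in>UNIV. indicator (box c d) x * (g x $ i - g' x $ i) = 0"
      by (intro AE_finite_allI) auto
    moreover have "AE x in lebesgue. x \<notin> cbox c d - box c d"
    proof (rule AE_not_in)
      have "negligible (cbox c d - box c d)"
        by (metis negligible_convex_frontier convex_box(1) frontier_cbox)
      then show "cbox c d - box c d \<in> null_sets lebesgue" by (simp add: negligible_iff_null_sets)
    qed
    ultimately show ?thesis by eventually_elim (auto simp: vec_eq_iff indicator_def)
  qed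
  \<comment> \<open>Countably many closed boxes exhaust the open set, so the exceptional sets add up
    to a null set.\<close>
  obtain \<D> where \<D>: "countable \<D>" "\<And>X. X \<in> \<D> \<Longrightarrow> X \<subseteq> \<Omega>" "\<And>X. X \<in> \<D> \<Longrightarrow> \<exists>a b. X = cbox a b" "\<Union>\<D> = \<Omega>"
    using open_countable_Union_open_cbox[OF \<Omega>] by (metis (no_types, lifting) PowD subsetD)
  have "AE x in lebesgue. \<forall>X\<in>\<D>. x \<in> X \<longrightarrow> g x = g' x"
    using \<D> box1 by (subst AE_ball_countable) (metis+)
  then have "AE x in lebesgue. x \<in> \<Omega> \<longrightarrow> g x = g' x"
    using \<D>(4) by (auto elim: AE_mp)
  then show ?thesis using S by (simp add: AE_restrict_space_iff)
qed

lemma integral_norm_powr_add_le: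
  fixes f g :: "'a \<Rightarrow> 'b::euclidean_space"
  assumes p: "p > 1" and t: "0 < t" "t < 1"
    and [measurable]: "f \<in> borel_measurable M" "g \<in> borel_measurable M"
    and i: "integrable M (\<lambda>x. norm (f x) powr p)" "integrable M (\<lambda>x. norm (g x) powr p)"
  shows "integrable M (\<lambda>x. norm (f x + g x) powr p)"
    and "(LINT x|M. norm (f x + g x) powr p)
      \<le> (1 - t) powr (1 - p) * (LINT x|M. norm (f x) powr p) + t powr (1 - p) * (LINT x|M. norm (g x) powr p)"
proof -
  let ?B = "\<lambda>x. (1 - t) powr (1 - p) * norm (f x) powr p + t powr (1 - p) * norm (g x) powr p"
  have B: "integrable M ?B" using i by auto
  show I: "integrable M (\<lambda>x. norm (f x + g x) powr p)"
    using norm_powr_add_le[OF p t, of "f _" "g _"]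
    by (intro Bochner_Integration.integrable_bound[OF B]) (auto intro!: AE_I2)
  have "(LINT x|M. norm (f x + g x) powr p) \<le> (LINT x|M. ?B x)"
    using norm_powr_add_le[OF p t] by (intro integral_mono I B)
  then show "(LINT x|M. norm (f x + g x) powr p)
      \<le> (1 - t) powr (1 - p) * (LINT x|M. norm (f x) powr p) + t powr (1 - p) * (LINT x|M. norm (g x) powr p)"
    using i by simp
qed

lemma Lp_norm_tendsto_0:
  assumes "p > 0" "(\<lambda>k. Lp_norm p \<Omega> (f k)) \<longlonglongrightarrow> 0"
  shows "(\<lambda>k. LINT x|lebesgue_on \<Omega>. norm (f k x) powr p) \<longlonglongrightarrow> 0"
proof -
  have "(\<lambda>k. Lp_norm p \<Omega> (f k) powr p) \<longlonglongrightarrow> 0 powr p"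
    using assms by (intro tendsto_powr') (auto simp: Lp_norm_def)
  then show ?thesis using assms by (simp add: Lp_norm_powr)
qed

text \<open>Collects what the later limits consume: pointwise convergence for the nonlinear
  integrals, L^1 convergence for the linear ones, and an upper bound of the energies. Convergence of
  the gradients themselves is not recorded.\<close>

definition minimizing_test_functions ::
    "(real^'n) set \<Rightarrow> real \<Rightarrow> real \<Rightarrow> (real^'n \<Rightarrow> real) \<Rightarrow> (nat \<Rightarrow> real^'n \<Rightarrow> real) \<Rightarrow> bool"
  where "minimizing_test_functions \<Omega> p q u \<phi> \<longleftrightarrow> (\<forall>k. \<phi> k \<in> test_functions \<Omega>) \<and>
    (AE x in lebesgue_on \<Omega>. (\<lambda>k. \<phi> k x) \<longlonglongrightarrow> u x) \<and>
    (\<lambda>k. LINT x|lebesgue_on \<Omega>. \<bar>\<phi> k x - u x\<bar>) \<longlonglongrightarrow> 0 \<and>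
    (\<forall>\<tau>>0. \<forall>\<^sub>F k in sequentially.
      (LINT x|lebesgue_on \<Omega>. norm (grad (\<phi> k) x) powr p) \<le> sobolev_lambda \<Omega> p q + \<tau>)"

lemma minimizing_test_functionsD:
  assumes "minimizing_test_functions \<Omega> p q u \<phi>"
  shows "\<phi> k \<in> test_functions \<Omega>"
    and "AE x in lebesgue_on \<Omega>. (\<lambda>k. \<phi> k x) \<longlonglongrightarrow> u x"
    and "(\<lambda>k. LINT x|lebesgue_on \<Omega>. \<bar>\<phi> k x - u x\<bar>) \<longlonglongrightarrow> 0"
    and "\<tau> > 0 \<Longrightarrow> \<forall>\<^sub>F k in sequentially.
      (LINT x|lebesgue_on \<Omega>. norm (grad (\<phi> k) x) powr p) \<le> sobolev_lambda \<Omega> p q + \<tau>"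
  using assms by (simp_all add: minimizing_test_functions_def)

lemma sobolev_extremal_approx:
  fixes u :: "real^'n \<Rightarrow> real"
  assumes \<Omega>: "bounded \<Omega>" "open \<Omega>" and p: "p > 1" and u: "sobolev_extremal \<Omega> p q u"
  shows "\<exists>\<phi>. minimizing_test_functions \<Omega> p q u \<phi>"
proof -
  let ?\<mu> = "lebesgue_on \<Omega>" and ?L = "sobolev_lambda \<Omega> p q"
  have "\<Omega> \<in> lmeasurable" using \<Omega> by (simp add: lmeasurable_open)
  then interpret finite_measure "lebesgue_on \<Omega>" by (rule finite_measure_lebesgue_on)
  have S: "\<Omega> \<in> sets lebesgue" using \<Omega> by (simp add: borel_open)
  have uc: "continuous_on (closure \<Omega>) u" using u by (auto simp: sobolev_extremal_def)
  obtain g \<phi> where g: "g \<in> Lp_space p \<Omega>" "has_weak_gradient \<Omega> u g"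
    and \<phi>: "\<And>k. \<phi> k \<in> test_functions \<Omega>"
    and l1: "(\<lambda>k. Lp_norm p \<Omega> (\<lambda>x. \<phi> k x - u x)) \<longlonglongrightarrow> 0"
    and l2: "(\<lambda>k. Lp_norm p \<Omega> (\<lambda>x. grad (\<phi> k) x - g x)) \<longlonglongrightarrow> 0"
    using u by (auto simp: sobolev_extremal_def W1p_0_def)
  obtain g' where g': "has_weak_gradient \<Omega> u g'" "Lp_norm p \<Omega> g' powr p = ?L"
    using u by (auto simp: sobolev_extremal_def)
  have gm[measurable]: "g \<in> borel_measurable ?\<mu>" and gi: "integrable ?\<mu> (\<lambda>x. norm (g x) powr p)"
    using g by (auto simp: Lp_space_def)
  have lam: "(LINT x|?\<mu>. norm (g x) powr p) = ?L"
  proof -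
    have AE: "AE x in ?\<mu>. g x = g' x" by (rule weak_gradient_unique[OF \<Omega>(2) g(2) g'(1)])
    \<comment> \<open>Measurability of \<open>g'\<close> is transferred from \<open>g\<close>:
      Lebesgue measure is complete, so equality almost everywhere suffices.\<close>
    then have "AE x in lebesgue. x \<in> \<Omega> \<longrightarrow> g x = g' x" using S by (simp add: AE_restrict_space_iff)
    then have "AE x in lebesgue. indicator \<Omega> x *\<^sub>R g x = indicator \<Omega> x *\<^sub>R g' x" by eventually_elim (auto simp: indicator_def)
    moreover have "(\<lambda>x. indicator \<Omega> x *\<^sub>R g x) \<in> borel_measurable lebesgue"
      using gm S by (simp add: borel_measurable_restrict_space_iff)
    ultimately have "(\<lambda>x. indicator \<Omega> x *\<^sub>R g' x) \<in> borel_measurable lebesgue"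
      by (rule borel_measurable_AE[rotated])
    then have g'm[measurable]: "g' \<in> borel_measurable ?\<mu>"
      using S by (simp add: borel_measurable_restrict_space_iff)
    have "(LINT x|?\<mu>. norm (g x) powr p) = (LINT x|?\<mu>. norm (g' x) powr p)"
      using AE by (intro integral_cong_AE) (auto elim: AE_mp)
    then show ?thesis using g'(2) p by (simp add: Lp_norm_powr)
  qed
  have s\<phi>: "smooth_fun_on UNIV (\<phi> k)" for k using \<phi>[of k] by (auto simp: test_functions_def)
  have c1: "continuous_on (closure \<Omega>) (\<lambda>x. \<phi> k x - u x)" for k
    by (intro continuous_intros smooth_imp_continuous s\<phi> uc)
  have c2: "continuous_on UNIV (grad (\<phi> k))" for k by (intro smooth_continuous_grad s\<phi>)
  have i1: "integrable ?\<mu> (\<lambda>x. \<phi> k x - u x)" for k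
    using integrable_lebesgue_on_continuous[OF \<Omega>(1) S c1] .
  have i1p: "integrable ?\<mu> (\<lambda>x. \<bar>\<phi> k x - u x\<bar> powr p)" for k
    using integrable_lebesgue_on_continuous[OF \<Omega>(1) S continuous_on_norm_powr[OF _ c1]] p by simp
  have i2: "integrable ?\<mu> (\<lambda>x. norm (grad (\<phi> k) x) powr p)" for k
    using test_function_integrable[OF \<Omega> continuous_on_norm_powr[OF _ c2]] p by simp
  have m2[measurable]: "grad (\<phi> k) \<in> borel_measurable ?\<mu>" for k
    using test_function_integrable[OF \<Omega> c2] by (rule borel_measurable_integrable)
  have i3: "integrable ?\<mu> (\<lambda>x. norm (grad (\<phi> k) x - g x) powr p)" for k
    using integral_norm_powr_add_le(1)[of p "1/2" "grad (\<phi> k)" ?\<mu> "\<lambda>x. - g x"] p i2 gi by simp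
  define I where "I k = (LINT x|?\<mu>. \<bar>\<phi> k x - u x\<bar> powr p)" for k
  define J where "J k = (LINT x|?\<mu>. norm (grad (\<phi> k) x - g x) powr p)" for k
  have I0: "I \<longlonglongrightarrow> 0" using Lp_norm_tendsto_0[OF _ l1] p by (simp add: I_def[abs_def])
  have J0: "J \<longlonglongrightarrow> 0" using Lp_norm_tendsto_0[OF _ l2] p by (simp add: J_def[abs_def])
  have L1: "(\<lambda>k. LINT x|?\<mu>. \<bar>\<phi> k x - u x\<bar>) \<longlonglongrightarrow> 0"
  proof (rule tendstoI)
    fix e :: real assume e: "e > 0"
    define \<tau> where "\<tau> = e / (2 * (measure ?\<mu> (space ?\<mu>) + 1))"
    have \<tau>: "\<tau> > 0" using e by (simp add: \<tau>_def add_nonneg_pos)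
    have "\<tau> * measure ?\<mu> (space ?\<mu>) \<le> \<tau> * (measure ?\<mu> (space ?\<mu>) + 1)" using \<tau> by (intro mult_left_mono) auto
    also have "\<dots> = e / 2" by (simp add: \<tau>_def field_simps add_nonneg_eq_0_iff)
    finally have *: "\<tau> * measure ?\<mu> (space ?\<mu>) \<le> e / 2" .
    have le: "(LINT x|?\<mu>. \<bar>\<phi> k x - u x\<bar>) \<le> e / 2 + \<tau> powr (1 - p) * I k" for k
    proof -
      have "(LINT x|?\<mu>. \<bar>\<phi> k x - u x\<bar>) \<le> (LINT x|?\<mu>. \<tau> + \<tau> powr (1 - p) * \<bar>\<phi> k x - u x\<bar> powr p)"
        using \<tau> p i1 i1p by (intro integral_mono le_add_powr) auto
      also have "\<dots> = \<tau> * measure ?\<mu> (space ?\<mu>) + \<tau> powr (1 - p) * I k"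
        using i1p by (simp add: I_def mult.commute)
      finally show ?thesis using * by simp
    qed
    have "(\<lambda>k. e / 2 + \<tau> powr (1 - p) * I k) \<longlonglongrightarrow> e / 2 + \<tau> powr (1 - p) * 0"
      by (intro tendsto_intros I0)
    then have "\<forall>\<^sub>F k in sequentially. e / 2 + \<tau> powr (1 - p) * I k < e"
      by (rule order_tendstoD(2)) (use e in simp)
    then show "\<forall>\<^sub>F k in sequentially. dist (LINT x|?\<mu>. \<bar>\<phi> k x - u x\<bar>) 0 < e"
      by eventually_elim (use le in \<open>simp add: abs_of_nonneg\<close>, fastforce intro: le_less_trans)
  qed
  have lim: "\<forall>\<^sub>F k in sequentially. (LINT x|?\<mu>. norm (grad (\<phi> k) x) powr p) \<le> ?L + \<tau>" if \<tau>: "\<tau> > 0" for \<tau>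
  proof -
    \<comment> \<open>The weight t is fixed first, so small that the factor of the limit energy is
      nearly 1; only then is k taken large, against the factor
      \<open>t powr (1 - p)\<close>.\<close>
    have "((\<lambda>t. (1 - t) powr (1 - p) * ?L) \<longlongrightarrow> (1 - 0) powr (1 - p) * ?L) (at_right 0)"
      by (intro tendsto_intros) auto
    then have "\<forall>\<^sub>F t in at_right 0. (1 - t) powr (1 - p) * ?L < ?L + \<tau> / 2"
      using \<tau> by (intro order_tendstoD) auto
    moreover have "\<forall>\<^sub>F t in at_right (0::real). t < 1 \<and> 0 < t"
      by (intro eventually_conj eventually_at_right_less eventually_at_right_real[THEN eventually_mono, of 0 1]) auto
    ultimately have "\<forall>\<^sub>F t in at_right 0. (1 - t) powr (1 - p) * ?L < ?L + \<tau> / 2 \<and> t < 1 \<and> 0 < t"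
      by (rule eventually_conj)
    then obtain t where t: "(1 - t) powr (1 - p) * ?L < ?L + \<tau> / 2" "t < 1" "0 < t"
      using eventually_happens[of _ "at_right (0::real)"] by fastforce
    have "(\<lambda>k. t powr (1 - p) * J k) \<longlonglongrightarrow> t powr (1 - p) * 0" by (intro tendsto_intros J0)
    then have "\<forall>\<^sub>F k in sequentially. t powr (1 - p) * J k < \<tau> / 2"
      using \<tau> by (intro order_tendstoD) auto
    then show ?thesis
    proof eventually_elim
      case (elim k)
      show ?case
        using integral_norm_powr_add_le(2)[of p t g ?\<mu> "\<lambda>x. grad (\<phi> k) x - g x"] p t gi i3[of k] elim
        by (simp add: lam J_def)
    qed
  qed
  obtain r where r: "strict_mono r" "AE x in ?\<mu>. (\<lambda>n. \<phi> (r n) x - u x) \<longlonglongrightarrow> 0"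
    using tendsto_L1_AE_subseq[of ?\<mu> "\<lambda>k x. \<phi> k x - u x"] i1 L1 by auto
  have "minimizing_test_functions \<Omega> p q u (\<lambda>k. \<phi> (r k))"
    unfolding minimizing_test_functions_def
  proof (intro conjI allI impI)
    show "\<phi> (r k) \<in> test_functions \<Omega>" for k by (rule \<phi>)
    show "AE x in ?\<mu>. (\<lambda>k. \<phi> (r k) x) \<longlonglongrightarrow> u x"
      using r(2) by eventually_elim (simp add: LIM_zero_iff)
    show "(\<lambda>k. LINT x|?\<mu>. \<bar>\<phi> (r k) x - u x\<bar>) \<longlonglongrightarrow> 0"
      using LIMSEQ_subseq_LIMSEQ[OF L1 r(1)] by (simp add: o_def)
    show "\<forall>\<^sub>F k in sequentially. (LINT x|?\<mu>. norm (grad (\<phi> (r k)) x) powr p) \<le> ?L + \<tau>" if "\<tau> > 0" for \<tau>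
      using eventually_compose_filterlim[OF lim[OF that] filterlim_subseq[OF r(1)]] by simp
  qed
  then show ?thesis by blast
qed

section \<open>The energy comparison\<close>

text \<open>The absolute value makes the power differentiable from both sides at 0, so that the
  chain rule applies also at critical points, where |grad v|^2 vanishes.\<close>

lemma abs_powr_has_derivative:
  fixes a t :: real
  assumes a: "a > 1" and t: "t \<ge> 0"
  shows "((\<lambda>t. \<bar>t\<bar> powr a) has_real_derivative a * t powr (a - 1)) (at t)"
proof (cases "t = 0")
  case False
  then have "t > 0" using t by simp
  then have "((\<lambda>t. t powr a) has_real_derivative a * t powr (a - 1)) (at t)"
    by (rule has_real_derivative_powr)
  moreover have "eventually (\<lambda>s. s > 0) (nhds t)"
    using \<open>t > 0\<close> eventually_nhds_in_open[of "{0<..}" t] by simp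
  then have "eventually (\<lambda>s. \<bar>s\<bar> powr a = s powr a) (nhds t)" by eventually_elim simp
  ultimately show ?thesis by (subst DERIV_cong_ev[OF refl _ refl])
next
  case True
  have "((\<lambda>h. \<bar>h\<bar> powr a / h) \<longlongrightarrow> 0) (at 0)"
  proof (rule Lim_null_comparison)
    show "\<forall>\<^sub>F h in at 0. norm (\<bar>h\<bar> powr a / h) \<le> \<bar>h\<bar> powr (a - 1)"
      by (rule always_eventually) (simp add: powr_diff)
    have "((\<lambda>h. \<bar>h\<bar> powr (a - 1)) \<longlongrightarrow> \<bar>0\<bar> powr (a - 1)) (at (0::real))"
      using a by (intro tendsto_powr' tendsto_intros) auto
    then show "((\<lambda>h. \<bar>h\<bar> powr (a - 1)) \<longlongrightarrow> 0) (at (0::real))" using a by simp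
  qed
  then show ?thesis using True a by (simp add: DERIV_def)
qed

definition laplacian :: "(real^'n \<Rightarrow> real) \<Rightarrow> real^'n \<Rightarrow> real"
  where "laplacian v x = (\<Sum>i\<in>UNIV. partial_deriv i (partial_deriv i v) x)"

text \<open>The divergence of |grad v|^(p-2) grad v, expanded. For p > 4 both powers of the gradient
  are continuous across its zeros.\<close>

definition p_laplacian :: "real \<Rightarrow> (real^'n \<Rightarrow> real) \<Rightarrow> real^'n \<Rightarrow> real"
  where "p_laplacian p v x = (p - 2) * norm (grad v x) powr (p - 4) * inf_laplacian v x
    + norm (grad v x) powr (p - 2) * laplacian v x"

lemma smooth_continuous_inf_laplacian: "smooth_fun_on UNIV v \<Longrightarrow> continuous_on A (inf_laplacian v)"
  unfolding inf_laplacian_def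
  by (intro continuous_intros smooth_imp_continuous smooth_partial)

lemma smooth_continuous_laplacian: "smooth_fun_on UNIV v \<Longrightarrow> continuous_on A (laplacian v)"
  unfolding laplacian_def
  by (intro continuous_intros smooth_imp_continuous smooth_partial)

lemma continuous_on_p_laplacian:
  "p > 4 \<Longrightarrow> smooth_fun_on UNIV v \<Longrightarrow> continuous_on A (p_laplacian p v)"
  unfolding p_laplacian_def
  by (intro continuous_intros continuous_on_norm_powr smooth_continuous_grad
      smooth_continuous_inf_laplacian smooth_continuous_laplacian) auto

lemma p_laplacian_integration_by_parts:
  fixes v :: "real^'n \<Rightarrow> real"
  assumes \<Omega>: "bounded \<Omega>" "open \<Omega>" and \<phi>: "\<phi> \<in> test_functions \<Omega>"
    and p: "p > 4" and v: "smooth_fun_on UNIV v"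
  shows "(LINT x|lebesgue_on \<Omega>. norm (grad v x) powr (p - 2) * (grad v x \<bullet> grad \<phi> x))
    = - (LINT x|lebesgue_on \<Omega>. p_laplacian p v x * \<phi> x)"
proof -
  define w where "w x = (\<Sum>j\<in>UNIV. partial_deriv j v x * partial_deriv j v x)" for x
  \<comment> \<open>The factor |grad v|^(p-2) is the a-th power of the smooth function w = |grad
    v|^2, and p > 4 makes a > 1.\<close>
  define a where "a = (p - 2) / 2"
  have a: "a > 1" using p by (simp add: a_def)
  have w_eq: "w x = (norm (grad v x))\<^sup>2" for x
    by (simp only: power2_norm_eq_inner) (simp add: w_def inner_vec_def grad_def)
  have w0: "w x \<ge> 0" for x by (simp add: w_eq)
  have ws: "smooth_fun_on UNIV w"
    unfolding w_def[abs_def] by (intro smooth_sum smooth_mult smooth_partial v) auto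
  have \<phi>s: "smooth_fun_on UNIV \<phi>" using \<phi> by (auto simp: test_functions_def)
  note vd = smooth_imp_differentiable[OF smooth_partial[OF v]]
  have wd: "partial_deriv i w x = 2 * (\<Sum>j\<in>UNIV. partial_deriv j v x * partial_deriv i (partial_deriv j v) x)" for i x
  proof -
    have "(partial_deriv j v has_derivative (\<lambda>h. frechet_derivative (partial_deriv j v) (at x) h)) (at x)" for j
      using vd[of j x] frechet_derivative_works by (metis (no_types, lifting) ext)
    then have "(w has_derivative (\<lambda>h. \<Sum>j\<in>UNIV. partial_deriv j v x * frechet_derivative (partial_deriv j v) (at x) h
        + frechet_derivative (partial_deriv j v) (at x) h * partial_deriv j v x)) (at x)"
      unfolding w_def[abs_def] by (intro has_derivative_sum has_derivative_mult)
    from partial_deriv_eqI[OF this, of i] show ?thesis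
      by (simp add: sum_distrib_left algebra_simps partial_deriv_def sum.distrib)
  qed
  define F where "F i x = \<bar>w x\<bar> powr a * partial_deriv i v x" for i x
  have nw: "\<bar>w x\<bar> powr a = norm (grad v x) powr (p - 2)" for x
    by (simp add: w_eq a_def powr_powr diff_divide_distrib flip: powr_numeral)
  have nw': "w x powr (a - 1) = norm (grad v x) powr (p - 4)" for x
    by (simp add: w_eq a_def powr_powr diff_divide_distrib flip: powr_numeral)
  note wa = partial_deriv_compose[OF smooth_imp_differentiable[OF ws] abs_powr_has_derivative[OF a w0]]
  have Fd: "F i differentiable (at x)" for i x
    unfolding F_def[abs_def] by (intro differentiable_mult wa(2) vd)
  have pF: "partial_deriv i (F i) x = norm (grad v x) powr (p - 2) * partial_deriv i (partial_deriv i v) x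
      + (p - 2) * norm (grad v x) powr (p - 4) * (\<Sum>j\<in>UNIV. partial_deriv j v x * partial_deriv i (partial_deriv j v) x) * partial_deriv i v x" for i x
    unfolding F_def[abs_def]
    by (subst partial_deriv_mult[OF wa(2) vd], subst wa(1))
      (simp add: nw nw' wd, simp add: a_def)
  have pc: "continuous_on UNIV (partial_deriv i v)" "continuous_on UNIV (partial_deriv i (partial_deriv j v))" for i j
    using v by (auto intro: smooth_imp_continuous smooth_partial)
  have cF: "continuous_on UNIV (partial_deriv i (F i))" for i
    unfolding pF[abs_def]
    by (intro continuous_intros continuous_on_norm_powr smooth_continuous_grad[OF v] pc) (use p in auto)
  have cF0: "continuous_on UNIV (F i)" for i
    using Fd by (auto intro!: continuous_at_imp_continuous_on differentiable_imp_continuous_within)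
  have c\<phi>: "continuous_on UNIV \<phi>" "continuous_on UNIV (partial_deriv i \<phi>)" for i
    using \<phi>s by (auto intro: smooth_imp_continuous smooth_partial)
  have "norm (grad v x) powr (p - 2) * (grad v x \<bullet> grad \<phi> x) = (\<Sum>i\<in>UNIV. F i x * partial_deriv i \<phi> x)" for x
    by (simp add: F_def nw inner_vec_def grad_def sum_distrib_left mult.assoc)
  then have "(LINT x|lebesgue_on \<Omega>. norm (grad v x) powr (p - 2) * (grad v x \<bullet> grad \<phi> x))
      = (\<Sum>i\<in>UNIV. LINT x|lebesgue_on \<Omega>. F i x * partial_deriv i \<phi> x)"
    by (simp add: Bochner_Integration.integral_sum test_function_integrable[OF \<Omega>] continuous_on_mult cF0 c\<phi>)
  also have "\<dots> = (\<Sum>i\<in>UNIV. - (LINT x|lebesgue_on \<Omega>. partial_deriv i (F i) x * \<phi> x))"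
    by (intro sum.cong refl integration_by_parts \<Omega> \<phi> Fd cF)
  also have "\<dots> = - (LINT x|lebesgue_on \<Omega>. (\<Sum>i\<in>UNIV. partial_deriv i (F i) x * \<phi> x))"
    by (subst Bochner_Integration.integral_sum)
      (auto simp: sum_negf intro!: test_function_integrable[OF \<Omega>] continuous_on_mult cF c\<phi>)
  also have "(\<lambda>x. \<Sum>i\<in>UNIV. partial_deriv i (F i) x * \<phi> x) = (\<lambda>x. p_laplacian p v x * \<phi> x)"
  proof
    fix x
    define X where "X i = (\<Sum>j\<in>UNIV. partial_deriv j v x * partial_deriv i (partial_deriv j v) x)" for i
    have "inf_laplacian v x = (\<Sum>i\<in>UNIV. X i * partial_deriv i v x)"
      unfolding X_def inf_laplacian_def
      by (subst sum.swap) (simp add: sum_distrib_left mult_ac)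
    then have "p_laplacian p v x = (\<Sum>i\<in>UNIV. partial_deriv i (F i) x)"
      by (simp add: pF[of _ x, folded X_def] p_laplacian_def laplacian_def sum.distrib sum_distrib_left mult.assoc add.commute)
    then show "(\<Sum>i\<in>UNIV. partial_deriv i (F i) x * \<phi> x) = p_laplacian p v x * \<phi> x"
      by (simp add: sum_distrib_right)
  qed
  finally show ?thesis by simp
qed

text \<open>The comparison behind both viscosity inequalities: \<open>\<phi>\<close> is modified towards \<open>v\<close> where
  \<open>s (\<phi> - v) + \<delta> > 0\<close>, and convexity of \<open>z \<mapsto> |z|\<^sup>p\<close> bounds the energy of the result. Here
  \<open>s = 1\<close> pushes \<open>\<phi>\<close> down and \<open>s = -1\<close> pushes it up.\<close>

lemma test_function_energy:
  fixes \<phi> v :: "real^'n \<Rightarrow> real"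
  assumes \<Omega>: "bounded \<Omega>" "open \<Omega>" and \<phi>: "\<phi> \<in> test_functions \<Omega>"
    and p: "p > 4" and q: "q > 0" and v: "smooth_fun_on UNIV v" and s: "s * s = 1"
    and \<eta>: "(\<lambda>x. soft_pos (s * (\<phi> x - v x) + \<delta>)) \<in> test_functions \<Omega>" (is "?\<eta> \<in> _")
  shows "sobolev_lambda \<Omega> p q * (LINT x|lebesgue_on \<Omega>. norm (\<phi> x - s * soft_pos (s * (\<phi> x - v x) + \<delta>)) powr q) powr (p / q)
    \<le> (LINT x|lebesgue_on \<Omega>. norm (grad \<phi> x) powr p)
      + s * p * (LINT x|lebesgue_on \<Omega>. p_laplacian p v x * soft_pos (s * (\<phi> x - v x) + \<delta>))"
proof -
  define w where "w x = \<phi> x - s * ?\<eta> x" for x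
  have \<phi>s: "smooth_fun_on UNIV \<phi>" using \<phi> by (auto simp: test_functions_def)
  have \<eta>s: "smooth_fun_on UNIV ?\<eta>" using \<eta> by (auto simp: test_functions_def)
  have w: "w \<in> test_functions \<Omega>"
  proof -
    obtain K where K: "compact K" "K \<subseteq> \<Omega>" "\<And>x. x \<notin> K \<Longrightarrow> \<phi> x = 0" using \<phi> by (elim test_functionE) blast
    obtain K' where K': "compact K'" "K' \<subseteq> \<Omega>" "\<And>x. x \<notin> K' \<Longrightarrow> ?\<eta> x = 0" using \<eta> by (elim test_functionE) blast
    show ?thesis
    proof (rule test_functionI)
      show "smooth_fun_on UNIV w"
        unfolding w_def[abs_def] by (intro smooth_diff smooth_mult smooth_const \<phi>s \<eta>s)
      show "compact (K \<union> K')" "K \<union> K' \<subseteq> \<Omega>" using K K' by auto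
      show "w x = 0" if "x \<notin> K \<union> K'" for x using that K(3)[of x] K'(3)[of x] by (simp add: w_def)
    qed
  qed
  have c: "continuous_on UNIV (grad \<phi>)" "continuous_on UNIV (grad v)" "continuous_on UNIV (grad w)" "continuous_on UNIV (grad ?\<eta>)"
    using \<phi>s v \<eta>s w by (auto intro: smooth_continuous_grad simp: test_functions_def)
  have pw: "norm (grad w x) powr p \<le> norm (grad \<phi> x) powr p
      - s * p * (norm (grad v x) powr (p - 2) * (grad v x \<bullet> grad ?\<eta> x))" for x
  proof -
    let ?a = "grad \<phi> x" and ?b = "grad v x"
    define t where "t = soft_pos' (s * (\<phi> x - v x) + \<delta>)"
    have t: "0 \<le> t" "t \<le> 1" using soft_pos'_bounds by (auto simp: t_def)
    note d = has_derivative_grad[OF smooth_imp_differentiable[OF \<phi>s, of x]]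
      has_derivative_grad[OF smooth_imp_differentiable[OF v, of x]]
    have d1: "((\<lambda>x. s * (\<phi> x - v x) + \<delta>) has_derivative (\<lambda>h. s * (?a \<bullet> h - ?b \<bullet> h))) (at x)"
      by (auto intro!: derivative_eq_intros d)
    have d2: "(?\<eta> has_derivative (\<lambda>h. t * (s * (?a \<bullet> h - ?b \<bullet> h)))) (at x)"
      using has_derivative_compose[OF d1 soft_pos_has_derivative[unfolded has_field_derivative_def]]
      by (simp add: t_def)
    then have g\<eta>: "grad ?\<eta> x = (t * s) *\<^sub>R (?a - ?b)"
      by (intro grad_eqI) (simp add: inner_diff_left mult.assoc)
    have "(w has_derivative (\<lambda>h. ?a \<bullet> h - s * (t * (s * (?a \<bullet> h - ?b \<bullet> h))))) (at x)"
      unfolding w_def[abs_def] by (intro has_derivative_diff d has_derivative_mult_right d2)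
    moreover have "s * (s * y) = y" for y using s by (simp flip: mult.assoc)
    \<comment> \<open>The slope \<open>t\<close> lies in [0,1], so the new gradient is a convex
      combination of those of \<phi> and v; the sign enters twice and disappears through
      \<open>s * s = 1\<close>.\<close>
    ultimately have gw: "grad w x = ?a + t *\<^sub>R (?b - ?a)"
      by (intro grad_eqI) (simp add: inner_diff_left inner_add_left algebra_simps)
    have "norm (grad w x) powr p \<le> (1 - t) * norm ?a powr p + t * norm ?b powr p"
      unfolding gw using t p by (intro norm_powr_convex) auto
    \<comment> \<open>The tangent is taken at grad v and not at grad \<phi>, so that the field to be
      integrated by parts belongs to the fixed smooth function v.\<close>
    also have "\<dots> \<le> norm ?a powr p - t * (p * norm ?b powr (p - 2) * (?b \<bullet> (?a - ?b)))"
      using mult_left_mono[OF norm_powr_above_tangent[of p ?b ?a] t(1)] p by (simp add: algebra_simps)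
    also have "t * (p * norm ?b powr (p - 2) * (?b \<bullet> (?a - ?b)))
        = s * s * t * (p * norm ?b powr (p - 2) * (?b \<bullet> (?a - ?b)))" by (simp add: s)
    finally show ?thesis unfolding g\<eta> by (simp add: mult_ac)
  qed
  have i1: "integrable (lebesgue_on \<Omega>) (\<lambda>x. norm (grad \<phi> x) powr p)"
    and i2: "integrable (lebesgue_on \<Omega>) (\<lambda>x. norm (grad w x) powr p)"
    and i3: "integrable (lebesgue_on \<Omega>) (\<lambda>x. norm (grad v x) powr (p - 2) * (grad v x \<bullet> grad ?\<eta> x))"
    using p by (auto intro!: test_function_integrable[OF \<Omega>] continuous_on_norm_powr continuous_intros c)
  have "sobolev_lambda \<Omega> p q * (LINT x|lebesgue_on \<Omega>. norm (w x) powr q) powr (p / q)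
      \<le> (LINT x|lebesgue_on \<Omega>. norm (grad w x) powr p)"
    using p q by (intro sobolev_lambda_le \<Omega> w) auto
  also have "\<dots> \<le> (LINT x|lebesgue_on \<Omega>. norm (grad \<phi> x) powr p
      - s * p * (norm (grad v x) powr (p - 2) * (grad v x \<bullet> grad ?\<eta> x)))"
    using i1 i2 i3 pw by (intro integral_mono) auto
  also have "\<dots> = (LINT x|lebesgue_on \<Omega>. norm (grad \<phi> x) powr p)
      - s * p * (LINT x|lebesgue_on \<Omega>. norm (grad v x) powr (p - 2) * (grad v x \<bullet> grad ?\<eta> x))"
    using i1 i3 by simp
  finally show ?thesis
    unfolding p_laplacian_integration_by_parts[OF \<Omega> \<eta> p v] w_def by simp
qed

text \<open>The comparison for test functions, passed to the limit at fixed p. The set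
  \<open>C\<close> keeps the perturbations compactly supported: outside \<open>C\<close> and the
  support of the approximant, the argument of \<open>soft_pos\<close> is \<delta> - s v \<le>
  0.\<close>

lemma sobolev_extremal_energy:
  fixes u v :: "real^'n \<Rightarrow> real"
  assumes \<Omega>: "bounded \<Omega>" "open \<Omega>" and p: "p > 4" and q: "q > 0"
    and u: "sobolev_extremal \<Omega> p q u" and v: "smooth_fun_on UNIV v" and s: "s * s = 1"
    and C: "compact C" "C \<subseteq> \<Omega>" "\<And>x. x \<notin> C \<Longrightarrow> \<delta> \<le> s * v x"
  defines "\<eta> \<equiv> \<lambda>x. soft_pos (s * (u x - v x) + \<delta>)"
  shows "sobolev_lambda \<Omega> p q * (LINT x|lebesgue_on \<Omega>. norm (u x - s * \<eta> x) powr q) powr (p / q)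
    \<le> sobolev_lambda \<Omega> p q + s * p * (LINT x|lebesgue_on \<Omega>. p_laplacian p v x * \<eta> x)"
proof -
  let ?\<mu> = "lebesgue_on \<Omega>" and ?L = "sobolev_lambda \<Omega> p q"
  have "\<Omega> \<in> lmeasurable" using \<Omega> by (simp add: lmeasurable_open)
  then interpret finite_measure "lebesgue_on \<Omega>" by (rule finite_measure_lebesgue_on)
  have S: "\<Omega> \<in> sets lebesgue" using \<Omega> by (simp add: borel_open)
  have uc: "continuous_on (closure \<Omega>) u" using u by (auto simp: sobolev_extremal_def)
  have "p > 1" using p by simp
  obtain \<phi> where \<phi>: "minimizing_test_functions \<Omega> p q u \<phi>"
    using sobolev_extremal_approx[OF \<Omega> \<open>p > 1\<close> u] by blast
  note \<phi> = minimizing_test_functionsD[OF \<phi>]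
  define e where "e k x = soft_pos (s * (\<phi> k x - v x) + \<delta>)" for k x
  have \<phi>s: "smooth_fun_on UNIV (\<phi> k)" for k using \<phi>(1)[of k] by (auto simp: test_functions_def)
  have es: "smooth_fun_on UNIV (e k)" for k
    unfolding e_def[abs_def] by (intro smooth_soft_pos smooth_add smooth_mult smooth_diff smooth_const \<phi>s v)
  have e: "e k \<in> test_functions \<Omega>" for k
  proof -
    obtain K where K: "compact K" "K \<subseteq> \<Omega>" "\<And>x. x \<notin> K \<Longrightarrow> \<phi> k x = 0" using \<phi>(1)[of k] by (elim test_functionE) blast
    show ?thesis
    proof (rule test_functionI[OF es])
      show "compact (K \<union> C)" "K \<union> C \<subseteq> \<Omega>" using K C by auto
      show "e k x = 0" if "x \<notin> K \<union> C" for x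
        using that K(3)[of x] C(3)[of x] unfolding e_def by (intro soft_pos_0) simp
    qed
  qed
  have abs_s: "\<bar>s\<bar> = 1" using s by (auto simp: square_eq_1_iff)
  have el: "\<bar>e k x - \<eta> x\<bar> \<le> \<bar>\<phi> k x - u x\<bar>" for k x
  proof -
    have "\<bar>e k x - \<eta> x\<bar> \<le> \<bar>s * (\<phi> k x - u x)\<bar>"
      using soft_pos_lipschitz[of "s * (\<phi> k x - v x) + \<delta>" "s * (u x - v x) + \<delta>"]
      by (simp add: e_def \<eta>_def algebra_simps)
    then show ?thesis by (simp add: abs_mult abs_s)
  qed
  have vc: "continuous_on A v" for A by (rule smooth_imp_continuous[OF v])
  have \<eta>c: "continuous_on (closure \<Omega>) \<eta>"
    unfolding \<eta>_def by (intro continuous_on_compose2[OF continuous_on_soft_pos[of UNIV]] continuous_intros uc vc) auto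
  have wc: "continuous_on (closure \<Omega>) (\<lambda>x. u x - s * \<eta> x)" by (intro continuous_intros uc \<eta>c)
  have cc: "compact (closure \<Omega>)" using \<Omega> by simp
  obtain B where B: "\<And>x. x \<in> closure \<Omega> \<Longrightarrow> norm (u x - s * \<eta> x) \<le> B"
    using compact_imp_bounded[OF compact_continuous_image[OF wc cc]] by (auto simp: bounded_iff)
  have pc: "continuous_on (closure \<Omega>) (p_laplacian p v)" by (rule continuous_on_p_laplacian[OF p v])
  obtain P where P: "\<And>x. x \<in> closure \<Omega> \<Longrightarrow> \<bar>p_laplacian p v x\<bar> \<le> P"
    using compact_imp_bounded[OF compact_continuous_image[OF pc cc]] by (auto simp: bounded_iff)
  have cl: "x \<in> closure \<Omega>" if "x \<in> \<Omega>" for x using that closure_subset by auto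
  \<comment> \<open>The approximants need not be uniformly bounded. Truncation at a bound
    \<open>B\<close> of the limit supplies a dominating constant, leaves the limit unchanged, and
    only lowers the integral, which is the harmless direction on the left side.\<close>
  define I where "I k = (LINT x|?\<mu>. (min (norm (\<phi> k x - s * e k x)) B) powr q)" for k
  have ec: "continuous_on UNIV (e k)" "continuous_on UNIV (\<phi> k)" for k
    by (auto intro: smooth_imp_continuous es \<phi>s)
  have wkc: "continuous_on UNIV (\<lambda>x. \<phi> k x - s * e k x)" for k by (intro continuous_intros ec)
  have I_lim: "I \<longlonglongrightarrow> (LINT x|?\<mu>. norm (u x - s * \<eta> x) powr q)"
    unfolding I_def
  proof (rule integral_dominated_convergence[where w = "\<lambda>_. \<bar>B\<bar> powr q"])
    have [measurable]: "(\<lambda>x. u x - s * \<eta> x) \<in> borel_measurable ?\<mu>" "(\<lambda>x. \<phi> k x - s * e k x) \<in> borel_measurable ?\<mu>" for k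
      using integrable_lebesgue_on_continuous[OF \<Omega>(1) S wc] test_function_integrable[OF \<Omega> wkc]
      by (auto dest: borel_measurable_integrable)
    show "(\<lambda>x. norm (u x - s * \<eta> x) powr q) \<in> borel_measurable ?\<mu>"
      "(\<lambda>x. min (norm (\<phi> k x - s * e k x)) B powr q) \<in> borel_measurable ?\<mu>" for k by measurable
    show "AE x in ?\<mu>. (\<lambda>k. min (norm (\<phi> k x - s * e k x)) B powr q) \<longlonglongrightarrow> norm (u x - s * \<eta> x) powr q"
      using \<phi>(2) AE_space
    proof eventually_elim
      case (elim x)
      have "(\<lambda>k. e k x) \<longlonglongrightarrow> \<eta> x"
      proof (rule LIM_zero_cancel, rule Lim_null_comparison)
        show "\<forall>\<^sub>F k in sequentially. norm (e k x - \<eta> x) \<le> \<bar>\<phi> k x - u x\<bar>" using el by simp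
        show "(\<lambda>k. \<bar>\<phi> k x - u x\<bar>) \<longlonglongrightarrow> 0"
          using tendsto_rabs[OF LIM_zero[OF elim(1)]] by simp
      qed
      then have "(\<lambda>k. min (norm (\<phi> k x - s * e k x)) B powr q) \<longlonglongrightarrow> min (norm (u x - s * \<eta> x)) B powr q"
        using q B[OF cl, of x] elim by (intro tendsto_powr' tendsto_intros elim(1)) (auto intro: order_trans[OF norm_ge_zero])
      then show ?case using B[OF cl, of x] elim by (simp add: min_absorb1)
    qed
    show "AE x in ?\<mu>. norm (min (norm (\<phi> k x - s * e k x)) B powr q) \<le> \<bar>B\<bar> powr q" for k
    proof (rule AE_I2)
      fix x assume "x \<in> space ?\<mu>"
      then have "B \<ge> 0" using B[OF cl, of x] by (auto intro: order_trans[OF norm_ge_zero])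
      then show "norm (min (norm (\<phi> k x - s * e k x)) B powr q) \<le> \<bar>B\<bar> powr q"
        using q by (auto intro!: powr_mono2)
    qed
  qed simp
  have \<eta>i: "integrable ?\<mu> (\<lambda>x. p_laplacian p v x * \<eta> x)"
    by (intro integrable_lebesgue_on_continuous \<Omega> S continuous_intros pc \<eta>c)
  have ei: "integrable ?\<mu> (\<lambda>x. p_laplacian p v x * e k x)" for k
    by (intro test_function_integrable \<Omega> continuous_intros continuous_on_p_laplacian p v ec)
  have J_lim: "(\<lambda>k. LINT x|?\<mu>. p_laplacian p v x * e k x) \<longlonglongrightarrow> (LINT x|?\<mu>. p_laplacian p v x * \<eta> x)"
  proof (rule LIM_zero_cancel, rule Lim_null_comparison)
    have "norm ((LINT x|?\<mu>. p_laplacian p v x * e k x) - (LINT x|?\<mu>. p_laplacian p v x * \<eta> x))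
        \<le> P * (LINT x|?\<mu>. \<bar>\<phi> k x - u x\<bar>)" for k
    proof -
      have i1: "integrable ?\<mu> (\<lambda>x. \<phi> k x - u x)"
        by (intro integrable_lebesgue_on_continuous \<Omega> S continuous_intros uc continuous_on_subset[OF ec(2)]) auto
      have "norm ((LINT x|?\<mu>. p_laplacian p v x * e k x) - (LINT x|?\<mu>. p_laplacian p v x * \<eta> x))
          = norm (LINT x|?\<mu>. p_laplacian p v x * e k x - p_laplacian p v x * \<eta> x)"
        using ei \<eta>i by simp
      also have "\<dots> \<le> (LINT x|?\<mu>. norm (p_laplacian p v x * e k x - p_laplacian p v x * \<eta> x))"
        by (rule integral_norm_bound)
      also have "\<dots> \<le> (LINT x|?\<mu>. P * \<bar>\<phi> k x - u x\<bar>)"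
      proof (rule integral_mono)
        show "integrable ?\<mu> (\<lambda>x. norm (p_laplacian p v x * e k x - p_laplacian p v x * \<eta> x))"
          using ei \<eta>i by (intro integrable_norm Bochner_Integration.integrable_diff)
        show "integrable ?\<mu> (\<lambda>x. P * \<bar>\<phi> k x - u x\<bar>)" using i1 by simp
        show "norm (p_laplacian p v x * e k x - p_laplacian p v x * \<eta> x) \<le> P * \<bar>\<phi> k x - u x\<bar>"
          if "x \<in> space ?\<mu>" for x
          using mult_mono[OF P[OF cl, of x] el[of k x]] that P[OF cl, of x]
          by (simp flip: right_diff_distrib add: abs_mult)
      qed
      finally show ?thesis by simp
    qed
    then show "\<forall>\<^sub>F k in sequentially. norm ((LINT x|?\<mu>. p_laplacian p v x * e k x) - (LINT x|?\<mu>. p_laplacian p v x * \<eta> x))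
        \<le> P * (LINT x|?\<mu>. \<bar>\<phi> k x - u x\<bar>)" by simp
    show "(\<lambda>k. P * (LINT x|?\<mu>. \<bar>\<phi> k x - u x\<bar>)) \<longlonglongrightarrow> 0"
      using tendsto_mult_left[OF \<phi>(3), of P] by simp
  qed
  have L0: "?L \<ge> 0"
    using u unfolding sobolev_extremal_def by (metis powr_ge_zero)
  show ?thesis
  proof (rule field_le_epsilon)
    fix \<tau> :: real assume \<tau>: "\<tau> > 0"
    have lhs: "(\<lambda>k. ?L * I k powr (p / q)) \<longlonglongrightarrow> ?L * (LINT x|?\<mu>. norm (u x - s * \<eta> x) powr q) powr (p / q)"
      using p q by (intro tendsto_intros tendsto_powr' I_lim) (auto simp: I_def)
    have rhs: "(\<lambda>k. ?L + \<tau> + s * p * (LINT x|?\<mu>. p_laplacian p v x * e k x)) \<longlonglongrightarrow>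
        ?L + \<tau> + s * p * (LINT x|?\<mu>. p_laplacian p v x * \<eta> x)"
      by (intro tendsto_intros J_lim)
    have "\<forall>\<^sub>F k in sequentially. ?L * I k powr (p / q) \<le> ?L + \<tau> + s * p * (LINT x|?\<mu>. p_laplacian p v x * e k x)"
      using \<phi>(4)[OF \<tau>]
    proof eventually_elim
      case (elim k)
      have i: "integrable ?\<mu> (\<lambda>x. norm (\<phi> k x - s * e k x) powr q)"
        using q by (intro test_function_integrable[OF \<Omega>] continuous_on_norm_powr wkc)
      have "I k \<le> (LINT x|?\<mu>. norm (\<phi> k x - s * e k x) powr q)"
        unfolding I_def
      proof (rule integral_mono')
        fix x assume x: "x \<in> space ?\<mu>"
        then have "B \<ge> 0" using B[OF cl, of x] by (auto intro: order_trans[OF norm_ge_zero])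
        then show "min (norm (\<phi> k x - s * e k x)) B powr q \<le> norm (\<phi> k x - s * e k x) powr q"
          using q by (intro powr_mono2) auto
      qed (use i in auto)
      then have "?L * I k powr (p / q) \<le> ?L * (LINT x|?\<mu>. norm (\<phi> k x - s * e k x) powr q) powr (p / q)"
        using L0 p q by (intro mult_left_mono powr_mono2) (auto simp: I_def)
      also have "\<dots> \<le> (LINT x|?\<mu>. norm (grad (\<phi> k) x) powr p) + s * p * (LINT x|?\<mu>. p_laplacian p v x * e k x)"
        using test_function_energy[OF \<Omega> \<phi>(1) p q v s e[unfolded e_def[abs_def]]] by (simp add: e_def)
      finally show ?case using elim by simp
    qed
    from tendsto_le[OF _ rhs lhs this]
    show "?L * (LINT x|?\<mu>. norm (u x - s * \<eta> x) powr q) powr (p / q)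
        \<le> ?L + s * p * (LINT x|?\<mu>. p_laplacian p v x * \<eta> x) + \<tau>" by simp
  qed
qed

section \<open>Growth of the Sobolev constants and box averages\<close>

lemma sqrt_powr_has_derivative:
  fixes t :: real
  assumes "t > 0"
  shows "((\<lambda>t. (\<Prod>i<j. 1 / 2 - real i) * t powr (1 / 2 - real j)) has_real_derivative
    (\<Prod>i<Suc j. 1 / 2 - real i) * t powr (1 / 2 - real (Suc j))) (at t)"
proof -
  have "1 / 2 - real j - 1 = 1 / 2 - real (Suc j)" by simp
  then show ?thesis
    using DERIV_cmult[OF has_real_derivative_powr[OF assms, of "1 / 2 - real j"], of "\<Prod>i<j. 1 / 2 - real i"]
    by (simp add: mult.assoc)
qed

lemma smooth_sqrt:
  assumes f: "smooth_fun_on UNIV f" and pos: "\<And>x. f x > 0"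
  shows "smooth_fun_on UNIV (\<lambda>x. sqrt (f x))"
proof -
  have "smooth_fun_on UNIV (\<lambda>x. (\<Prod>i<(0::nat). 1 / 2 - real i) * f x powr (1 / 2 - real 0))"
    by (rule smooth_compose[where h = "\<lambda>j t. (\<Prod>i<j. 1 / 2 - real i) * t powr (1 / 2 - real j)"])
      (use f pos sqrt_powr_has_derivative in auto)
  then show ?thesis using pos by (simp add: powr_half_sqrt less_imp_le)
qed

text \<open>The cone R - |x - a| is smoothed at its vertex by a square root and at its base by
  \<open>soft_pos\<close>. Of the loss 4 e, the shift that makes the support compact costs 2 e, and
  each smoothing costs e.\<close>

lemma cone_test_function:
  fixes a :: "real^'n"
  assumes B: "ball a R \<subseteq> \<Omega>" and e: "e > 0" "R > 2 * e"
  obtains \<psi> where "\<psi> \<in> test_functions \<Omega>" "\<And>x. norm (grad \<psi> x) \<le> 1"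
    "\<And>x. R - 4 * e - norm (x - a) \<le> \<psi> x"
proof -
  define z where "z x = sqrt (e\<^sup>2 + (norm (x - a))\<^sup>2)" for x
  define \<psi> where "\<psi> x = e * soft_pos (1 / e * (R - 2 * e - z x))" for x
  have pos: "e\<^sup>2 + (norm (x - a))\<^sup>2 > 0" for x using e by (simp add: add_pos_nonneg)
  have z_ge: "norm (x - a) \<le> z x" for x unfolding z_def by (rule real_le_rsqrt) simp
  have z_pos: "z x > 0" for x unfolding z_def using pos by simp
  have z_le: "z x \<le> e + norm (x - a)" for x
    unfolding z_def using e by (intro real_le_lsqrt) (auto simp: power2_sum)
  have zs: "smooth_fun_on UNIV z"
    unfolding z_def[abs_def] by (intro smooth_sqrt smooth_add smooth_const smooth_dist2 pos)
  have \<psi>s: "smooth_fun_on UNIV \<psi>"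
    unfolding \<psi>_def[abs_def] by (intro smooth_mult smooth_const smooth_soft_pos smooth_diff zs)
  have t: "\<psi> \<in> test_functions \<Omega>"
  proof (rule test_functionI[OF \<psi>s])
    show "compact (cball a (R - 2 * e))" by simp
    show "cball a (R - 2 * e) \<subseteq> \<Omega>" using B e by auto
    show "\<psi> x = 0" if "x \<notin> cball a (R - 2 * e)" for x
      using that z_ge[of x] e unfolding \<psi>_def
      by (auto simp: dist_norm norm_minus_commute mult_nonneg_nonpos intro!: soft_pos_0 divide_nonpos_pos)
  qed
  have g: "norm (grad \<psi> x) \<le> 1" for x
  proof -
    have d0: "((\<lambda>x. e\<^sup>2 + (x - a) \<bullet> (x - a)) has_derivative (\<lambda>h. 2 * ((x - a) \<bullet> h))) (at x)"
      by (auto intro!: derivative_eq_intros simp: inner_commute)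
    have d1: "(z has_derivative (\<lambda>h. ((x - a) \<bullet> h) / z x)) (at x)"
      using has_derivative_real_sqrt[OF _ d0] pos[of x] z_pos[of x]
      by (simp add: z_def[abs_def] power2_norm_eq_inner divide_simps)
    have d2: "((\<lambda>x. 1 / e * (R - 2 * e - z x)) has_derivative (\<lambda>h. - (((x - a) \<bullet> h) / z x) / e)) (at x)"
      using e by (auto intro!: derivative_eq_intros d1)
    let ?t = "soft_pos' (1 / e * (R - 2 * e - z x))"
    have "(\<psi> has_derivative (\<lambda>h. e * (?t * (- (((x - a) \<bullet> h) / z x) / e)))) (at x)"
      unfolding \<psi>_def[abs_def]
      by (intro has_derivative_mult_right has_derivative_compose[OF d2 soft_pos_has_derivative[unfolded has_field_derivative_def]])
    then have "grad \<psi> x = (- ?t / z x) *\<^sub>R (x - a)"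
      using e by (intro grad_eqI) (simp add: mult.assoc)
    then have "norm (grad \<psi> x) = ?t * (norm (x - a) / z x)"
      using soft_pos'_bounds(1) z_pos[of x] by (simp add: abs_mult)
    also have "\<dots> \<le> 1 * 1"
      using soft_pos'_bounds z_pos[of x] z_ge[of x] by (intro mult_mono) auto
    finally show ?thesis by simp
  qed
  have "R - 4 * e - norm (x - a) \<le> \<psi> x" for x
  proof -
    have "e * (1 / e * (R - 2 * e - z x) - 1) \<le> \<psi> x"
      unfolding \<psi>_def using e by (intro mult_left_mono soft_pos_ge) auto
    moreover have "e * (1 / e * (R - 2 * e - z x) - 1) = R - 3 * e - z x"
      using e by (simp add: field_simps)
    ultimately show ?thesis using z_le[of x] by linarith
  qed
  with t g show thesis by (rule that)
qed

lemma integral_ge_on_ball: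
  fixes f :: "real^'n \<Rightarrow> real"
  assumes S: "bounded S" "S \<in> sets lebesgue" and f: "continuous_on (closure S) f" "\<And>x. x \<in> S \<Longrightarrow> f x \<ge> 0"
    and B: "ball z r \<subseteq> S" "\<And>x. x \<in> ball z r \<Longrightarrow> c \<le> f x"
  shows "c * measure lebesgue (ball z r) \<le> (LINT x|lebesgue_on S. f x)"
proof -
  have "S \<in> lmeasurable" using S bounded_set_imp_lmeasurable by blast
  then interpret finite_measure "lebesgue_on S" by (rule finite_measure_lebesgue_on)
  have bs: "ball z r \<in> sets (lebesgue_on S)" using B S by (simp add: sets_restrict_space_iff)
  have "c * measure lebesgue (ball z r) = (LINT y|lebesgue_on S. c * indicator (ball z r) y)"
    using B S by (simp add: measure_restrict_space Int_absorb2)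
  also have "\<dots> \<le> (LINT y|lebesgue_on S. f y)"
  proof (rule integral_mono)
    show "integrable (lebesgue_on S) (\<lambda>y. c * indicator (ball z r) y)"
    proof (intro integrable_mult_right integrable_real_indicator)
      show "emeasure (lebesgue_on S) (ball z r) < \<infinity>"
        by (simp only: emeasure_eq_measure ennreal_less_top infinity_ennreal_def)
    qed (rule bs)
    show "integrable (lebesgue_on S) f" by (rule integrable_lebesgue_on_continuous[OF S f(1)])
    show "c * indicator (ball z r) y \<le> f y" if "y \<in> space (lebesgue_on S)" for y
      using that B(2)[of y] f(2)[of y] by (auto simp: indicator_def)
  qed
  finally show ?thesis .
qed

lemma measure_ball_pos: "r > 0 \<Longrightarrow> measure lebesgue (ball (z::real^'n) r) > 0"
  by (simp add: content_ball_pos measure_completion)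

text \<open>A cone of slope at most 1 that stays above 1/L on a small ball competes after
  normalisation. What matters is that \<open>C\<close> depends on neither p nor q.\<close>

lemma sobolev_lambda_upper_bound:
  fixes a :: "real^'n"
  assumes \<Omega>: "bounded \<Omega>" "open \<Omega>" and B: "ball a R \<subseteq> \<Omega>" and R: "R > 0" and L: "L > 1 / R"
  obtains C where "C > 0" "\<And>p q. p > 1 \<Longrightarrow> q \<ge> p \<Longrightarrow> sobolev_lambda \<Omega> p q \<le> C * L powr p"
proof -
  have "1 / R > 0" using R by simp
  then have L0: "L > 0" using L by linarith
  \<comment> \<open>On the ball of radius e the smoothed cone is at least R - 4 e - e, which is
    1/L.\<close>
  define e where "e = (R - 1 / L) / 5"
  have "1 / L < R" using L L0 R by (simp add: field_simps)
  then have e0: "e > 0" by (simp add: e_def)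
  have e5: "5 * e = R - 1 / L" "1 / L > 0" using L0 by (simp_all add: e_def)
  with e0 have e: "e > 0" "R > 2 * e" by linarith+
  obtain \<psi> where \<psi>: "\<psi> \<in> test_functions \<Omega>" "\<And>x. norm (grad \<psi> x) \<le> 1"
    "\<And>x. R - 4 * e - norm (x - a) \<le> \<psi> x"
    using cone_test_function[OF B e] by blast
  have \<psi>s: "smooth_fun_on UNIV \<psi>" using \<psi> by (auto simp: test_functions_def)
  have S: "\<Omega> \<in> sets lebesgue" using \<Omega> by (simp add: borel_open)
  have "\<Omega> \<in> lmeasurable" using \<Omega> by (simp add: lmeasurable_open)
  then interpret finite_measure "lebesgue_on \<Omega>" by (rule finite_measure_lebesgue_on)
  let ?\<mu> = "lebesgue_on \<Omega>"
  define m where "m = measure lebesgue (ball a e)"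
  have m: "m > 0" unfolding m_def by (rule measure_ball_pos[OF e(1)])
  have Bs: "ball a e \<subseteq> \<Omega>" using B e by (auto simp: subset_iff)
  define C where "C = (measure ?\<mu> (space ?\<mu>) + 1) / min 1 m"
  have C: "C > 0" unfolding C_def using m by (intro divide_pos_pos) (auto simp: add_nonneg_pos)
  have "sobolev_lambda \<Omega> p q \<le> C * L powr p" if p: "p > 1" "q \<ge> p" for p q
  proof -
    have "q > 0" using p by simp
    have "continuous_on UNIV \<psi>" "continuous_on UNIV (grad \<psi>)"
      using \<psi>s by (auto intro: smooth_continuous_grad smooth_imp_continuous)
    then have i: "integrable ?\<mu> (\<lambda>x. norm (\<psi> x) powr q)" "integrable ?\<mu> (\<lambda>x. norm (grad \<psi> x) powr p)"
      using p \<open>q > 0\<close> by (intro test_function_integrable[OF \<Omega>] continuous_on_norm_powr; simp)+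
    have "(LINT x|?\<mu>. norm (grad \<psi> x) powr p) \<le> (LINT x|?\<mu>. 1)"
      using i \<psi>(2) p by (intro integral_mono) (auto intro!: powr_le1)
    then have up: "(LINT x|?\<mu>. norm (grad \<psi> x) powr p) \<le> measure ?\<mu> (space ?\<mu>) + 1" by simp
    have low: "(1 / L) powr q * m \<le> (LINT x|?\<mu>. norm (\<psi> x) powr q)"
      unfolding m_def
    proof (rule integral_ge_on_ball[OF \<Omega>(1) S _ _ Bs])
      show "continuous_on (closure \<Omega>) (\<lambda>x. norm (\<psi> x) powr q)"
        using \<open>q > 0\<close> by (intro continuous_on_norm_powr smooth_imp_continuous \<psi>s)
      show "(1 / L) powr q \<le> norm (\<psi> x) powr q" if "x \<in> ball a e" for x
      proof -
        have "norm (x - a) < e" using that by (simp add: dist_norm norm_minus_commute)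
        with e5(1) have "1 / L \<le> norm (\<psi> x)" using \<psi>(3)[of x] by simp
        then show ?thesis using L0 p by (intro powr_mono2) auto
      qed
    qed simp
    \<comment> \<open>The volume of the ball enters with the exponent p/q, which lies between 0 and
      1; \<open>min 1 m\<close> bounds all these powers from below.\<close>
    have "(1 / L) powr p * min 1 m \<le> (1 / L) powr p * m powr (p / q)"
    proof (intro mult_left_mono)
      show "min 1 m \<le> m powr (p / q)"
      proof (cases "m \<ge> 1")
        case True
        then have "1 \<le> m powr (p / q)" using p by (intro ge_one_powr_ge_zero) auto
        then show ?thesis by simp
      next
        case False
        then have "m powr 1 \<le> m powr (p / q)" using p m by (intro powr_mono') auto
        then show ?thesis using m by simp
      qed
    qed simp
    also have "\<dots> = ((1 / L) powr q * m) powr (p / q)"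
      using p m L0 by (simp add: powr_mult powr_powr)
    also have "\<dots> \<le> (LINT x|?\<mu>. norm (\<psi> x) powr q) powr (p / q)"
      using low m p by (intro powr_mono2) auto
    finally have low2: "(1 / L) powr p * min 1 m \<le> (LINT x|?\<mu>. norm (\<psi> x) powr q) powr (p / q)" .
    show ?thesis
    proof (cases "sobolev_lambda \<Omega> p q \<le> 0")
      case True
      moreover have "0 \<le> C * L powr p" using C by simp
      ultimately show ?thesis by linarith
    next
      case False
      then have "sobolev_lambda \<Omega> p q * ((1 / L) powr p * min 1 m) \<le> measure ?\<mu> (space ?\<mu>) + 1"
        using mult_left_mono[OF low2, of "sobolev_lambda \<Omega> p q"] up
          sobolev_lambda_le[OF \<Omega> p(1) \<open>q > 0\<close> \<psi>(1)] by linarith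
      then show ?thesis using m L0 by (simp add: C_def powr_divide field_simps)
    qed
  qed
  with C show thesis by (rule that)
qed

section \<open>Averages over translated boxes\<close>

lemma integrable_lebesgue_on_indicator_cbox:
  fixes f :: "'a::euclidean_space \<Rightarrow> real"
  assumes S: "bounded S" "S \<in> sets lebesgue" and f: "continuous_on (closure S) f"
  shows "integrable (lebesgue_on S) (\<lambda>x. indicator (cbox c e) x * f x)"
proof -
  have "cbox c e \<inter> S \<in> sets (lebesgue_on S)"
    using S by (auto simp: sets_restrict_space_iff intro: sets.Int)
  from integrable_real_mult_indicator[OF this integrable_lebesgue_on_continuous[OF S f]]
  have "integrable (lebesgue_on S) (\<lambda>x. f x * indicator (cbox c e \<inter> S) x)" .
  then show ?thesis
    by (rule Bochner_Integration.integrable_cong[THEN iffD1, rotated -1]) (auto simp: indicator_def)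
qed

lemma integral_lebesgue_on_indicator_cbox:
  fixes f :: "real^'n \<Rightarrow> real"
  assumes "\<Omega> \<in> sets lebesgue" "continuous_on UNIV f" "\<And>x. x \<notin> \<Omega> \<Longrightarrow> f x = 0"
  shows "(LINT x|lebesgue_on \<Omega>. indicator (cbox c d) x * f x) = integral (cbox c d) f"
proof -
  have "(LINT x|lebesgue_on \<Omega>. indicator (cbox c d) x * f x) = (LINT x|lebesgue. (if x \<in> \<Omega> then indicator (cbox c d) x * f x else 0))"
    by (rule Lebesgue_Measure.integral_restrict_UNIV[symmetric, OF assms(1)])
  also have "(\<lambda>x. if x \<in> \<Omega> then indicator (cbox c d) x * f x else 0) = (\<lambda>x. if x \<in> cbox c d then f x else 0)"
    using assms(3) by (auto simp: indicator_def fun_eq_iff)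
  also have "(LINT x|lebesgue. (if x \<in> cbox c d then f x else 0)) = (LINT x|lebesgue_on (cbox c d). f x)"
    by (rule Lebesgue_Measure.integral_restrict_UNIV) simp
  also have "\<dots> = integral (cbox c d) f"
    by (intro lebesgue_integral_eq_integral integrable_lebesgue_on_continuous)
      (auto intro: continuous_on_subset[OF assms(2)])
  finally show ?thesis .
qed

text \<open>Differentiate the integral while the box travels along the segment from a to b. As
  \<phi> vanishes off the domain, the box may leave it on the way, and its share of the energy never
  exceeds the total.\<close>

lemma test_function_box_average:
  fixes a b d :: "real^'n"
  assumes \<Omega>: "bounded \<Omega>" "open \<Omega>" and \<phi>: "\<phi> \<in> test_functions \<Omega>" and p: "p > 1" and \<alpha>: "\<alpha> > 0"
  shows "\<bar>(LINT x|lebesgue_on \<Omega>. indicator (cbox (b - d) (b + d)) x * \<phi> x)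
      - (LINT x|lebesgue_on \<Omega>. indicator (cbox (a - d) (a + d)) x * \<phi> x)\<bar>
    \<le> norm (b - a) * (\<alpha> * measure lborel (cbox (- d) d) + \<alpha> powr (1 - p) * (LINT x|lebesgue_on \<Omega>. norm (grad \<phi> x) powr p))"
proof -
  have S: "\<Omega> \<in> sets lebesgue" using \<Omega> by (simp add: borel_open)
  obtain K where K: "smooth_fun_on UNIV \<phi>" "compact K" "K \<subseteq> \<Omega>" "\<And>x. x \<notin> K \<Longrightarrow> \<phi> x = 0" "\<And>x. x \<notin> K \<Longrightarrow> grad \<phi> x = 0"
    using test_functionE[OF \<phi>] by metis
  have c: "continuous_on A \<phi>" "continuous_on A (grad \<phi>)" for A
    using K by (auto intro: smooth_imp_continuous smooth_continuous_grad)
  let ?Q = "cbox (- d) d"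
  define \<gamma> where "\<gamma> t = a + t *\<^sub>R (b - a)" for t
  define A where "A t = integral ?Q (\<lambda>z. \<phi> (z + \<gamma> t))" for t
  define D where "D t = integral ?Q (\<lambda>z. grad \<phi> (z + \<gamma> t) \<bullet> (b - a))" for t
  have shift: "integral ?Q (\<lambda>z. f (z + e)) = (LINT x|lebesgue_on \<Omega>. indicator (cbox (e - d) (e + d)) x * f x)"
    if "continuous_on UNIV f" "\<And>x. x \<notin> \<Omega> \<Longrightarrow> f x = 0" for f :: "real^'n \<Rightarrow> real" and e
    using integral_lebesgue_on_indicator_cbox[OF S that] integral_shift_cbox[of "e - d" e "e + d" f] by simp
  have A_eq: "A t = (LINT x|lebesgue_on \<Omega>. indicator (cbox (\<gamma> t - d) (\<gamma> t + d)) x * \<phi> x)" for t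
    unfolding A_def using c K by (intro shift) auto
  have Ad: "(A has_real_derivative D t) (at t within UNIV)" for t
    unfolding A_def[abs_def] D_def
  proof (rule leibniz_rule_field_derivative)
    show "(\<lambda>z. \<phi> (z + \<gamma> t)) integrable_on ?Q" for t
      by (intro integrable_continuous continuous_on_compose2[OF c(1)[of UNIV]] continuous_intros) auto
    show "continuous_on (UNIV \<times> ?Q) (\<lambda>(t, z). grad \<phi> (z + \<gamma> t) \<bullet> (b - a))"
      unfolding case_prod_beta \<gamma>_def
      by (intro continuous_on_inner continuous_on_compose2[OF c(2)[of UNIV]] continuous_intros) auto
    show "((\<lambda>t. \<phi> (z + \<gamma> t)) has_real_derivative grad \<phi> (z + \<gamma> t) \<bullet> (b - a)) (at t within UNIV)" for t z
    proof -
      have "((\<lambda>t. z + \<gamma> t) has_derivative (\<lambda>s. s *\<^sub>R (b - a))) (at t)"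
        unfolding \<gamma>_def by (auto intro!: derivative_eq_intros)
      from has_derivative_compose[OF this has_derivative_grad[OF smooth_imp_differentiable[OF K(1)]]]
      show ?thesis by (simp add: has_field_derivative_def mult_commute_abs)
    qed
  qed auto
  let ?B = "\<alpha> * measure lborel ?Q + \<alpha> powr (1 - p) * (LINT x|lebesgue_on \<Omega>. norm (grad \<phi> x) powr p)"
  have Db: "\<bar>D t\<bar> \<le> norm (b - a) * ?B" for t
  proof -
    let ?g = "\<lambda>x. norm (grad \<phi> x) powr p"
    have gc: "continuous_on A ?g" for A using p by (intro continuous_on_norm_powr c) auto
    have ig: "(\<lambda>z. ?g (z + \<gamma> t)) integrable_on ?Q"
      by (intro integrable_continuous continuous_on_compose2[OF gc[of UNIV]] continuous_intros) auto
    have "\<bar>D t\<bar> \<le> integral ?Q (\<lambda>z. norm (b - a) * (\<alpha> + \<alpha> powr (1 - p) * ?g (z + \<gamma> t)))"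
      unfolding D_def real_norm_def[symmetric]
    proof (rule integral_norm_bound_integral)
      show "(\<lambda>z. grad \<phi> (z + \<gamma> t) \<bullet> (b - a)) integrable_on ?Q"
        by (intro integrable_continuous continuous_on_inner continuous_on_compose2[OF c(2)[of UNIV]] continuous_intros) auto
      show "(\<lambda>z. norm (b - a) * (\<alpha> + \<alpha> powr (1 - p) * ?g (z + \<gamma> t))) integrable_on ?Q"
        by (intro integrable_continuous continuous_intros continuous_on_compose2[OF gc[of UNIV]]) auto
      show "norm (grad \<phi> (z + \<gamma> t) \<bullet> (b - a)) \<le> norm (b - a) * (\<alpha> + \<alpha> powr (1 - p) * ?g (z + \<gamma> t))" for z
      proof -
        have "norm (grad \<phi> (z + \<gamma> t) \<bullet> (b - a)) \<le> norm (b - a) * norm (grad \<phi> (z + \<gamma> t))"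
          using Cauchy_Schwarz_ineq2[of "grad \<phi> (z + \<gamma> t)" "b - a"] by (simp add: mult.commute)
        also have "\<dots> \<le> norm (b - a) * (\<alpha> + \<alpha> powr (1 - p) * ?g (z + \<gamma> t))"
          using \<alpha> p by (intro mult_left_mono le_add_powr) auto
        finally show ?thesis .
      qed
    qed
    also have "\<dots> = norm (b - a) * (\<alpha> * measure lborel ?Q + \<alpha> powr (1 - p) * integral ?Q (\<lambda>z. ?g (z + \<gamma> t)))"
    proof -
      have "integral ?Q (\<lambda>z. \<alpha> + \<alpha> powr (1 - p) * ?g (z + \<gamma> t))
          = integral ?Q (\<lambda>z. \<alpha>) + integral ?Q (\<lambda>z. \<alpha> powr (1 - p) * ?g (z + \<gamma> t))"
        by (intro integral_add integrable_const integrable_on_mult_right ig)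
      then show ?thesis by (simp add: mult.commute)
    qed
    also have "integral ?Q (\<lambda>z. ?g (z + \<gamma> t)) = (LINT x|lebesgue_on \<Omega>. indicator (cbox (\<gamma> t - d) (\<gamma> t + d)) x * ?g x)"
      using K by (intro shift gc) auto
    also have "\<dots> \<le> (LINT x|lebesgue_on \<Omega>. ?g x)"
      by (intro integral_mono') (auto intro!: test_function_integrable[OF \<Omega>] gc simp: indicator_def)
    finally show ?thesis using \<alpha> by (simp add: mult_left_mono)
  qed
  have "norm (A 1 - A 0) \<le> norm (b - a) * ?B * norm (1 - (0::real))"
    by (rule field_differentiable_bound[of UNIV A D]) (use Ad Db in auto)
  then show ?thesis unfolding A_eq by (simp add: \<gamma>_def)
qed

text \<open>The left side is built from linear functionals of the function, so L^1 convergence of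
  the approximants and the upper bound of their energies suffice.\<close>

lemma sobolev_extremal_box_average:
  fixes a b d :: "real^'n"
  assumes \<Omega>: "bounded \<Omega>" "open \<Omega>" and u: "sobolev_extremal \<Omega> p q u" and p: "p > 1" and \<alpha>: "\<alpha> > 0"
  shows "\<bar>(LINT x|lebesgue_on \<Omega>. indicator (cbox (b - d) (b + d)) x * u x)
      - (LINT x|lebesgue_on \<Omega>. indicator (cbox (a - d) (a + d)) x * u x)\<bar>
    \<le> norm (b - a) * (\<alpha> * measure lborel (cbox (- d) d) + \<alpha> powr (1 - p) * sobolev_lambda \<Omega> p q)"
proof -
  let ?\<mu> = "lebesgue_on \<Omega>" and ?L = "sobolev_lambda \<Omega> p q"
  have S: "\<Omega> \<in> sets lebesgue" using \<Omega> by (simp add: borel_open)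
  have uc: "continuous_on (closure \<Omega>) u" using u by (auto simp: sobolev_extremal_def)
  obtain \<phi> where \<phi>: "minimizing_test_functions \<Omega> p q u \<phi>"
    using sobolev_extremal_approx[OF \<Omega> p u] by blast
  note \<phi> = minimizing_test_functionsD[OF \<phi>]
  have \<phi>s: "smooth_fun_on UNIV (\<phi> k)" for k using \<phi>(1)[of k] by (auto simp: test_functions_def)
  have ui: "integrable ?\<mu> u" by (rule integrable_lebesgue_on_continuous[OF \<Omega>(1) S uc])
  have \<phi>i: "integrable ?\<mu> (\<phi> k)" for k by (intro test_function_integrable \<Omega> smooth_imp_continuous \<phi>s)
  note ind = integrable_lebesgue_on_indicator_cbox[OF \<Omega>(1) S]
  have lim: "(\<lambda>k. LINT x|?\<mu>. indicator (cbox c e) x * \<phi> k x) \<longlonglongrightarrow> (LINT x|?\<mu>. indicator (cbox c e) x * u x)" for c e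
  proof (rule LIM_zero_cancel, rule Lim_null_comparison[OF _ \<phi>(3)], rule always_eventually, rule allI)
    fix k
    have "norm ((LINT x|?\<mu>. indicator (cbox c e) x * \<phi> k x) - (LINT x|?\<mu>. indicator (cbox c e) x * u x))
       = norm (LINT x|?\<mu>. indicator (cbox c e) x * \<phi> k x - indicator (cbox c e) x * u x)"
      using ind[OF uc] ind[OF smooth_imp_continuous[OF \<phi>s]] by simp
    also have "\<dots> \<le> (LINT x|?\<mu>. norm (indicator (cbox c e) x * \<phi> k x - indicator (cbox c e) x * u x))"
      by (rule integral_norm_bound)
    also have "\<dots> \<le> (LINT x|?\<mu>. \<bar>\<phi> k x - u x\<bar>)"
      using ui \<phi>i by (intro integral_mono') (auto simp: indicator_def)
    finally show "norm ((LINT x|?\<mu>. indicator (cbox c e) x * \<phi> k x) - (LINT x|?\<mu>. indicator (cbox c e) x * u x))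
       \<le> (LINT x|?\<mu>. \<bar>\<phi> k x - u x\<bar>)" .
  qed
  show ?thesis
  proof (rule field_le_epsilon)
    fix \<tau> :: real assume \<tau>: "\<tau> > 0"
    define c where "c = norm (b - a) * \<alpha> powr (1 - p)"
    have c: "c \<ge> 0" by (simp add: c_def)
    define \<tau>' where "\<tau>' = \<tau> / (c + 1)"
    have \<tau>': "\<tau>' > 0" using \<tau> c by (simp add: \<tau>'_def)
    have "c * \<tau>' \<le> \<tau>" using \<tau> c by (simp add: \<tau>'_def field_simps)
    let ?A = "\<lambda>f. \<bar>(LINT x|?\<mu>. indicator (cbox (b - d) (b + d)) x * f x) - (LINT x|?\<mu>. indicator (cbox (a - d) (a + d)) x * f x)\<bar>"
    let ?B = "norm (b - a) * (\<alpha> * measure lborel (cbox (- d) d) + \<alpha> powr (1 - p) * ?L)"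
    have "\<forall>\<^sub>F k in sequentially. ?A (\<phi> k) \<le> ?B + \<tau>"
      using \<phi>(4)[OF \<tau>']
    proof eventually_elim
      case (elim k)
      have "?A (\<phi> k) \<le> norm (b - a) * (\<alpha> * measure lborel (cbox (- d) d) + \<alpha> powr (1 - p) * (LINT x|?\<mu>. norm (grad (\<phi> k) x) powr p))"
        by (rule test_function_box_average[OF \<Omega> \<phi>(1) p \<alpha>])
      also have "\<dots> \<le> norm (b - a) * (\<alpha> * measure lborel (cbox (- d) d) + \<alpha> powr (1 - p) * (?L + \<tau>'))"
        using elim by (intro mult_left_mono add_left_mono) auto
      also have "\<dots> = ?B + c * \<tau>'" by (simp add: c_def algebra_simps)
      finally show ?case using \<open>c * \<tau>' \<le> \<tau>\<close> by linarith
    qed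
    moreover have "(\<lambda>k. ?A (\<phi> k)) \<longlonglongrightarrow> ?A u" by (intro tendsto_intros lim)
    ultimately show "?A u \<le> ?B + \<tau>" by (intro tendsto_upperbound[of "\<lambda>k. ?A (\<phi> k)"]) auto
  qed
qed

section \<open>Polynomial test functions\<close>

lemma Ck_on_subset: "Ck_on k S f \<Longrightarrow> T \<subseteq> S \<Longrightarrow> Ck_on k T f"
  by (induction k arbitrary: f) (auto intro: continuous_on_subset)

lemma inf_laplacian_eq_derivative:
  assumes "\<And>i. (partial_deriv i v has_derivative D i) (at x)"
  shows "inf_laplacian v x = (\<Sum>i\<in>UNIV. grad v x $ i * D i (grad v x))"
proof -
  have "D i (grad v x) = (\<Sum>j\<in>UNIV. grad v x $ j * partial_deriv j (partial_deriv i v) x)" for i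
  proof -
    have "partial_deriv i v differentiable (at x)" using assms differentiable_def by blast
    from has_derivative_unique[OF assms has_derivative_partial[OF this]] show ?thesis by simp
  qed
  then show ?thesis
    by (simp add: inf_laplacian_def grad_def sum_distrib_left mult.assoc)
qed

text \<open>The mean value estimate for the remainder along the ray from x0. Only the quadratic form
  h . (A h) enters, so commuting of the mixed partial derivatives is never invoked.\<close>

lemma taylor_second_order:
  fixes f :: "real^'n \<Rightarrow> real" and A :: "real^'n^'n"
  assumes r: "r > 0" and f: "\<And>x. x \<in> ball x0 r \<Longrightarrow> f differentiable (at x)"
    and A: "(grad f has_derivative (\<lambda>k. A *v k)) (at x0)" and e: "e > 0"
  obtains \<rho> where "0 < \<rho>" "\<rho> < r"
    "\<And>h. norm h < \<rho> \<Longrightarrow> \<bar>f (x0 + h) - f x0 - grad f x0 \<bullet> h - h \<bullet> (A *v h) / 2\<bar> \<le> e * (norm h)\<^sup>2"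
proof -
  obtain d where d: "d > 0" "\<And>y. norm (y - x0) < d \<Longrightarrow> norm (grad f y - grad f x0 - A *v (y - x0)) \<le> e * norm (y - x0)"
    using A e unfolding has_derivative_at_alt by blast
  define \<rho> where "\<rho> = min d (r / 2)"
  have \<rho>: "0 < \<rho>" "\<rho> < r" "\<rho> \<le> d" using d r by (auto simp: \<rho>_def)
  have "\<bar>f (x0 + h) - f x0 - grad f x0 \<bullet> h - h \<bullet> (A *v h) / 2\<bar> \<le> e * (norm h)\<^sup>2" if h: "norm h < \<rho>" for h
  proof -
    define F where "F t = f (x0 + t *\<^sub>R h) - t * (grad f x0 \<bullet> h) - t\<^sup>2 * (h \<bullet> (A *v h) / 2)" for t
    define F' where "F' t = (grad f (x0 + t *\<^sub>R h) - grad f x0 - A *v (t *\<^sub>R h)) \<bullet> h" for t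
    have sm: "norm (t *\<^sub>R h) \<le> norm h" if "t \<in> {0..1}" for t
      using that by (simp add: mult_left_le_one_le)
    have Fd: "(F has_real_derivative F' t) (at t within {0..1})" if t: "t \<in> {0..1}" for t
    proof -
      have "f differentiable (at (x0 + t *\<^sub>R h))"
        using sm[OF t] h \<rho> by (intro f) (auto simp: dist_norm)
      note D = has_derivative_grad[OF this]
      have "((\<lambda>t. x0 + t *\<^sub>R h) has_derivative (\<lambda>s. s *\<^sub>R h)) (at t)"
        by (auto intro!: derivative_eq_intros)
      from has_derivative_compose[OF this D]
      have "((\<lambda>t. f (x0 + t *\<^sub>R h)) has_real_derivative grad f (x0 + t *\<^sub>R h) \<bullet> h) (at t)"
        by (simp add: has_field_derivative_def mult_commute_abs)
      then have "(F has_real_derivative grad f (x0 + t *\<^sub>R h) \<bullet> h - grad f x0 \<bullet> h - 2 * t * (h \<bullet> (A *v h) / 2)) (at t)"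
        unfolding F_def by (auto intro!: derivative_eq_intros)
      moreover have "A *v (t *\<^sub>R h) = t *\<^sub>R (A *v h)" by (simp add: scalar_mult_eq_scaleR[symmetric] matrix_vector_mult_scaleR vector_scalar_commute)
      ultimately have "(F has_real_derivative F' t) (at t)"
        by (simp add: F'_def inner_diff_left inner_diff_right inner_commute)
      then show ?thesis by (rule has_field_derivative_at_within)
    qed
    have F'b: "norm (F' t) \<le> e * (norm h)\<^sup>2" if t: "t \<in> {0..1}" for t
    proof -
      have "norm (F' t) \<le> norm (grad f (x0 + t *\<^sub>R h) - grad f x0 - A *v (t *\<^sub>R h)) * norm h"
        unfolding F'_def real_norm_def by (rule Cauchy_Schwarz_ineq2)
      also have "\<dots> \<le> (e * norm (t *\<^sub>R h)) * norm h"
        using d(2)[of "x0 + t *\<^sub>R h"] sm[OF t] h \<rho> by (intro mult_right_mono) auto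
      also have "\<dots> \<le> (e * norm h) * norm h"
        using sm[OF t] e by (intro mult_right_mono mult_left_mono) auto
      finally show ?thesis by (simp add: power2_eq_square)
    qed
    have "norm (F 1 - F 0) \<le> e * (norm h)\<^sup>2 * norm (1 - (0::real))"
      by (rule field_differentiable_bound[of "{0..1}" F F']) (use Fd F'b in auto)
    then show ?thesis by (simp add: F_def)
  qed
  with \<rho>(1,2) show thesis by (rule that)
qed

text \<open>The coefficient b shifts the infinity Laplacian at the centre by 2 b |g|^2, while the K
  term, of fourth order, leaves it unchanged. Hence strict touching is governed by b and behaviour
  far away by K.\<close>

definition quartic :: "real \<Rightarrow> real^'n \<Rightarrow> real^'n^'n \<Rightarrow> real \<Rightarrow> real \<Rightarrow> real^'n \<Rightarrow> real^'n \<Rightarrow> real"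
  where "quartic c g A b K x0 x = c + g \<bullet> (x - x0) + (x - x0) \<bullet> (A *v (x - x0)) / 2
    + b * (norm (x - x0))\<^sup>2 + K * (norm (x - x0))^4"

lemma smooth_quartic: "smooth_fun_on UNIV (quartic c g A b K x0)"
proof -
  have "quartic c g A b K x0 = (\<lambda>x. c + (x \<bullet> g - x0 \<bullet> g)
    + (\<Sum>i\<in>UNIV. \<Sum>j\<in>UNIV. (A $ i $ j / 2) * ((x \<bullet> axis i 1 - x0 $ i) * (x \<bullet> axis j 1 - x0 $ j)))
    + b * (norm (x - x0))\<^sup>2 + K * ((norm (x - x0))\<^sup>2 * (norm (x - x0))\<^sup>2))"
  proof
    fix x
    have "h \<bullet> (A *v h) / 2 = (\<Sum>i\<in>UNIV. \<Sum>j\<in>UNIV. (A $ i $ j / 2) * (h $ i * h $ j))" for h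
      by (simp add: inner_vec_def matrix_vector_mult_def sum_divide_distrib sum_distrib_left mult_ac)
    from this[of "x - x0"] show "quartic c g A b K x0 x = c + (x \<bullet> g - x0 \<bullet> g)
      + (\<Sum>i\<in>UNIV. \<Sum>j\<in>UNIV. (A $ i $ j / 2) * ((x \<bullet> axis i 1 - x0 $ i) * (x \<bullet> axis j 1 - x0 $ j)))
      + b * (norm (x - x0))\<^sup>2 + K * ((norm (x - x0))\<^sup>2 * (norm (x - x0))\<^sup>2)"
      by (simp add: quartic_def inner_diff_right inner_commute[of g] inner_axis power2_eq_square power4_eq_xxxx)
  qed
  then show ?thesis
    by (simp only:) (intro smooth_add smooth_sum smooth_mult smooth_diff smooth_const smooth_inner smooth_dist2; simp)
qed

lemma quartic_derivatives:
  fixes x0 g :: "real^'n"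
  defines "h \<equiv> \<lambda>x. x - x0"
  shows "grad (quartic c g A b K x0) x = g + (1 / 2) *\<^sub>R (A *v h x + transpose A *v h x)
      + (2 * b) *\<^sub>R h x + (4 * K * (norm (h x))\<^sup>2) *\<^sub>R h x" (is "_ = ?V x")
    and "inf_laplacian (quartic c g A b K x0) x0 = g \<bullet> (A *v g) + 2 * b * (norm g)\<^sup>2"
proof -
  have lin: "((\<lambda>x. B *v (x - x0)) has_derivative (\<lambda>k. B *v k)) (at x)" for B :: "real^'n^'n" and x
    by (rule bounded_linear.has_derivative[OF matrix_vector_mul_bounded_linear])
      (auto intro!: derivative_eq_intros)
  have V: "grad (quartic c g A b K x0) x = ?V x" for x
  proof (rule grad_eqI)
    have n2: "((\<lambda>x. (norm (x - x0))\<^sup>2) has_derivative (\<lambda>k. 2 * (h x \<bullet> k))) (at x)"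
      unfolding power2_norm_eq_inner h_def
      by (auto intro!: derivative_eq_intros simp: inner_commute)
    have n4: "((\<lambda>x. (norm (x - x0))^4) has_derivative (\<lambda>k. 4 * (norm (h x))\<^sup>2 * (h x \<bullet> k))) (at x)"
      using has_derivative_mult[OF n2 n2]
      by (simp add: h_def power4_eq_xxxx power2_eq_square algebra_simps)
    have q: "((\<lambda>x. (x - x0) \<bullet> (A *v (x - x0))) has_derivative (\<lambda>k. h x \<bullet> (A *v k) + k \<bullet> (A *v h x))) (at x)"
      unfolding h_def by (auto intro!: derivative_eq_intros lin)
    have t: "h x \<bullet> (A *v k) = (transpose A *v h x) \<bullet> k" for k
      by (metis dot_lmul_matrix transpose_matrix_vector)
    have l: "((\<lambda>x. g \<bullet> (x - x0)) has_derivative (\<lambda>k. g \<bullet> k)) (at x)"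
      by (auto intro!: derivative_eq_intros)
    have "((\<lambda>x. c + g \<bullet> (x - x0) + (1 / 2) * ((x - x0) \<bullet> (A *v (x - x0))) + b * (norm (x - x0))\<^sup>2 + K * (norm (x - x0))^4)
      has_derivative (\<lambda>k. 0 + g \<bullet> k + (1 / 2) * (h x \<bullet> (A *v k) + k \<bullet> (A *v h x))
        + b * (2 * (h x \<bullet> k)) + K * (4 * (norm (h x))\<^sup>2 * (h x \<bullet> k)))) (at x)"
      by (intro has_derivative_add has_derivative_const has_derivative_mult_right l q n2 n4)
    then have "(quartic c g A b K x0 has_derivative (\<lambda>k. 0 + g \<bullet> k + (1 / 2) * (h x \<bullet> (A *v k) + k \<bullet> (A *v h x))
        + b * (2 * (h x \<bullet> k)) + K * (4 * (norm (h x))\<^sup>2 * (h x \<bullet> k)))) (at x)"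
      by (simp add: quartic_def[abs_def])
    then show "(quartic c g A b K x0 has_derivative (\<bullet>) (?V x)) (at x)"
      by (rule has_derivative_eq_rhs) (simp add: fun_eq_iff t inner_add_left inner_commute algebra_simps)
  qed
  then show "grad (quartic c g A b K x0) x = ?V x" .
  have pd: "partial_deriv i (quartic c g A b K x0) = (\<lambda>x. ?V x $ i)" for i
    using V by (simp add: fun_eq_iff grad_def vec_eq_iff)
  define D where "D k = (1 / 2) *\<^sub>R (A *v k + transpose A *v k) + (2 * b) *\<^sub>R k" for k
  have "(?V has_derivative D) (at x0)"
  proof -
    have id: "(h has_derivative (\<lambda>k. k)) (at x0)" unfolding h_def by (auto intro!: derivative_eq_intros)
    have "((\<lambda>x. (norm (h x))\<^sup>2) has_derivative (\<lambda>k. 2 * (h x0 \<bullet> k))) (at x0)"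
      unfolding power2_norm_eq_inner h_def
      by (auto intro!: derivative_eq_intros simp: inner_commute)
    from has_derivative_scaleR[OF has_derivative_mult_right[OF this, of "4 * K"] id]
    have s4: "((\<lambda>x. (4 * K * (norm (h x))\<^sup>2) *\<^sub>R h x) has_derivative (\<lambda>k. 0)) (at x0)"
      by (simp add: h_def)
    have lin': "((\<lambda>x. B *v h x) has_derivative (\<lambda>k. B *v k)) (at x0)" for B :: "real^'n^'n"
      unfolding h_def by (rule lin)
    have "(?V has_derivative (\<lambda>k. 0 + (1 / 2) *\<^sub>R (A *v k + transpose A *v k) + (2 * b) *\<^sub>R k + 0)) (at x0)"
      by (intro has_derivative_add has_derivative_const has_derivative_scaleR_right lin' id s4)
    then show ?thesis unfolding D_def by simp
  qed
  then have "((\<lambda>x. ?V x $ i) has_derivative (\<lambda>k. D k $ i)) (at x0)" for i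
    by (rule bounded_linear.has_derivative[OF bounded_linear_vec_nth])
  then have "inf_laplacian (quartic c g A b K x0) x0 = (\<Sum>i\<in>UNIV. ?V x0 $ i * D (?V x0) $ i)"
    using inf_laplacian_eq_derivative[of "quartic c g A b K x0" "\<lambda>i k. D k $ i" x0] pd V by simp
  also have "?V x0 = g" by (simp add: h_def)
  also have "(\<Sum>i\<in>UNIV. g $ i * D g $ i) = g \<bullet> D g" by (simp add: inner_vec_def)
  also have "\<dots> = g \<bullet> (A *v g) + 2 * b * (norm g)\<^sup>2"
  proof -
    have "g \<bullet> (transpose A *v g) = g \<bullet> (A *v g)"
      by (metis dot_lmul_matrix inner_commute transpose_matrix_vector)
    then show ?thesis by (simp add: D_def inner_add_right power2_norm_eq_inner)
  qed
  finally show "inf_laplacian (quartic c g A b K x0) x0 = g \<bullet> (A *v g) + 2 * b * (norm g)\<^sup>2" .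
qed

text \<open>The quadratic Taylor polynomial, tilted by \<open>s \<epsilon> |h|\<^sup>2\<close> so that it still touches strictly, and
  by \<open>s K |h|\<^sup>4\<close> with \<open>K\<close> so large that it stays on the right side of \<open>w\<close> far away.\<close>

lemma global_test_function:
  fixes \<phi> w :: "real^'n \<Rightarrow> real"
  assumes r: "r > 0" "ball x0 r \<subseteq> \<Omega>" and C2: "Ck_on 2 (ball x0 r) \<phi>" and eq: "\<phi> x0 = w x0"
    and s: "s * s = 1" and touch: "\<And>x. x \<in> ball x0 r - {x0} \<Longrightarrow> s * (\<phi> x - w x) > 0"
    and bound: "\<And>x. x \<in> S \<Longrightarrow> \<bar>w x\<bar> \<le> 1" and lap: "s * inf_laplacian \<phi> x0 < 0"
  obtains v C where "smooth_fun_on UNIV v" "v x0 = w x0" "\<And>x. x \<in> S - {x0} \<Longrightarrow> s * (v x - w x) > 0"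
    "compact C" "C \<subseteq> \<Omega>" "\<And>x. x \<notin> C \<Longrightarrow> 1 \<le> s * v x" "s * inf_laplacian v x0 < 0"
proof -
  have Cks: "\<phi> differentiable (at x)" "partial_deriv i \<phi> differentiable (at x)" if "x \<in> ball x0 r" for i x
    using C2 that by (auto simp: numeral_2_eq_2)
  have x0: "x0 \<in> ball x0 r" using r by simp
  define g where "g = grad \<phi> x0"
  define A where "A = (\<chi> i j. partial_deriv j (partial_deriv i \<phi>) x0)"
  have pA: "(partial_deriv i \<phi> has_derivative (\<lambda>k. (A *v k) $ i)) (at x0)" for i
    using has_derivative_partial[OF Cks(2)[OF x0, of i]]
    by (simp add: A_def matrix_vector_mult_def mult.commute)
  have gA: "(grad \<phi> has_derivative (\<lambda>k. A *v k)) (at x0)"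
    unfolding has_derivative_componentwise_within[of "grad \<phi>"] Basis_vec_def
    using pA by (auto simp: inner_axis grad_def)
  have lapA: "inf_laplacian \<phi> x0 = g \<bullet> (A *v g)"
    using inf_laplacian_eq_derivative[OF pA] by (simp add: g_def inner_vec_def)
  \<comment> \<open>The tilt changes the infinity Laplacian by 2 e |g|^2 up to sign; this choice
    keeps the change below the available margin.\<close>
  define e where "e = - (s * (g \<bullet> (A *v g))) / (4 * ((norm g)\<^sup>2 + 1))"
  have g1: "(norm g)\<^sup>2 + 1 > 0" by (simp add: add_nonneg_pos)
  have e: "e > 0" using lap g1 unfolding e_def lapA by (intro divide_pos_pos) auto
  have eg: "2 * e * (norm g)\<^sup>2 < - (s * (g \<bullet> (A *v g)))"
  proof -
    have "2 * e * (norm g)\<^sup>2 < 4 * e * ((norm g)\<^sup>2 + 1)" using e by (simp add: algebra_simps add_pos_nonneg)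
    also have "\<dots> = - (s * (g \<bullet> (A *v g)))" using g1 unfolding e_def by (simp add: field_simps)
    finally show ?thesis .
  qed
  obtain \<rho> where \<rho>: "0 < \<rho>" "\<rho> < r"
    "\<And>h. norm h < \<rho> \<Longrightarrow> \<bar>\<phi> (x0 + h) - \<phi> x0 - grad \<phi> x0 \<bullet> h - h \<bullet> (A *v h) / 2\<bar> \<le> (e / 2) * (norm h)\<^sup>2"
    using taylor_second_order[OF r(1) Cks(1) gA, of "e / 2"] e by auto
  obtain B where B: "\<And>k. norm (A *v k) \<le> norm k * B" "B > 0"
    using bounded_linear.pos_bounded[OF matrix_vector_mul_bounded_linear[of A]] by blast
  define c where "c = w x0"
  \<comment> \<open>At distance n \<ge> \<rho> each summand times n^4 dominates one lower order
    term: the constant |c| + 2, the linear term and the quadratic term. The surplus 2 remains as a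
    lower bound of s v.\<close>
  define K where "K = (\<bar>c\<bar> + 2) / \<rho>^4 + norm g / \<rho>^3 + B / \<rho>\<^sup>2"
  define v where "v = quartic c g A (s * e) (s * K) x0"
  have K: "K > 0"
  proof -
    have "(\<bar>c\<bar> + 2) / \<rho>^4 > 0" using \<rho>(1) by (intro divide_pos_pos) auto
    moreover have "norm g / \<rho>^3 \<ge> 0" "B / \<rho>\<^sup>2 \<ge> 0" using \<rho>(1) B(2) by auto
    ultimately show ?thesis unfolding K_def by linarith
  qed
  have abs_s: "\<bar>s\<bar> = 1" using s by (auto simp: square_eq_1_iff)
  have sv: "s * v x = s * (c + g \<bullet> (x - x0) + (x - x0) \<bullet> (A *v (x - x0)) / 2) + e * (norm (x - x0))\<^sup>2 + K * (norm (x - x0))^4" for x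
  proof -
    have ss: "s * (s * y) = y" for y using s by (simp flip: mult.assoc)
    show ?thesis by (simp add: v_def quartic_def distrib_left mult.assoc ss)
  qed
  have far: "s * v x \<ge> 2" if x: "norm (x - x0) \<ge> \<rho>" for x
  proof -
    let ?n = "norm (x - x0)"
    have "\<bar>c + g \<bullet> (x - x0) + (x - x0) \<bullet> (A *v (x - x0)) / 2\<bar> \<le> \<bar>c\<bar> + norm g * ?n + B * ?n\<^sup>2"
    proof -
      have "\<bar>g \<bullet> (x - x0)\<bar> \<le> norm g * ?n" by (rule Cauchy_Schwarz_ineq2)
      moreover have "\<bar>(x - x0) \<bullet> (A *v (x - x0))\<bar> \<le> ?n * (?n * B)"
        using Cauchy_Schwarz_ineq2[of "x - x0" "A *v (x - x0)"] mult_left_mono[OF B(1)[of "x - x0"], of ?n] by simp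
      moreover have "0 \<le> ?n * (?n * B)" using B by simp
      ultimately show ?thesis by (simp add: power2_eq_square mult_ac)
    qed
    then have "s * (c + g \<bullet> (x - x0) + (x - x0) \<bullet> (A *v (x - x0)) / 2) \<ge> - (\<bar>c\<bar> + norm g * ?n + B * ?n\<^sup>2)"
    proof -
      assume T: "\<bar>c + g \<bullet> (x - x0) + (x - x0) \<bullet> (A *v (x - x0)) / 2\<bar> \<le> \<bar>c\<bar> + norm g * ?n + B * ?n\<^sup>2"
      have "\<bar>s * (c + g \<bullet> (x - x0) + (x - x0) \<bullet> (A *v (x - x0)) / 2)\<bar> \<le> \<bar>c\<bar> + norm g * ?n + B * ?n\<^sup>2"
        using T unfolding abs_mult abs_s by simp
      then show ?thesis by linarith
    qed
    moreover have "\<bar>c\<bar> + 2 + norm g * ?n + B * ?n\<^sup>2 \<le> K * ?n^4"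
    proof -
      have "\<bar>c\<bar> + 2 \<le> (\<bar>c\<bar> + 2) / \<rho>^4 * ?n^4"
      proof -
        have "\<rho>^4 \<le> ?n^4" using x \<rho> by (intro power_mono) auto
        then show ?thesis using \<rho> by (simp add: le_divide_eq mult_left_mono)
      qed
      moreover have "norm g * ?n \<le> norm g / \<rho>^3 * ?n^4"
      proof -
        have "\<rho>^3 * ?n \<le> ?n^3 * ?n" using x \<rho> by (intro mult_right_mono power_mono) auto
        then have "\<rho>^3 * ?n \<le> ?n^4" by (simp add: eval_nat_numeral)
        then have "norm g * (\<rho>^3 * ?n) \<le> norm g * ?n^4" by (intro mult_left_mono) auto
        then show ?thesis using \<rho> by (simp add: le_divide_eq mult_ac)
      qed
      moreover have "B * ?n\<^sup>2 \<le> B / \<rho>\<^sup>2 * ?n^4"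
      proof -
        have "\<rho>\<^sup>2 * ?n\<^sup>2 \<le> ?n\<^sup>2 * ?n\<^sup>2" using x \<rho> by (intro mult_right_mono power_mono) auto
        then have "\<rho>\<^sup>2 * ?n\<^sup>2 \<le> ?n^4" by (simp add: eval_nat_numeral)
        then have "B * (\<rho>\<^sup>2 * ?n\<^sup>2) \<le> B * ?n^4" using B by (intro mult_left_mono) auto
        then show ?thesis using \<rho> by (simp add: le_divide_eq mult_ac)
      qed
      ultimately show ?thesis by (simp add: K_def distrib_right)
    qed
    moreover have "e * ?n\<^sup>2 \<ge> 0" using e by simp
    ultimately show ?thesis unfolding sv by linarith
  qed
  show thesis
  proof (rule that[of v "cball x0 \<rho>"])
    show "smooth_fun_on UNIV v" unfolding v_def by (rule smooth_quartic)
    show "v x0 = w x0" by (simp add: v_def quartic_def c_def)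
    show "compact (cball x0 \<rho>)" by simp
    show "cball x0 \<rho> \<subseteq> \<Omega>" using r \<rho> by (auto simp: subset_iff)
    show "1 \<le> s * v x" if "x \<notin> cball x0 \<rho>" for x
      using far[of x] that by (simp add: dist_norm norm_minus_commute)
    show "s * (v x - w x) > 0" if x: "x \<in> S - {x0}" for x
    proof (cases "norm (x - x0) < \<rho>")
      case False
      have "\<bar>s * w x\<bar> \<le> 1" using bound[of x] x by (simp add: abs_mult abs_s)
      then show ?thesis using far[of x] False by (simp add: right_diff_distrib)
    next
      case True
      let ?T = "c + g \<bullet> (x - x0) + (x - x0) \<bullet> (A *v (x - x0)) / 2" and ?n = "norm (x - x0)"
      have n: "?n > 0" using x by simp
      have "x \<in> ball x0 r - {x0}" using True \<rho> x by (simp add: dist_norm norm_minus_commute)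
      then have 1: "s * (\<phi> x - w x) > 0" by (rule touch)
      \<comment> \<open>The Taylor remainder uses up half of the tilt; the other half keeps the
        touching strict.\<close>
      have "\<bar>\<phi> x - ?T\<bar> \<le> (e / 2) * ?n\<^sup>2"
        using \<rho>(3)[OF True] by (simp add: c_def eq g_def algebra_simps)
      then have "\<bar>s * (\<phi> x - ?T)\<bar> \<le> (e / 2) * ?n\<^sup>2" by (simp add: abs_mult abs_s)
      then have 2: "s * ?T \<ge> s * \<phi> x - (e / 2) * ?n\<^sup>2" unfolding right_diff_distrib by linarith
      have 3: "e / 2 * ?n\<^sup>2 > 0" "K * ?n^4 > 0" using e K n by simp_all
      have "s * (v x - w x) = s * ?T + e * ?n\<^sup>2 + K * ?n^4 - s * w x" by (simp add: right_diff_distrib sv)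
      moreover have "e * ?n\<^sup>2 = e / 2 * ?n\<^sup>2 + e / 2 * ?n\<^sup>2" by simp
      ultimately show ?thesis using 1 2 3 unfolding right_diff_distrib by linarith
    qed
    have "s * inf_laplacian v x0 = s * (g \<bullet> (A *v g)) + s * s * (2 * e * (norm g)\<^sup>2)"
      unfolding v_def quartic_derivatives(2) by (simp add: algebra_simps)
    then show "s * inf_laplacian v x0 < 0" using eg s by simp
  qed
qed

section \<open>The limit function\<close>

lemma powr_tendsto_0:
  fixes x :: real
  assumes "0 < x" "x < 1"
  shows "((\<lambda>t. x powr t) \<longlongrightarrow> 0) at_top"
proof -
  have "filterlim (\<lambda>t. ln x * t) at_bot at_top"
    using assms by (intro filterlim_tendsto_neg_mult_at_bot[OF tendsto_const] filterlim_ident) auto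
  from filterlim_compose[OF exp_at_bot this] show ?thesis
    using assms by (simp add: powr_def mult.commute)
qed

lemma mult_powr_tendsto_0:
  fixes x :: real
  assumes x: "0 < x" "x < 1"
  shows "((\<lambda>t. t * x powr t) \<longlongrightarrow> 0) at_top"
proof -
  define b where "b = - ln x / 2"
  have b: "b > 0" using x by (simp add: b_def)
  have "((\<lambda>t. 1 / b * sqrt x powr t) \<longlongrightarrow> 1 / b * 0) at_top"
    using x by (intro tendsto_intros powr_tendsto_0) auto
  then have lim: "((\<lambda>t. 1 / b * sqrt x powr t) \<longlongrightarrow> 0) at_top" by simp
  show ?thesis
  proof (rule Lim_null_comparison[OF _ lim])
    show "\<forall>\<^sub>F t in at_top. norm (t * x powr t) \<le> 1 / b * sqrt x powr t"
      using eventually_ge_at_top[of 0]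
    proof eventually_elim
      case (elim t)
      have s: "x powr t = exp (- (b * t)) * sqrt x powr t"
      proof -
        have "sqrt x = exp (- b)" using x by (simp add: b_def ln_sqrt[symmetric])
        then have "sqrt x powr t = exp (- (b * t))" by (simp add: powr_def)
        moreover have "x powr t = exp (- (b * t) + - (b * t))" using x by (simp add: powr_def b_def)
        ultimately show ?thesis by (simp only: exp_add)
      qed
      have "b * t \<le> exp (b * t)" using exp_ge_add_one_self[of "b * t"] by linarith
      then have "b * t * exp (- (b * t)) \<le> exp (b * t) * exp (- (b * t))"
        by (rule mult_right_mono) simp
      then have "b * t * exp (- (b * t)) \<le> 1" by (simp flip: exp_add)
      then have "t * exp (- (b * t)) \<le> 1 / b" using b by (simp add: field_simps)
      then have "t * exp (- (b * t)) * sqrt x powr t \<le> 1 / b * sqrt x powr t"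
        by (rule mult_right_mono) simp
      then show ?case using elim by (simp add: s abs_mult mult.assoc)
    qed
  qed
qed

text \<open>The decay is split as x^q = (sqrt x)^q (sqrt x)^q. One factor absorbs A^p, because q
  \<ge> K p eventually for any K; the other still beats the factor q.\<close>

lemma powr_mult_powr_tendsto_0:
  fixes p q :: "nat \<Rightarrow> real"
  assumes p: "filterlim p at_top sequentially" and r: "filterlim (\<lambda>n. q n / p n) at_top sequentially"
    and A: "A > 0" and x: "0 < x" "x < 1"
  shows "(\<lambda>n. A powr p n * (q n * x powr q n)) \<longlonglongrightarrow> 0"
proof -
  have sx: "0 < sqrt x" "sqrt x < 1" using x by auto
  have "\<forall>\<^sub>F K in at_top. sqrt x powr K < 1 / A"
    using A order_tendstoD(2)[OF powr_tendsto_0[OF sx], of "1 / A"] by simp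
  then obtain K where K: "sqrt x powr K < 1 / A" "K > 0"
    using eventually_happens[OF eventually_conj[OF _ eventually_gt_at_top[of 0]]] trivial_limit_at_top_linorder by metis
  have q: "filterlim q at_top sequentially"
  proof (rule filterlim_at_top_mono[OF p])
    show "\<forall>\<^sub>F n in sequentially. p n \<le> q n"
      using r[unfolded filterlim_at_top, rule_format, of 1] p[unfolded filterlim_at_top_dense, rule_format, of 0]
      by eventually_elim (simp add: field_simps)
  qed
  have lim: "(\<lambda>n. q n * sqrt x powr q n) \<longlonglongrightarrow> 0"
    by (rule filterlim_compose[OF mult_powr_tendsto_0[OF sx] q])
  show ?thesis
  proof (rule Lim_null_comparison[OF _ lim])
    show "\<forall>\<^sub>F n in sequentially. norm (A powr p n * (q n * x powr q n)) \<le> q n * sqrt x powr q n"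
      using r[unfolded filterlim_at_top, rule_format, of K] p[unfolded filterlim_at_top_dense, rule_format, of 0]
        q[unfolded filterlim_at_top_dense, rule_format, of 0]
    proof eventually_elim
      case (elim n)
      have "K * p n \<le> q n" using elim by (simp add: field_simps)
      then have "sqrt x powr q n \<le> sqrt x powr (K * p n)" using sx by (intro powr_mono') auto
      also have "\<dots> = (sqrt x powr K) powr p n" by (simp add: powr_powr)
      also have "\<dots> \<le> (1 / A) powr p n" using K A elim by (intro powr_mono2) auto
      finally have "A powr p n * sqrt x powr q n \<le> 1" using A by (simp add: powr_divide field_simps)
      moreover have "x powr q n = sqrt x powr q n * sqrt x powr q n"
        using x by (simp flip: powr_mult)
      moreover have "0 \<le> q n * sqrt x powr q n" using elim by simp
      ultimately show ?case
        using mult_right_mono[of "A powr p n * sqrt x powr q n" 1 "q n * sqrt x powr q n"] elim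
        by (simp add: mult_ac abs_mult)
    qed
  qed
qed

locale infinity_limit =
  fixes \<Omega> :: "(real^'n) set" and p q :: "nat \<Rightarrow> real"
    and u :: "nat \<Rightarrow> real^'n \<Rightarrow> real" and w :: "real^'n \<Rightarrow> real"
  assumes bounded: "bounded \<Omega>" and open_\<Omega>: "open \<Omega>"
    and extremal: "sobolev_extremal \<Omega> (p n) (q n) (u n)"
    and p_lim: "filterlim p at_top sequentially"
    and ratio: "filterlim (\<lambda>n. q n / p n) at_top sequentially"
    and unif: "uniform_limit (closure \<Omega>) u w sequentially"
    and w_C0: "w \<in> C0_closure \<Omega>"
begin

lemma sets_\<Omega>: "\<Omega> \<in> sets lebesgue"
  using open_\<Omega> by (simp add: borel_open)

sublocale finite_measure "lebesgue_on \<Omega>"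
  using bounded open_\<Omega> by (intro finite_measure_lebesgue_on) (simp add: lmeasurable_open)

lemma eventually_p_gt: "\<forall>\<^sub>F n in sequentially. p n > c"
  using p_lim by (simp add: filterlim_at_top_dense)

lemma eventually_q_ge_p: "\<forall>\<^sub>F n in sequentially. q n \<ge> p n"
  using ratio[unfolded filterlim_at_top, rule_format, of 1] eventually_p_gt[of 0]
  by eventually_elim (simp add: field_simps)

lemma q_lim: "filterlim q at_top sequentially"
  by (rule filterlim_at_top_mono[OF p_lim eventually_q_ge_p])

lemma uniformly_close:
  "e > 0 \<Longrightarrow> \<forall>\<^sub>F n in sequentially. \<forall>x\<in>closure \<Omega>. \<bar>u n x - w x\<bar> < e"
  using unif by (simp add: uniform_limit_iff dist_real_def)

lemma u_continuous: "continuous_on (closure \<Omega>) (u n)"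
  and u_pos: "x \<in> \<Omega> \<Longrightarrow> u n x > 0"
  using extremal[of n] by (auto simp: sobolev_extremal_def)

lemma lambda_nonneg: "sobolev_lambda \<Omega> (p n) (q n) \<ge> 0"
  using extremal[of n] unfolding sobolev_extremal_def by (metis powr_ge_zero)

lemma u_integral:
  assumes "q n > 0"
  shows "(LINT x|lebesgue_on \<Omega>. norm (u n x) powr q n) = 1"
proof -
  have "Lp_norm (q n) \<Omega> (u n) = 1" using extremal[of n] by (auto simp: sobolev_extremal_def)
  then show ?thesis using Lp_norm_powr[OF assms, of \<Omega> "u n"] by simp
qed

lemma w_continuous: "continuous_on (closure \<Omega>) w"
  and w_frontier: "x \<in> frontier \<Omega> \<Longrightarrow> w x = 0"
  using w_C0 by (auto simp: C0_closure_def)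

lemma pointwise: "x \<in> closure \<Omega> \<Longrightarrow> (\<lambda>n. u n x) \<longlonglongrightarrow> w x"
  using unif by (rule tendsto_uniform_limitI)

lemma w_nonneg: "x \<in> closure \<Omega> \<Longrightarrow> 0 \<le> w x"
proof (cases "x \<in> \<Omega>")
  case True
  then have "x \<in> closure \<Omega>" using closure_subset by auto
  from tendsto_lowerbound[OF pointwise[OF this], of 0] show ?thesis
    using u_pos[OF True] by (simp add: less_imp_le)
next
  case False
  moreover assume "x \<in> closure \<Omega>"
  ultimately have "x \<in> frontier \<Omega>" using open_\<Omega> by (simp add: frontier_def interior_open)
  then show ?thesis by (simp add: w_frontier)
qed

text \<open>Otherwise the extremals eventually exceed some c1 > 1 on a fixed ball, and their L^q
  integrals would grow at least like c1^q instead of being 1. Two numbers c1 < c leave room for the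
  uniform error.\<close>

lemma w_le_1:
  assumes x: "x \<in> closure \<Omega>"
  shows "w x \<le> 1"
proof (rule ccontr)
  assume "\<not> w x \<le> 1"
  then have wx: "w x > 1" by simp
  then have "x \<notin> frontier \<Omega>" using w_frontier[of x] by auto
  then have x\<Omega>: "x \<in> \<Omega>" using x open_\<Omega> by (simp add: frontier_def interior_open)
  define c where "c = (1 + w x) / 2"
  have c: "1 < c" "c < w x" using wx by (auto simp: c_def)
  have cw: "continuous_on \<Omega> w" using w_continuous closure_subset continuous_on_subset by blast
  obtain r where r: "r > 0" "ball x r \<subseteq> \<Omega>" "\<And>y. y \<in> ball x r \<Longrightarrow> w y > c"
  proof -
    have "open (\<Omega> \<inter> w -` {c<..})" using cw open_\<Omega> by (intro continuous_open_preimage) auto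
    moreover have "x \<in> \<Omega> \<inter> w -` {c<..}" using x\<Omega> c by simp
    ultimately obtain r where "r > 0" "ball x r \<subseteq> \<Omega> \<inter> w -` {c<..}" using openE by blast
    then show thesis by (intro that[of r]) blast+
  qed
  define c1 where "c1 = (1 + c) / 2"
  have c1: "c1 > 1" "c - c1 > 0" using c by (auto simp: c1_def)
  define m where "m = measure lebesgue (ball x r)"
  have m: "m > 0" unfolding m_def by (rule measure_ball_pos[OF r(1)])
  have "((\<lambda>t. (1 / c1) powr t) \<longlongrightarrow> 0) at_top" using c1 by (intro powr_tendsto_0) auto
  then have "(\<lambda>n. (1 / c1) powr q n) \<longlonglongrightarrow> 0" by (rule filterlim_compose[OF _ q_lim])
  then have "\<forall>\<^sub>F n in sequentially. (1 / c1) powr q n < m" using m by (rule order_tendstoD(2))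
  then have "\<forall>\<^sub>F n in sequentially. False"
    using uniformly_close[OF c1(2)] eventually_q_ge_p eventually_p_gt[of 0]
  proof eventually_elim
    case (elim n)
    have q: "q n > 0" using elim by simp
    have "c1 powr q n * m \<le> (LINT y|lebesgue_on \<Omega>. norm (u n y) powr q n)"
      unfolding m_def
    proof (rule integral_ge_on_ball[OF bounded sets_\<Omega> _ _ r(2)])
      show "continuous_on (closure \<Omega>) (\<lambda>y. norm (u n y) powr q n)"
        by (intro continuous_on_norm_powr u_continuous q)
      show "c1 powr q n \<le> norm (u n y) powr q n" if y: "y \<in> ball x r" for y
      proof -
        have "y \<in> closure \<Omega>" using y r closure_subset by blast
        then have "c1 \<le> norm (u n y)" using elim(2) r(3)[OF y] by fastforce
        then show ?thesis using c1 q by (intro powr_mono2) auto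
      qed
    qed simp
    also have "\<dots> = 1" by (rule u_integral[OF q])
    finally have "c1 powr q n * m \<le> 1" .
    then have "m \<le> (1 / c1) powr q n" using c1 by (simp add: powr_divide field_simps)
    with elim show False by simp
  qed
  then show False by simp
qed

text \<open>Extension by zero, so that averages make sense over boxes that reach or leave the
  boundary.\<close>

definition w0 :: "real^'n \<Rightarrow> real"
  where "w0 x = (if x \<in> \<Omega> then w x else 0)"

lemma w0_eq: "x \<in> closure \<Omega> \<Longrightarrow> w0 x = w x"
  using w_frontier[of x] open_\<Omega> by (auto simp: w0_def frontier_def interior_open)

lemma w0_continuous: "continuous_on UNIV w0"
proof -
  have "continuous_on (closure \<Omega> \<union> - \<Omega>) w0"
    unfolding w0_def
  proof (rule continuous_on_cases)
    show "\<forall>x. x \<in> closure \<Omega> \<and> x \<notin> \<Omega> \<or> x \<in> - \<Omega> \<and> x \<in> \<Omega> \<longrightarrow> w x = 0"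
      using w_frontier open_\<Omega> by (auto simp: frontier_def interior_open)
  qed (use open_\<Omega> w_continuous in \<open>auto simp: closed_def\<close>)
  moreover have "closure \<Omega> \<union> - \<Omega> = UNIV" using closure_subset by auto
  ultimately show ?thesis by simp
qed

lemma w0_box_average:
  assumes B: "ball z R \<subseteq> \<Omega>" and R: "R > 0" and \<alpha>: "\<alpha> > 1 / R"
  shows "\<bar>integral (cbox (b - d) (b + d)) w0 - integral (cbox (a - d) (a + d)) w0\<bar>
    \<le> norm (b - a) * (\<alpha> * measure lborel (cbox (- d) d))"
proof -
  let ?\<mu> = "lebesgue_on \<Omega>"
  have "1 / R > 0" using R by simp
  then have \<alpha>0: "\<alpha> > 0" using \<alpha> by linarith
  \<comment> \<open>A slope strictly between 1/R and \<alpha> makes the energy term decay like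
    (L/\<alpha>)^p.\<close>
  obtain L where L: "L > 1 / R" "L < \<alpha>" using dense[OF \<alpha>] by blast
  have L0: "L > 0" using less_trans[OF \<open>1 / R > 0\<close> L(1)] .
  obtain C where C: "C > 0" "\<And>p q. p > 1 \<Longrightarrow> q \<ge> p \<Longrightarrow> sobolev_lambda \<Omega> p q \<le> C * L powr p"
    using sobolev_lambda_upper_bound[OF bounded open_\<Omega> B R L(1)] by blast
  define I where "I f e = (LINT x|?\<mu>. indicator (cbox (e - d) (e + d)) x * f x)" for f :: "real^'n \<Rightarrow> real" and e
  have I_w0: "I w e = integral (cbox (e - d) (e + d)) w0" for e
  proof -
    have "I w e = I w0 e" unfolding I_def by (intro Bochner_Integration.integral_cong) (auto simp: w0_def)
    also have "\<dots> = integral (cbox (e - d) (e + d)) w0"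
      unfolding I_def by (intro integral_lebesgue_on_indicator_cbox sets_\<Omega> w0_continuous) (auto simp: w0_def)
    finally show ?thesis .
  qed
  note ind = integrable_lebesgue_on_indicator_cbox[OF bounded sets_\<Omega>]
  have I_lim: "(\<lambda>n. I (u n) e) \<longlonglongrightarrow> I w e" for e
  proof (rule tendstoI)
    fix t :: real assume t: "t > 0"
    define t' where "t' = t / (measure ?\<mu> (space ?\<mu>) + 1)"
    have m1: "measure ?\<mu> (space ?\<mu>) + 1 > 0" by (simp add: add_nonneg_pos)
    have t': "t' > 0" using t m1 by (simp add: t'_def)
    have "t' * measure ?\<mu> (space ?\<mu>) < t' * (measure ?\<mu> (space ?\<mu>) + 1)" using t' by simp
    also have "\<dots> = t" using m1 by (simp add: t'_def)
    finally have less: "t' * measure ?\<mu> (space ?\<mu>) < t" .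
    show "\<forall>\<^sub>F n in sequentially. dist (I (u n) e) (I w e) < t"
      using uniformly_close[OF t']
    proof eventually_elim
      case (elim n)
      have "norm (I (u n) e - I w e) = norm (LINT x|?\<mu>. indicator (cbox (e - d) (e + d)) x * u n x - indicator (cbox (e - d) (e + d)) x * w x)"
        unfolding I_def using ind[OF u_continuous] ind[OF w_continuous] by simp
      also have "\<dots> \<le> (LINT x|?\<mu>. norm (indicator (cbox (e - d) (e + d)) x * u n x - indicator (cbox (e - d) (e + d)) x * w x))"
        by (rule integral_norm_bound)
      also have "\<dots> \<le> (LINT x|?\<mu>. t')"
      proof (rule integral_mono')
        fix x assume "x \<in> space ?\<mu>"
        then have "x \<in> closure \<Omega>" using closure_subset by auto
        with elim have "\<bar>u n x - w x\<bar> < t'" by blast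
        then show "norm (indicator (cbox (e - d) (e + d)) x * u n x - indicator (cbox (e - d) (e + d)) x * w x) \<le> t'"
          using t' by (auto simp: indicator_def)
      qed (use t' in auto)
      also have "\<dots> = t' * measure ?\<mu> (space ?\<mu>)" by (simp add: mult.commute)
      finally show ?case using less by (simp add: dist_norm)
    qed
  qed
  have lim0: "(\<lambda>n. \<alpha> * C * (L / \<alpha>) powr p n) \<longlonglongrightarrow> \<alpha> * C * 0"
    using L L0 \<alpha>0 by (intro tendsto_intros filterlim_compose[OF powr_tendsto_0 p_lim]) auto
  have "(\<lambda>n. norm (b - a) * (\<alpha> * measure lborel (cbox (- d) d) + \<alpha> * C * (L / \<alpha>) powr p n)) \<longlonglongrightarrow>
      norm (b - a) * (\<alpha> * measure lborel (cbox (- d) d) + \<alpha> * C * 0)"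
    by (intro tendsto_intros lim0)
  moreover have "(\<lambda>n. \<bar>I (u n) b - I (u n) a\<bar>) \<longlonglongrightarrow> \<bar>I w b - I w a\<bar>"
    by (intro tendsto_intros I_lim)
  moreover have "\<forall>\<^sub>F n in sequentially. \<bar>I (u n) b - I (u n) a\<bar>
      \<le> norm (b - a) * (\<alpha> * measure lborel (cbox (- d) d) + \<alpha> * C * (L / \<alpha>) powr p n)"
    using eventually_p_gt[of 1] eventually_q_ge_p
  proof eventually_elim
    case (elim n)
    have "\<bar>I (u n) b - I (u n) a\<bar> \<le> norm (b - a) * (\<alpha> * measure lborel (cbox (- d) d) + \<alpha> powr (1 - p n) * sobolev_lambda \<Omega> (p n) (q n))"
      unfolding I_def by (rule sobolev_extremal_box_average[OF bounded open_\<Omega> extremal elim(1) \<alpha>0])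
    also have "\<dots> \<le> norm (b - a) * (\<alpha> * measure lborel (cbox (- d) d) + \<alpha> powr (1 - p n) * (C * L powr p n))"
      using C(2)[OF elim] by (intro mult_left_mono add_left_mono) auto
    also have "\<alpha> powr (1 - p n) * (C * L powr p n) = \<alpha> * C * (L / \<alpha>) powr p n"
      using \<alpha>0 L0 by (simp add: powr_diff powr_divide)
    finally show ?case .
  qed
  ultimately have "\<bar>I w b - I w a\<bar> \<le> norm (b - a) * (\<alpha> * measure lborel (cbox (- d) d) + \<alpha> * C * 0)"
    by (intro tendsto_le[OF trivial_limit_sequentially]) auto
  then show ?thesis unfolding I_w0 by simp
qed

text \<open>Shrinking the box turns the bound for averages into one for point values. Every slope
  above 1/R is admissible, hence 1/R itself.\<close>

lemma w_lipschitz: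
  assumes B: "ball z R \<subseteq> \<Omega>" and R: "R > 0" and x: "x \<in> closure \<Omega>" and y: "y \<in> closure \<Omega>"
  shows "\<bar>w x - w y\<bar> \<le> norm (x - y) / R"
proof -
  have "\<bar>w0 x - w0 y\<bar> \<le> norm (x - y) / R"
  proof (rule field_le_epsilon)
    fix e :: real assume e: "e > 0"
    \<comment> \<open>One third for each of the two box averages and one for the excess of \<alpha>
      over 1/R, which is divided by |x - y| + 1 for this purpose.\<close>
    define t where "t = e / 3"
    have t: "t > 0" using e by (simp add: t_def)
    define \<alpha> where "\<alpha> = 1 / R + t / (norm (x - y) + 1)"
    have n1: "norm (x - y) + 1 > 0" by (simp add: add_nonneg_pos)
    have \<alpha>: "\<alpha> > 1 / R" using t n1 by (simp add: \<alpha>_def)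
    have "norm (x - y) * (t / (norm (x - y) + 1)) \<le> t"
      using t n1 by (simp add: field_simps)
    then have \<alpha>': "norm (x - y) * \<alpha> \<le> norm (x - y) / R + t" by (simp add: \<alpha>_def distrib_left)
    have avg: "\<exists>\<delta>>0. \<forall>c. 0 < c \<and> c < \<delta> \<longrightarrow>
        \<bar>integral (cbox (a - c *\<^sub>R One) (a + c *\<^sub>R One)) w0 - w0 a * measure lborel (cbox (- (c *\<^sub>R One)) (c *\<^sub>R One :: real^'n))\<bar>
        \<le> t * measure lborel (cbox (- (c *\<^sub>R One)) (c *\<^sub>R One :: real^'n))" for a
    proof -
      have "isCont w0 a" using w0_continuous by (simp add: continuous_on_eq_continuous_at)
      then obtain d where d: "d > 0" "\<And>y. dist y a < d \<Longrightarrow> dist (w0 y) (w0 a) < t"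
        using t unfolding continuous_at_eps_delta by blast
      define N where "N = norm (One :: real^'n)"
      have N: "N \<ge> 0" by (simp add: N_def)
      show ?thesis
      proof (intro exI[of _ "d / (N + 1)"] conjI allI impI)
        show "d / (N + 1) > 0" using d N by simp
        fix c :: real assume c: "0 < c \<and> c < d / (N + 1)"
        let ?Q = "cbox (a - c *\<^sub>R One) (a + c *\<^sub>R One)"
        have Q: "measure lborel ?Q = measure lborel (cbox (- (c *\<^sub>R One)) (c *\<^sub>R One :: real^'n))"
          using c by (simp add: content_cbox_cases inner_add_left inner_diff_left)
        have near: "\<bar>w0 y - w0 a\<bar> \<le> t" if y: "y \<in> ?Q" for y
        proof -
          have "norm (y - a) \<le> norm (c *\<^sub>R One :: real^'n)"
          proof (rule norm_le_componentwise)
            fix i :: "real^'n" assume "i \<in> Basis"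
            then show "\<bar>(y - a) \<bullet> i\<bar> \<le> \<bar>(c *\<^sub>R One) \<bullet> i\<bar>"
              using y c by (auto simp: mem_box inner_diff_left inner_add_left abs_le_iff dest!: bspec)
          qed
          also have "\<dots> = c * N" using c by (simp add: N_def)
          also have "\<dots> < d"
          proof -
            have "c * N \<le> c * (N + 1)" using c by simp
            also have "\<dots> < d" using c N by (simp add: field_simps)
            finally show ?thesis .
          qed
          finally show ?thesis using d(2)[of y] by (simp add: dist_norm)
        qed
        have int: "w0 integrable_on ?Q" by (intro integrable_continuous continuous_on_subset[OF w0_continuous]) auto
        have "integral ?Q (\<lambda>y. w0 y - w0 a) = integral ?Q w0 - w0 a * measure lborel ?Q"
          using int by (subst Henstock_Kurzweil_Integration.integral_diff) (auto simp: mult.commute)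
        moreover have "norm (integral ?Q (\<lambda>y. w0 y - w0 a)) \<le> integral ?Q (\<lambda>y. t)"
          using near int by (intro integral_norm_bound_integral integrable_diff) auto
        ultimately show "\<bar>integral ?Q w0 - w0 a * measure lborel (cbox (- (c *\<^sub>R One)) (c *\<^sub>R One :: real^'n))\<bar>
          \<le> t * measure lborel (cbox (- (c *\<^sub>R One)) (c *\<^sub>R One :: real^'n))"
          by (simp add: Q mult.commute)
      qed
    qed
    obtain \<delta> where \<delta>: "\<delta> > 0" "\<And>c. 0 < c \<Longrightarrow> c < \<delta> \<Longrightarrow>
        \<bar>integral (cbox (x - c *\<^sub>R One) (x + c *\<^sub>R One)) w0 - w0 x * measure lborel (cbox (- (c *\<^sub>R One)) (c *\<^sub>R One :: real^'n))\<bar>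
        \<le> t * measure lborel (cbox (- (c *\<^sub>R One)) (c *\<^sub>R One :: real^'n))" using avg[of x] by blast
    obtain \<delta>' where \<delta>': "\<delta>' > 0" "\<And>c. 0 < c \<Longrightarrow> c < \<delta>' \<Longrightarrow>
        \<bar>integral (cbox (y - c *\<^sub>R One) (y + c *\<^sub>R One)) w0 - w0 y * measure lborel (cbox (- (c *\<^sub>R One)) (c *\<^sub>R One :: real^'n))\<bar>
        \<le> t * measure lborel (cbox (- (c *\<^sub>R One)) (c *\<^sub>R One :: real^'n))" using avg[of y] by blast
    define c where "c = min \<delta> \<delta>' / 2"
    have c: "0 < c" "c < \<delta>" "c < \<delta>'" using \<delta>(1) \<delta>'(1) by (auto simp: c_def min_def)
    define d where "d = c *\<^sub>R (One :: real^'n)"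
    define m where "m = measure lborel (cbox (- d) d)"
    have m: "m > 0"
      unfolding m_def content_pos_lt_eq using c by (simp add: d_def)
    have 1: "\<bar>integral (cbox (x - d) (x + d)) w0 - w0 x * m\<bar> \<le> t * m"
      "\<bar>integral (cbox (y - d) (y + d)) w0 - w0 y * m\<bar> \<le> t * m"
      using \<delta>(2)[of c] \<delta>'(2)[of c] c by (simp_all add: d_def m_def)
    have 2: "\<bar>integral (cbox (x - d) (x + d)) w0 - integral (cbox (y - d) (y + d)) w0\<bar> \<le> norm (x - y) * (\<alpha> * m)"
      unfolding m_def by (rule w0_box_average[OF B R \<alpha>])
    have "\<bar>w0 x * m - w0 y * m\<bar> \<le> t * m + norm (x - y) * (\<alpha> * m) + t * m" using 1 2 by linarith
    also have "\<dots> = (norm (x - y) * \<alpha> + 2 * t) * m" by (simp add: algebra_simps)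
    also have "\<bar>w0 x * m - w0 y * m\<bar> = \<bar>w0 x - w0 y\<bar> * m"
      using m by (simp add: abs_mult flip: left_diff_distrib)
    finally have "\<bar>w0 x - w0 y\<bar> \<le> norm (x - y) * \<alpha> + 2 * t" using m by simp
    also have "\<dots> \<le> norm (x - y) / R + 3 * t" using \<alpha>' by simp
    finally show "\<bar>w0 x - w0 y\<bar> \<le> norm (x - y) / R + e" by (simp add: t_def)
  qed
  then show ?thesis using x y by (simp add: w0_eq)
qed

section \<open>Viscosity inequalities for the limit\<close>

text \<open>With s = 1 the extremals are pushed down below a v touching from above, with s = -1 they
  are pushed up. The integral H of the perturbation may be tiny; only H > 0 matters, since the final
  inequality is linear in H.\<close>

lemma no_strict_touching:
  fixes v :: "real^'n \<Rightarrow> real"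
  assumes s: "s * s = 1" and v: "smooth_fun_on UNIV v" and x0: "x0 \<in> \<Omega>" and eq: "v x0 = w x0"
    and strict: "\<And>x. x \<in> closure \<Omega> - {x0} \<Longrightarrow> s * (v x - w x) > 0"
    and C: "compact C" "C \<subseteq> \<Omega>" "\<And>x. x \<notin> C \<Longrightarrow> 1 \<le> s * v x"
    and lap: "s * inf_laplacian v x0 < 0" and below: "s = 1 \<Longrightarrow> w x0 < 1"
  shows False
proof -
  let ?\<mu> = "lebesgue_on \<Omega>"
  have g0: "grad v x0 \<noteq> 0"
  proof
    assume "grad v x0 = 0"
    then have "partial_deriv i v x0 = 0" for i by (simp add: grad_def vec_eq_iff)
    then show False using lap by (simp add: inf_laplacian_def)
  qed
  define c where "c = - (s * inf_laplacian v x0)"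
  have c: "c > 0" using lap by (simp add: c_def)
  define m where "m = norm (grad v x0) / 2"
  have m: "m > 0" using g0 by (simp add: m_def)
  \<comment> \<open>With |grad v|^(p-4) factored out of the p-Laplacian, the second order remainder
    is |grad v|^2 times the Laplacian; T bounds it near x0, uniformly in p.\<close>
  define T where "T = (norm (grad v x0))\<^sup>2 * \<bar>laplacian v x0\<bar> + 1"
  define \<kappa> where "\<kappa> = (if s = 1 then (1 - w x0) / 3 else 1)"
  have \<kappa>: "\<kappa> > 0" using below by (auto simp: \<kappa>_def)
  have nh: "(f \<longlongrightarrow> f x0) (nhds x0)" if "continuous_on UNIV f" for f :: "real^'n \<Rightarrow> real"
    using that continuous_on_eq_continuous_at[OF open_UNIV] isCont_def tendsto_at_iff_tendsto_nhds by blast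
  have "\<forall>\<^sub>F x in nhds x0. x \<in> \<Omega>" using x0 open_\<Omega> eventually_nhds by blast
  moreover have "\<forall>\<^sub>F x in nhds x0. s * inf_laplacian v x < - (c / 2)"
  proof (rule order_tendstoD(2)[OF nh])
    show "continuous_on UNIV (\<lambda>x. s * inf_laplacian v x)"
      by (intro continuous_intros smooth_continuous_inf_laplacian v)
    show "s * inf_laplacian v x0 < - (c / 2)" using c by (simp add: c_def)
  qed
  moreover have "\<forall>\<^sub>F x in nhds x0. m < norm (grad v x)"
  proof (rule order_tendstoD(1)[OF nh])
    show "continuous_on UNIV (\<lambda>x. norm (grad v x))" by (intro continuous_intros smooth_continuous_grad v)
    show "m < norm (grad v x0)" using g0 by (simp add: m_def)
  qed
  moreover have "\<forall>\<^sub>F x in nhds x0. (norm (grad v x))\<^sup>2 * \<bar>laplacian v x\<bar> < T"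
  proof (rule order_tendstoD(2)[OF nh])
    show "continuous_on UNIV (\<lambda>x. (norm (grad v x))\<^sup>2 * \<bar>laplacian v x\<bar>)"
      by (intro continuous_intros smooth_continuous_grad smooth_continuous_laplacian v)
    show "(norm (grad v x0))\<^sup>2 * \<bar>laplacian v x0\<bar> < T" by (simp add: T_def)
  qed
  moreover have "\<forall>\<^sub>F x in nhds x0. w0 x < w0 x0 + \<kappa>"
    by (rule order_tendstoD(2)[OF nh[OF w0_continuous]]) (use \<kappa> in simp)
  ultimately have "\<forall>\<^sub>F x in nhds x0. x \<in> \<Omega> \<and> s * inf_laplacian v x < - (c / 2) \<and> m < norm (grad v x)
      \<and> (norm (grad v x))\<^sup>2 * \<bar>laplacian v x\<bar> < T \<and> w0 x < w0 x0 + \<kappa>"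
    by eventually_elim simp
  then obtain \<rho> where \<rho>: "\<rho> > 0" and near: "\<And>x. dist x x0 < \<rho> \<Longrightarrow> x \<in> \<Omega> \<and> s * inf_laplacian v x < - (c / 2) \<and> m < norm (grad v x)
      \<and> (norm (grad v x))\<^sup>2 * \<bar>laplacian v x\<bar> < T \<and> w0 x < w0 x0 + \<kappa>"
    unfolding eventually_nhds_metric by blast
  have cl: "x \<in> closure \<Omega>" if "x \<in> \<Omega>" for x using that closure_subset by auto
  have vc: "continuous_on A v" for A by (rule smooth_imp_continuous[OF v])
  \<comment> \<open>Strict touching and compactness give a positive gap away from x0, so that for
    small \<delta> the perturbation lives in the ball where the local estimates hold.\<close>
  obtain \<delta>0 where \<delta>0: "\<delta>0 > 0" "\<And>x. x \<in> closure \<Omega> - ball x0 \<rho> \<Longrightarrow> \<delta>0 \<le> s * (v x - w x)"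
  proof (cases "closure \<Omega> - ball x0 \<rho> = {}")
    case True
    then show thesis by (intro that[of 1]) (simp, blast)
  next
    case False
    have "compact (closure \<Omega> - ball x0 \<rho>)" using bounded by (intro compact_diff) auto
    moreover have "continuous_on (closure \<Omega> - ball x0 \<rho>) (\<lambda>x. s * (v x - w x))"
      by (intro continuous_intros vc continuous_on_subset[OF w_continuous]) auto
    ultimately obtain z where z: "z \<in> closure \<Omega> - ball x0 \<rho>"
      "\<And>x. x \<in> closure \<Omega> - ball x0 \<rho> \<Longrightarrow> s * (v z - w z) \<le> s * (v x - w x)"
      using continuous_attains_inf[of "closure \<Omega> - ball x0 \<rho>" "\<lambda>x. s * (v x - w x)"] False by blast
    have "s * (v z - w z) > 0" using z \<rho> by (intro strict) auto
    then show thesis using that z by blast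
  qed
  \<comment> \<open>The bound by 1 makes the hypothesis on \<open>C\<close> applicable, the bound by
    \<kappa> is for u \<le> \<theta>, and the bound by \<delta>0 localises the perturbation.\<close>
  define \<delta> where "\<delta> = min (min (\<delta>0 / 3) \<kappa>) 1"
  have \<delta>: "\<delta> > 0" "3 * \<delta> \<le> \<delta>0" "\<delta> \<le> \<kappa>" "\<delta> \<le> 1" using \<delta>0 \<kappa> by (auto simp: \<delta>_def)
  \<comment> \<open>Any exponential bound of \<lambda> will do here, so an arbitrary ball around x0
    replaces the largest inscribed one.\<close>
  obtain R where R: "R > 0" "ball x0 R \<subseteq> \<Omega>" using x0 open_\<Omega> openE by blast
  define L where "L = 1 / R + 1"
  have L: "L > 1 / R" "L > 0" using R by (auto simp: L_def add_pos_pos)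
  obtain B where B: "B > 0" "\<And>p q. p > 1 \<Longrightarrow> q \<ge> p \<Longrightarrow> sobolev_lambda \<Omega> p q \<le> B * L powr p"
    using sobolev_lambda_upper_bound[OF bounded open_\<Omega> R(2,1) L(1)] by blast
  define \<theta> where "\<theta> = 1 - \<kappa>"
  have \<theta>: "0 < \<theta>" "\<theta> < 1" if "s = 1"
  proof -
    have "0 \<le> w x0" using w_nonneg[OF cl[OF x0]] .
    then show "0 < \<theta>" "\<theta> < 1" using below[OF that] by (auto simp: \<theta>_def \<kappa>_def that)
  qed
  \<comment> \<open>The threshold is read off from the end of the argument: below it, p m^(p-4)
    would be less than m^(p-4).\<close>
  have asym: "\<forall>\<^sub>F n in sequentially. s = 1 \<longrightarrow> (L / m) powr p n * (q n * \<theta> powr q n) < m powr (- 4) * \<theta> / B"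
  proof (cases "s = 1")
    case True
    have "(\<lambda>n. (L / m) powr p n * (q n * \<theta> powr q n)) \<longlonglongrightarrow> 0"
      using L m \<theta>[OF True] by (intro powr_mult_powr_tendsto_0 p_lim ratio) auto
    moreover have "0 < m powr (- 4) * \<theta> / B" using m \<theta>[OF True] B by simp
    ultimately show ?thesis using order_tendstoD(2) by fastforce
  qed simp
  have "\<forall>\<^sub>F n in sequentially. False"
    using uniformly_close[OF \<delta>(1)] eventually_p_gt[of 4] eventually_p_gt[of "2 * (T + 1) / c + 2"] eventually_q_ge_p asym
  proof eventually_elim
    case (elim n)
    let ?p = "p n" and ?q = "q n" and ?u = "u n" and ?L = "sobolev_lambda \<Omega> (p n) (q n)"
    have q: "?q > 0" "?q > 1" "?p / ?q \<le> 1" "0 < ?p / ?q" using elim by auto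
    have p: "?p > 4" "?p > 0" using elim by auto
    define \<eta> where "\<eta> x = soft_pos (s * (?u x - v x) + \<delta>)" for x
    have \<eta>0: "\<eta> x \<ge> 0" for x by (simp add: \<eta>_def soft_pos_nonneg)
    have \<eta>c: "continuous_on (closure \<Omega>) \<eta>"
      unfolding \<eta>_def by (intro continuous_on_compose2[OF continuous_on_soft_pos[of UNIV]] continuous_intros u_continuous vc) auto
    have abs_s: "\<bar>s\<bar> = 1" using s by (auto simp: square_eq_1_iff)
    have close: "\<bar>s * (?u x - w x)\<bar> < \<delta>" if "x \<in> closure \<Omega>" for x
      using elim(1) that by (simp add: abs_mult abs_s)
    have supp: "x \<in> ball x0 \<rho>" if "x \<in> \<Omega>" "\<eta> x \<noteq> 0" for x
    proof (rule ccontr)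
      assume "x \<notin> ball x0 \<rho>"
      then have "\<delta>0 \<le> s * (v x - w x)" using cl that by (intro \<delta>0) auto
      moreover have "s * (?u x - v x) = s * (?u x - w x) - s * (v x - w x)" by (simp add: algebra_simps)
      ultimately have "s * (?u x - v x) + \<delta> \<le> 0" using close[OF cl[OF that(1)]] \<delta> by linarith
      then show False using that by (simp add: \<eta>_def soft_pos_0)
    qed
    \<comment> \<open>At x0 the functions v and w agree, so the shift \<delta> exceeds the uniform
      error and the perturbation does not vanish.\<close>
    have \<eta>x0: "\<eta> x0 > 0"
      unfolding \<eta>_def eq using close[OF cl[OF x0]] by (intro soft_pos_pos) linarith
    define H where "H = (LINT x|?\<mu>. \<eta> x)"
    have \<eta>i: "integrable ?\<mu> \<eta>" by (rule integrable_lebesgue_on_continuous[OF bounded sets_\<Omega> \<eta>c])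
    have H: "H > 0"
    proof -
      have "continuous_on \<Omega> \<eta>" using \<eta>c closure_subset continuous_on_subset by blast
      then have "open (\<Omega> \<inter> \<eta> -` {\<eta> x0 / 2<..})" using open_\<Omega> by (intro continuous_open_preimage) auto
      moreover have "x0 \<in> \<Omega> \<inter> \<eta> -` {\<eta> x0 / 2<..}" using x0 \<eta>x0 by simp
      ultimately obtain r where r: "r > 0" "ball x0 r \<subseteq> \<Omega> \<inter> \<eta> -` {\<eta> x0 / 2<..}" using openE by blast
      then have "\<eta> x0 / 2 * measure lebesgue (ball x0 r) \<le> H"
        unfolding H_def using \<eta>0 by (intro integral_ge_on_ball bounded sets_\<Omega> \<eta>c) (auto simp: subset_iff less_imp_le)
      moreover have "0 < \<eta> x0 / 2 * measure lebesgue (ball x0 r)"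
        using \<eta>x0 measure_ball_pos[OF r(1)] by (intro mult_pos_pos) auto
      ultimately show ?thesis by linarith
    qed
    \<comment> \<open>The lower bound on p makes (p - 2) times the infinity Laplacian at most -(T +
      1), after multiplication by s; the Laplacian term contributes less than T, which leaves
      -1.\<close>
    have pl: "s * (p_laplacian ?p v x * \<eta> x) \<le> - (m powr (?p - 4)) * \<eta> x" if x: "x \<in> \<Omega>" for x
    proof (cases "\<eta> x = 0")
      case False
      then have "dist x x0 < \<rho>" using supp[OF x] by (simp add: dist_commute)
      note nx = near[OF this]
      let ?g = "norm (grad v x)"
      have gp: "?g > 0" using nx m by linarith
      have "?g powr (?p - 2) = ?g powr (?p - 4) * ?g\<^sup>2"
        using gp by (simp flip: powr_numeral powr_add)
      then have "s * p_laplacian ?p v x = ?g powr (?p - 4) * ((?p - 2) * (s * inf_laplacian v x) + s * (?g\<^sup>2 * laplacian v x))"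
        by (simp add: p_laplacian_def algebra_simps)
      also have "\<dots> \<le> ?g powr (?p - 4) * (- 1)"
      proof (intro mult_left_mono)
        have "(?p - 2) * (s * inf_laplacian v x) \<le> (?p - 2) * (- (c / 2))"
          using nx p by (intro mult_left_mono) auto
        also have "\<dots> \<le> - (T + 1)" using elim(3) c by (simp add: field_simps)
        finally have "(?p - 2) * (s * inf_laplacian v x) \<le> - (T + 1)" .
        moreover have "\<bar>s * (?g\<^sup>2 * laplacian v x)\<bar> < T" using nx by (simp add: abs_mult abs_s)
        ultimately show "(?p - 2) * (s * inf_laplacian v x) + s * (?g\<^sup>2 * laplacian v x) \<le> - 1" by linarith
      qed simp
      also have "\<dots> \<le> - (m powr (?p - 4))"
        using nx m p by (simp add: powr_mono2)
      finally have "s * p_laplacian ?p v x * \<eta> x \<le> - (m powr (?p - 4)) * \<eta> x"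
        using \<eta>0 by (rule mult_right_mono)
      then show ?thesis by (simp add: mult.assoc)
    qed simp
    have "s * (LINT x|?\<mu>. p_laplacian ?p v x * \<eta> x) = (LINT x|?\<mu>. s * (p_laplacian ?p v x * \<eta> x))" by simp
    also have "\<dots> \<le> (LINT x|?\<mu>. - (m powr (?p - 4)) * \<eta> x)"
      using pl by (intro integral_mono integrable_lebesgue_on_continuous[OF bounded sets_\<Omega>] continuous_intros
          continuous_on_p_laplacian v p \<eta>c) auto
    finally have sH: "s * (LINT x|?\<mu>. p_laplacian ?p v x * \<eta> x) \<le> - (m powr (?p - 4) * H)" by (simp add: H_def)
    define I where "I = (LINT x|?\<mu>. norm (?u x - s * \<eta> x) powr ?q)"
    have "?L * I powr (?p / ?q) \<le> ?L + s * ?p * (LINT x|?\<mu>. p_laplacian ?p v x * \<eta> x)"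
      unfolding I_def \<eta>_def using C(3) \<delta>(4)
      by (intro sobolev_extremal_energy[OF bounded open_\<Omega> p(1) q(1) extremal v s C(1,2)]) (auto intro: order_trans)
    also have "s * ?p * (LINT x|?\<mu>. p_laplacian ?p v x * \<eta> x) = ?p * (s * (LINT x|?\<mu>. p_laplacian ?p v x * \<eta> x))"
      by simp
    also have "\<dots> \<le> ?p * (- (m powr (?p - 4) * H))"
      using sH p by (intro mult_left_mono) auto
    finally have E: "?L * I powr (?p / ?q) \<le> ?L - ?p * (m powr (?p - 4) * H)" by simp
    have pos: "0 < ?p * (m powr (?p - 4) * H)" using p m H by simp
    have ui: "integrable ?\<mu> (\<lambda>x. norm (?u x) powr ?q)"
      by (intro integrable_lebesgue_on_continuous bounded sets_\<Omega> continuous_on_norm_powr u_continuous q)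
    have wi: "integrable ?\<mu> (\<lambda>x. norm (?u x - s * \<eta> x) powr ?q)"
      by (intro integrable_lebesgue_on_continuous bounded sets_\<Omega> continuous_on_norm_powr continuous_intros u_continuous \<eta>c q)
    consider "s = 1" | "s = - 1" using s by (auto simp: square_eq_1_iff)
    then show False
    proof cases
      case 2
      have "1 = (LINT x|?\<mu>. norm (?u x) powr ?q)" by (rule u_integral[OF q(1), symmetric])
      also have "\<dots> \<le> I"
        unfolding I_def using \<eta>0 u_pos q 2
        by (intro integral_mono[OF ui wi] powr_mono2) (auto simp: less_imp_le abs_of_pos)
      finally have "1 \<le> I powr (?p / ?q)" using q by (intro ge_one_powr_ge_zero) auto
      then have "?L * 1 \<le> ?L * I powr (?p / ?q)" by (intro mult_left_mono lambda_nonneg)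
      then show False using E pos by linarith
    next
      case 1
      note \<theta> = \<theta>[OF 1]
      define y where "y = ?q * \<theta> powr (?q - 1) * H"
      have y0: "y \<ge> 0" using q H by (simp add: y_def)
      \<comment> \<open>Tangent inequality for the q-th power. The bound u \<le> \<theta> is
        available only near x0, but elsewhere the perturbation is zero.\<close>
      have pw: "norm (?u x) powr ?q - ?q * \<theta> powr (?q - 1) * \<eta> x \<le> norm (?u x - s * \<eta> x) powr ?q" if x: "x \<in> \<Omega>" for x
      proof -
        have up: "?u x > 0" by (rule u_pos[OF x])
        have le: "?u x powr (?q - 1) * \<eta> x \<le> \<theta> powr (?q - 1) * \<eta> x"
        proof (cases "\<eta> x = 0")
          case False
          then have "dist x x0 < \<rho>" using supp[OF x] by (simp add: dist_commute)
          from near[OF this] have "w x < w x0 + \<kappa>" using x x0 by (simp add: w0_def)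
          then have "?u x < w x0 + 2 * \<kappa>" using close[OF cl[OF x]] \<delta>(3) 1 by simp
          moreover have "w x0 = 1 - 3 * \<kappa>" using 1 by (simp add: \<kappa>_def diff_divide_distrib)
          ultimately have "?u x \<le> \<theta>" by (simp add: \<theta>_def)
          then show ?thesis using up q \<eta>0 by (intro mult_right_mono powr_mono2) auto
        qed simp
        have "?u x powr (?q - 2) * ?u x = ?u x powr (?q - 1)"
          using up by (simp add: powr_diff powr_numeral power2_eq_square)
        then have "norm (?u x) powr ?q - ?q * (?u x powr (?q - 1) * \<eta> x) \<le> norm (?u x - \<eta> x) powr ?q"
          using norm_powr_above_tangent[of ?q "?u x" "?u x - \<eta> x"] q up by (simp add: mult_ac)
        moreover have "?q * (?u x powr (?q - 1) * \<eta> x) \<le> ?q * (\<theta> powr (?q - 1) * \<eta> x)"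
          using le q by (intro mult_left_mono) auto
        ultimately show ?thesis using 1 by (simp add: mult.assoc)
      qed
      have "1 - y = (LINT x|?\<mu>. norm (?u x) powr ?q - ?q * \<theta> powr (?q - 1) * \<eta> x)"
        using ui \<eta>i u_integral[OF q(1)] by (simp add: y_def H_def)
      also have "\<dots> \<le> I"
        unfolding I_def using ui wi \<eta>i pw by (intro integral_mono) auto
      finally have Iy: "1 - y \<le> I" .
      \<comment> \<open>For a base in [0,1] an exponent p/q \<le> 1 only increases the power, so the
        loss stays linear in y. A negative 1 - y is trivial.\<close>
      have "1 - y \<le> I powr (?p / ?q)"
      proof (cases "1 - y \<le> 0")
        case False
        then have "(1 - y) powr 1 \<le> (1 - y) powr (?p / ?q)" using y0 q by (intro powr_mono') auto
        also have "\<dots> \<le> I powr (?p / ?q)" using False Iy q by (intro powr_mono2) auto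
        finally show ?thesis using False by simp
      next
        case True
        then show ?thesis using powr_ge_zero[of I "?p / ?q"] by linarith
      qed
      then have "?L * (1 - y) \<le> ?L * I powr (?p / ?q)" by (intro mult_left_mono lambda_nonneg)
      then have "?p * (m powr (?p - 4) * H) \<le> ?L * y" using E by (simp add: right_diff_distrib)
      also have "\<dots> = ?L * (?q * \<theta> powr (?q - 1)) * H" by (simp add: y_def)
      finally have "(?p * m powr (?p - 4)) * H \<le> (?L * (?q * \<theta> powr (?q - 1))) * H" by (simp add: mult.assoc)
      \<comment> \<open>Here the unknown size H of the perturbation drops out.\<close>
      then have "?p * m powr (?p - 4) \<le> ?L * (?q * \<theta> powr (?q - 1))" using H by simp
      also have "\<dots> \<le> (B * L powr ?p) * (?q * \<theta> powr (?q - 1))"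
        using B(2)[of ?p ?q] p elim(4) q by (intro mult_right_mono) auto
      also have "\<dots> = B / \<theta> * m powr ?p * ((L / m) powr ?p * (?q * \<theta> powr ?q))"
        using m L \<theta> by (simp add: powr_divide powr_diff)
      also have "\<dots> < B / \<theta> * m powr ?p * (m powr (- 4) * \<theta> / B)"
        using elim(5) 1 m \<theta> B by (intro mult_strict_left_mono) auto
      also have "\<dots> = m powr ?p * m powr (- 4)" using \<theta> B by simp
      also have "\<dots> = m powr (?p - 4)" by (simp flip: powr_add)
      finally have "?p * m powr (?p - 4) < 1 * m powr (?p - 4)" by simp
      then show False using m p by (simp add: mult_less_cancel_right)
    qed
  qed
  then show False by simp
qed

lemma viscosity:
  assumes D: "D \<subseteq> \<Omega>" and s: "s * s = 1" and below: "\<And>x. x \<in> D \<Longrightarrow> w x < 1"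
    and x0: "x0 \<in> D" and r: "r > 0" "ball x0 r \<subseteq> D" and \<phi>: "Ck_on 2 (ball x0 r) \<phi>" "\<phi> x0 = w x0"
    and touch: "\<And>x. x \<in> ball x0 r - {x0} \<Longrightarrow> s * (\<phi> x - w x) > 0"
  shows "s * inf_laplacian \<phi> x0 \<ge> 0"
proof (rule ccontr)
  assume "\<not> s * inf_laplacian \<phi> x0 \<ge> 0"
  then have lap: "s * inf_laplacian \<phi> x0 < 0" by simp
  have bound: "\<bar>w x\<bar> \<le> 1" if "x \<in> closure \<Omega>" for x
    using w_nonneg[OF that] w_le_1[OF that] by simp
  have r\<Omega>: "ball x0 r \<subseteq> \<Omega>" using r D by blast
  obtain v C where v: "smooth_fun_on UNIV v" "v x0 = w x0" "\<And>x. x \<in> closure \<Omega> - {x0} \<Longrightarrow> s * (v x - w x) > 0"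
    "compact C" "C \<subseteq> \<Omega>" "\<And>x. x \<notin> C \<Longrightarrow> 1 \<le> s * v x" "s * inf_laplacian v x0 < 0"
    using global_test_function[OF r(1) r\<Omega> \<phi> s touch bound lap] by blast
  have "x0 \<in> \<Omega>" using x0 D by blast
  then show False
    using no_strict_touching[OF s v(1) _ v(2) v(3) v(4,5) v(6) v(7)] below[OF x0] by blast
qed

lemma infinity_harmonic_limit:
  assumes D: "D \<subseteq> \<Omega>" and below: "\<And>x. x \<in> D \<Longrightarrow> w x < 1"
  shows "infinity_harmonic D w"
proof -
  have "continuous_on D w"
    using w_continuous D closure_subset continuous_on_subset by (metis subset_trans)
  moreover have "- inf_laplacian \<phi> x0 \<ge> 0"
    if "x0 \<in> D" "r > 0" "ball x0 r \<subseteq> D" "Ck_on 2 (ball x0 r) \<phi>" "\<phi> x0 - w x0 = 0"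
      "\<forall>x\<in>ball x0 r - {x0}. \<phi> x - w x < 0" for x0 r \<phi>
    using viscosity[OF D _ below that(1-4), of "- 1"] that(5,6) by simp
  moreover have "- inf_laplacian \<phi> x0 \<le> 0"
    if "x0 \<in> D" "r > 0" "ball x0 r \<subseteq> D" "Ck_on 2 (ball x0 r) \<phi>" "\<phi> x0 - w x0 = 0"
      "\<forall>x\<in>ball x0 r - {x0}. \<phi> x - w x > 0" for x0 r \<phi>
    using viscosity[OF D _ below that(1-4), of 1] that(5,6) by simp
  ultimately show ?thesis
    unfolding infinity_harmonic_def inf_supersolution_def inf_subsolution_def by blast
qed

end

section \<open>The distance function\<close>

text \<open>Expand (|a + h| - |a|)^2 \<ge> 0. The quadratic error is what makes the distance
  function semiconcave.\<close>

lemma norm_add_le: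
  fixes a h :: "'a::real_inner"
  assumes "a \<noteq> 0"
  shows "norm (a + h) \<le> norm a + (a \<bullet> h) / norm a + (norm h)\<^sup>2 / (2 * norm a)"
proof -
  let ?A = "norm a"
  have A: "?A > 0" using assms by simp
  have "(norm (a + h) - ?A)\<^sup>2 \<ge> 0" by simp
  then have "2 * ?A * norm (a + h) \<le> (norm (a + h))\<^sup>2 + ?A\<^sup>2"
    by (simp add: power2_diff mult_ac)
  also have "(norm (a + h))\<^sup>2 = ?A\<^sup>2 + 2 * (a \<bullet> h) + (norm h)\<^sup>2"
    by (simp only: power2_norm_eq_inner) (simp add: inner_add_left inner_add_right inner_commute)
  finally show ?thesis using A by (simp add: field_simps power2_eq_square)
qed

locale bounded_open =
  fixes \<Omega> :: "(real^'n) set"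
  assumes bounded: "bounded \<Omega>" and open_\<Omega>: "open \<Omega>" and nonempty: "\<Omega> \<noteq> {}"
begin

abbreviation (input) d where "d \<equiv> dist_bd \<Omega>"

definition nearest :: "real^'n \<Rightarrow> real^'n \<Rightarrow> bool"
  where "nearest x y \<longleftrightarrow> y \<in> frontier \<Omega> \<and> dist x y = d x"

definition direction :: "real^'n \<Rightarrow> real^'n \<Rightarrow> real^'n"
  where "direction x y = (1 / d x) *\<^sub>R (x - y)"

lemma frontier_nonempty: "frontier \<Omega> \<noteq> {}"
  using bounded nonempty by (auto simp: frontier_eq_empty)

lemma compact_frontier: "compact (frontier \<Omega>)"
  using bounded by (rule compact_frontier_bounded)

lemma nearest_exists: obtains y where "nearest x y"
  using infdist_attains_inf[OF frontier_closed frontier_nonempty, of x]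
  by (metis dist_bd_def nearest_def)

lemma dist_bd_le: "y \<in> frontier \<Omega> \<Longrightarrow> d x \<le> dist x y"
  unfolding dist_bd_def by (rule infdist_le)

lemma dist_bd_lipschitz: "\<bar>d x - d y\<bar> \<le> dist x y"
  unfolding dist_bd_def by (rule infdist_triangle_abs)

lemma continuous_on_dist_bd: "continuous_on A d"
  unfolding dist_bd_def by (intro continuous_intros)

lemma frontier_disjoint: "x \<in> \<Omega> \<Longrightarrow> x \<notin> frontier \<Omega>"
  using open_\<Omega> by (auto simp: frontier_def interior_open)

lemma dist_bd_pos: "x \<in> \<Omega> \<Longrightarrow> d x > 0"
  unfolding dist_bd_def
  using infdist_pos_not_in_closed[OF frontier_closed frontier_nonempty] frontier_disjoint by blast

lemma dist_bd_frontier: "x \<in> frontier \<Omega> \<Longrightarrow> d x = 0"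
  unfolding dist_bd_def by (rule infdist_zero)

text \<open>A connected set that meets the domain but not its frontier lies inside. The centre z is
  not assumed to be in the domain: \<open>dist_bd\<close> is positive outside the closure as well,
  so membership has to come from x.\<close>

lemma ball_subset:
  assumes "x \<in> \<Omega>" "dist z x < r" "r \<le> d z"
  shows "ball z r \<subseteq> \<Omega>"
proof (rule ccontr)
  assume "\<not> ball z r \<subseteq> \<Omega>"
  then have "ball z r \<inter> frontier \<Omega> \<noteq> {}"
    using assms by (intro connected_Int_frontier) auto
  then show False using dist_bd_le[of _ z] assms by force
qed

lemma dist_bd_max:
  obtains x where "x \<in> \<Omega>" "\<And>y. y \<in> closure \<Omega> \<Longrightarrow> d y \<le> d x"
proof -
  have "compact (closure \<Omega>)" "closure \<Omega> \<noteq> {}" using bounded nonempty by auto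
  then obtain x where x: "x \<in> closure \<Omega>" "\<And>y. y \<in> closure \<Omega> \<Longrightarrow> d y \<le> d x"
    using continuous_attains_sup[OF _ _ continuous_on_dist_bd] by metis
  obtain z where z: "z \<in> \<Omega>" using nonempty by blast
  then have "d x > 0" using x(2)[of z] dist_bd_pos[OF z] closure_subset by fastforce
  then have "x \<notin> frontier \<Omega>" using dist_bd_frontier[of x] by auto
  then have "x \<in> \<Omega>" using x(1) open_\<Omega> by (simp add: frontier_def interior_open)
  then show thesis using x(2) that by blast
qed

text \<open>For a continuous function the essential supremum is the maximum: a nonempty open
  superlevel set has positive measure.\<close>

lemma Linf_norm_dist_bd:
  assumes x: "x \<in> \<Omega>" and max: "\<And>y. y \<in> \<Omega> \<Longrightarrow> d y \<le> d x"
  shows "Linf_norm \<Omega> d = d x"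
proof -
  let ?\<mu> = "lebesgue_on \<Omega>" and ?f = "\<lambda>x. ereal (norm (d x))"
  have S: "\<Omega> \<in> sets lebesgue" using open_\<Omega> by (simp add: borel_open)
  have d0: "d y \<ge> 0" for y by (simp add: dist_bd_def infdist_nonneg)
  have [measurable]: "d \<in> borel_measurable ?\<mu>"
    using S by (intro continuous_imp_measurable_on_sets_lebesgue continuous_on_dist_bd)
  have fm: "?f \<in> borel_measurable ?\<mu>" by measurable
  have "esssup ?\<mu> ?f \<le> ereal (d x)"
    using max d0 by (intro esssup_I fm AE_I2) auto
  moreover have "ereal (d x) \<le> esssup ?\<mu> ?f"
  proof (rule ccontr)
    assume "\<not> ereal (d x) \<le> esssup ?\<mu> ?f"
    then obtain c where c: "esssup ?\<mu> ?f < ereal c" "ereal c < ereal (d x)"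
      using ereal_dense2[of "esssup ?\<mu> ?f" "ereal (d x)"] unfolding not_le by blast
    have "open (\<Omega> \<inter> d -` {c<..})" using open_\<Omega> by (intro continuous_open_preimage continuous_on_dist_bd) auto
    moreover have "x \<in> \<Omega> \<inter> d -` {c<..}" using x c(2) by simp
    ultimately obtain r where r: "r > 0" "ball x r \<subseteq> \<Omega> \<inter> d -` {c<..}" using openE by blast
    have "AE y in ?\<mu>. ?f y \<le> esssup ?\<mu> ?f" by (rule esssup_AE)
    then have "AE y in lebesgue. y \<in> \<Omega> \<longrightarrow> ?f y \<le> esssup ?\<mu> ?f" using S by (simp add: AE_restrict_space_iff)
    then have "AE y in lebesgue. y \<notin> ball x r"
    proof eventually_elim
      case (elim y)
      show ?case
      proof
        assume "y \<in> ball x r"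
        then have "y \<in> \<Omega>" "c < d y" using r by auto
        then have "ereal (norm (d y)) < ereal c" using elim c by (meson le_less_trans)
        then show False using \<open>c < d y\<close> d0[of y] by simp
      qed
    qed
    then have "ball x r \<in> null_sets lebesgue" by (subst AE_iff_null_sets) auto
    then have "measure lebesgue (ball x r) = 0" by (rule measure_eq_0_null_sets)
    then show False using content_ball_pos[OF r(1), of x] by (simp add: measure_completion)
  qed
  ultimately have "esssup ?\<mu> ?f = ereal (d x)" by (rule antisym)
  then show ?thesis by (simp add: Linf_norm_def)
qed

lemma nearest_step:
  assumes "nearest x y" "0 \<le> t" "t \<le> d x" "d x > 0"
  shows "d (x - t *\<^sub>R direction x y) = d x - t"
proof -
  let ?z = "x - t *\<^sub>R direction x y"
  have n: "norm (x - y) = d x" using assms by (simp add: nearest_def dist_norm)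
  have "?z - y = (1 - t / d x) *\<^sub>R (x - y)" by (simp add: direction_def algebra_simps)
  moreover have "0 \<le> 1 - t / d x" using assms by simp
  ultimately have "norm (?z - y) = (1 - t / d x) * d x" by (simp add: n)
  also have "\<dots> = d x - t" using assms by (simp add: left_diff_distrib)
  finally have "d ?z \<le> d x - t" using dist_bd_le[of y ?z] assms by (simp add: nearest_def dist_norm)
  moreover have "\<bar>d x - d ?z\<bar> \<le> t"
    using dist_bd_lipschitz[of x ?z] assms n by (simp add: dist_norm direction_def)
  ultimately show ?thesis by linarith
qed

lemma norm_direction: "nearest x y \<Longrightarrow> d x > 0 \<Longrightarrow> norm (direction x y) = 1"
  by (simp add: nearest_def direction_def dist_norm)

lemma nearest_eq: "nearest x y \<Longrightarrow> d x > 0 \<Longrightarrow> y = x - d x *\<^sub>R direction x y"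
  by (simp add: direction_def)

text \<open>The distance is 1-Lipschitz, so |g| \<le> 1 for its gradient g; it falls at unit rate
  towards y, so g . e \<ge> 1. Together |g - e|^2 \<le> 0.\<close>

lemma derivative_eq_direction:
  assumes x: "x \<in> \<Omega>" and diff: "d differentiable (at x)" and y: "nearest x y"
  shows "(d has_derivative (\<lambda>h. direction x y \<bullet> h)) (at x)"
proof -
  note dx = dist_bd_pos[OF x]
  let ?e = "direction x y" and ?g = "grad d x"
  have D: "(d has_derivative (\<lambda>h. ?g \<bullet> h)) (at x)" by (rule has_derivative_grad[OF diff])
  have e1: "norm ?e = 1" by (rule norm_direction[OF y dx])
  have appr: "\<exists>\<delta>>0. \<forall>h. norm h < \<delta> \<longrightarrow> \<bar>d (x + h) - d x - ?g \<bullet> h\<bar> \<le> \<epsilon> * norm h" if e: "\<epsilon> > 0" for \<epsilon>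
  proof -
    obtain \<delta> where \<delta>: "\<delta> > 0" "\<forall>z. norm (z - x) < \<delta> \<longrightarrow> norm (d z - d x - ?g \<bullet> (z - x)) \<le> \<epsilon> * norm (z - x)"
      using D[unfolded has_derivative_at_alt, THEN conjunct2, rule_format, OF e] by (elim exE conjE)
    show ?thesis
    proof (intro exI[of _ \<delta>] conjI allI impI)
      show "\<bar>d (x + h) - d x - ?g \<bullet> h\<bar> \<le> \<epsilon> * norm h" if "norm h < \<delta>" for h
        using \<delta>(2)[rule_format, of "x + h"] that by simp
    qed (rule \<delta>(1))
  qed
  have ge: "?g \<bullet> ?e \<ge> 1"
  proof (rule field_le_epsilon)
    fix \<epsilon> :: real assume "\<epsilon> > 0"
    then obtain \<delta> where \<delta>: "\<delta> > 0" "\<And>h. norm h < \<delta> \<Longrightarrow> \<bar>d (x + h) - d x - ?g \<bullet> h\<bar> \<le> \<epsilon> * norm h"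
      using appr by blast
    define t where "t = min (\<delta> / 2) (d x)"
    have t: "t > 0" "t < \<delta>" "t \<le> d x" using \<delta> dx by (auto simp: t_def)
    have "\<bar>d (x - t *\<^sub>R ?e) - d x + t * (?g \<bullet> ?e)\<bar> \<le> \<epsilon> * t"
      using \<delta>(2)[of "- (t *\<^sub>R ?e)"] t e1 by simp
    then have "t * 1 \<le> t * (?g \<bullet> ?e + \<epsilon>)"
      using nearest_step[OF y, of t] t dx by (simp add: algebra_simps)
    then show "1 \<le> ?g \<bullet> ?e + \<epsilon>" using t by simp
  qed
  have le: "norm ?g \<le> 1"
  proof (rule field_le_epsilon)
    fix \<epsilon> :: real assume "\<epsilon> > 0"
    then obtain \<delta> where \<delta>: "\<delta> > 0" "\<And>h. norm h < \<delta> \<Longrightarrow> \<bar>d (x + h) - d x - ?g \<bullet> h\<bar> \<le> \<epsilon> * norm h"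
      using appr by blast
    define t where "t = \<delta> / (2 * (norm ?g + 1))"
    have n1: "norm ?g + 1 > 0" by (simp add: add_nonneg_pos)
    have t: "t > 0" using \<delta> n1 by (simp add: t_def)
    have "t * norm ?g \<le> t * (norm ?g + 1)" using t by simp
    also have "\<dots> = \<delta> / 2" using n1 by (simp add: t_def field_simps)
    also have "\<dots> < \<delta>" using \<delta> by simp
    finally have "norm (t *\<^sub>R ?g) < \<delta>" using t by simp
    from \<delta>(2)[OF this] have "\<bar>?g \<bullet> (t *\<^sub>R ?g)\<bar> \<le> \<bar>d (x + t *\<^sub>R ?g) - d x\<bar> + \<epsilon> * norm (t *\<^sub>R ?g)" by linarith
    also have "\<bar>d (x + t *\<^sub>R ?g) - d x\<bar> \<le> norm (t *\<^sub>R ?g)"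
      using dist_bd_lipschitz[of "x + t *\<^sub>R ?g" x] by (simp add: dist_norm)
    finally have "t * (norm ?g * norm ?g) \<le> t * ((1 + \<epsilon>) * norm ?g)"
      using t by (simp add: algebra_simps flip: power2_norm_eq_inner power2_eq_square)
    then have "norm ?g * norm ?g \<le> (1 + \<epsilon>) * norm ?g" using t by simp
    then show "norm ?g \<le> 1 + \<epsilon>" using \<open>\<epsilon> > 0\<close> by (cases "norm ?g = 0") auto
  qed
  have "(norm (?g - ?e))\<^sup>2 = (norm ?g)\<^sup>2 - 2 * (?g \<bullet> ?e) + (norm ?e)\<^sup>2"
    by (simp only: power2_norm_eq_inner) (simp add: inner_diff_left inner_diff_right inner_commute)
  also have "\<dots> \<le> 1 - 2 * 1 + 1"
    using ge le e1 by (intro add_mono diff_mono) (auto simp: power_le_one)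
  finally have "?g = ?e" by simp
  then show ?thesis using D by simp
qed

lemma nearest_unique:
  assumes x: "x \<in> \<Omega>" and diff: "d differentiable (at x)" and y: "nearest x y" "nearest x y'"
  shows "y = y'"
proof -
  have "direction x y = direction x y'"
    using derivative_eq_direction[OF x diff y(1)] derivative_eq_direction[OF x diff y(2)] grad_eqI by metis
  then show ?thesis using nearest_eq[OF y(1)] nearest_eq[OF y(2)] dist_bd_pos[OF x] by metis
qed

text \<open>By compactness the frontier points away from the unique nearest one are farther by a
  fixed margin, which a small move of x cannot overcome.\<close>

lemma nearest_continuous:
  assumes uniq: "\<And>y'. nearest x y' \<Longrightarrow> y' = y" and e: "e > 0"
  obtains \<delta> where "\<delta> > 0" "\<And>x' y'. dist x' x < \<delta> \<Longrightarrow> nearest x' y' \<Longrightarrow> dist y' y < e"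
proof -
  let ?F = "frontier \<Omega> - ball y e"
  have "\<exists>\<eta>>0. \<forall>y'\<in>?F. d x + \<eta> \<le> dist x y'"
  proof (cases "?F = {}")
    case False
    have "compact ?F" using compact_frontier by (intro compact_diff) auto
    then obtain z where z: "z \<in> ?F" "\<And>y'. y' \<in> ?F \<Longrightarrow> dist x z \<le> dist x y'"
      using continuous_attains_inf[of ?F "dist x"] False continuous_on_dist[OF continuous_on_const continuous_on_id] by metis
    have "dist x z \<noteq> d x" using z uniq[of z] e by (auto simp: nearest_def)
    then have "d x < dist x z" using dist_bd_le[of z x] z by auto
    then show ?thesis using z by (intro exI[of _ "dist x z - d x"]) auto
  qed (auto intro: exI[of _ 1])
  then obtain \<eta> where \<eta>: "\<eta> > 0" "\<And>y'. y' \<in> ?F \<Longrightarrow> d x + \<eta> \<le> dist x y'" by blast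
  show thesis
  proof (rule that[of "\<eta> / 2"])
    show "\<eta> / 2 > 0" using \<eta> by simp
    fix x' y' assume x': "dist x' x < \<eta> / 2" and n: "nearest x' y'"
    have "dist x y' \<le> dist x x' + dist x' y'" by (rule dist_triangle)
    also have "dist x' y' = d x'" using n by (simp add: nearest_def)
    also have "dist x x' + d x' \<le> dist x x' + (d x + dist x' x)"
      using dist_bd_lipschitz[of x' x] by simp
    also have "\<dots> < d x + \<eta>" using x' by (simp add: dist_commute)
    finally have "y' \<notin> ?F" using \<eta>(2)[of y'] by auto
    then show "dist y' y < e" using n by (auto simp: nearest_def dist_commute)
  qed
qed

text \<open>Freezing y bounds the distance by |. - y|. This works for every nearest point, so where
  there are several the distance lies below several slopes at once.\<close>

lemma dist_bd_upper:
  assumes y: "nearest x y" and dx: "d x > 0"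
  shows "d (x + h) \<le> d x + direction x y \<bullet> h + (norm h)\<^sup>2 / (2 * d x)"
proof -
  have n: "norm (x - y) = d x" using y by (simp add: nearest_def dist_norm)
  have "d (x + h) \<le> norm (x - y + h)"
    using dist_bd_le[of y "x + h"] y by (simp add: nearest_def dist_norm algebra_simps)
  also have "\<dots> \<le> d x + ((x - y) \<bullet> h) / d x + (norm h)\<^sup>2 / (2 * d x)"
  proof -
    have "x - y \<noteq> 0" using n dx by force
    from norm_add_le[OF this, of h] show ?thesis by (simp add: n)
  qed
  finally show ?thesis by (simp add: direction_def)
qed

text \<open>The upper estimate freezes y. The lower one uses a nearest point y' of the moved point,
  whose direction differs little from that of y because nearest points depend continuously on the
  point.\<close>

lemma differentiable_if_unique_nearest:
  assumes x: "x \<in> \<Omega>" and y: "nearest x y" and uniq: "\<And>y'. nearest x y' \<Longrightarrow> y' = y"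
  shows "d differentiable (at x)"
proof -
  note dx = dist_bd_pos[OF x]
  let ?e = "direction x y"
  have n: "norm (x - y) = d x" using y by (simp add: nearest_def dist_norm)
  have "(d has_derivative (\<lambda>h. ?e \<bullet> h)) (at x)"
    unfolding has_derivative_at_alt
  proof (intro conjI allI impI)
    show "bounded_linear (\<lambda>h. ?e \<bullet> h)" by (rule bounded_linear_inner_right)
    fix \<epsilon> :: real assume \<epsilon>: "\<epsilon> > 0"
    have "((\<lambda>z. (1 / norm (x - z)) *\<^sub>R (x - z)) \<longlongrightarrow> (1 / norm (x - y)) *\<^sub>R (x - y)) (nhds y)"
      using n dx by (intro tendsto_intros filterlim_ident) auto
    then have "\<forall>\<^sub>F z in nhds y. dist ((1 / norm (x - z)) *\<^sub>R (x - z)) ?e < \<epsilon>"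
      using \<epsilon> unfolding tendsto_iff by (simp add: n direction_def)
    moreover have "\<forall>\<^sub>F z in nhds y. z \<noteq> x"
      using n dx by (intro t1_space_nhds) auto
    ultimately have "\<forall>\<^sub>F z in nhds y. dist ((1 / norm (x - z)) *\<^sub>R (x - z)) ?e < \<epsilon> \<and> z \<noteq> x"
      by (rule eventually_conj)
    then obtain r where r: "r > 0" "\<And>z. dist z y < r \<Longrightarrow> dist ((1 / norm (x - z)) *\<^sub>R (x - z)) ?e < \<epsilon> \<and> z \<noteq> x"
      unfolding eventually_nhds_metric by blast
    obtain \<delta> where \<delta>: "\<delta> > 0" "\<And>x' y'. dist x' x < \<delta> \<Longrightarrow> nearest x' y' \<Longrightarrow> dist y' y < r"
      using nearest_continuous[OF uniq r(1)] by blast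
    \<comment> \<open>The second bound absorbs the quadratic term of the upper estimate into
      \<epsilon> times the norm.\<close>
    define \<delta>' where "\<delta>' = min \<delta> (\<epsilon> * (2 * d x))"
    have "norm (d z - d x - ?e \<bullet> (z - x)) \<le> \<epsilon> * norm (z - x)" if z: "norm (z - x) < \<delta>'" for z
    proof -
      let ?h = "z - x"
      have "d z \<le> d x + ?e \<bullet> ?h + (norm ?h)\<^sup>2 / (2 * d x)"
        using dist_bd_upper[OF y dx, of ?h] by simp
      moreover have "(norm ?h)\<^sup>2 / (2 * d x) \<le> \<epsilon> * norm ?h"
      proof -
        have "norm ?h * norm ?h \<le> (\<epsilon> * (2 * d x)) * norm ?h"
          using z by (intro mult_right_mono) (auto simp: \<delta>'_def)
        then show ?thesis using dx by (simp add: power2_eq_square field_simps)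
      qed
      moreover have "d x + ?e \<bullet> ?h - \<epsilon> * norm ?h \<le> d z"
      proof -
        obtain y' where y': "nearest z y'" by (rule nearest_exists)
        let ?a = "x - y'"
        have "dist y' y < r" using z y' by (intro \<delta>(2)) (auto simp: \<delta>'_def dist_norm)
        note r' = r(2)[OF this]
        have a: "norm ?a > 0" using r' by auto
        have "?a \<bullet> (?a + ?h) \<le> norm ?a * norm (?a + ?h)" by (rule norm_cauchy_schwarz)
        then have "norm ?a * norm ?a + ?a \<bullet> ?h \<le> norm ?a * norm (?a + ?h)"
          by (simp only: inner_add_right power2_norm_eq_inner[symmetric] power2_eq_square)
        moreover have "norm ?a * (norm ?a + ((1 / norm ?a) *\<^sub>R ?a) \<bullet> ?h) = norm ?a * norm ?a + ?a \<bullet> ?h"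
          using a by (simp only: inner_scaleR_left distrib_left) simp
        ultimately have "norm ?a + ((1 / norm ?a) *\<^sub>R ?a) \<bullet> ?h \<le> norm (?a + ?h)"
          using a by (metis mult_left_le_imp_le)
        also have "norm (?a + ?h) = d z" using y' by (simp add: nearest_def dist_norm algebra_simps)
        finally have "norm ?a + ((1 / norm ?a) *\<^sub>R ?a) \<bullet> ?h \<le> d z" .
        moreover have "d x \<le> norm ?a" using dist_bd_le[of y' x] y' by (simp add: nearest_def dist_norm)
        moreover have "(?e - (1 / norm ?a) *\<^sub>R ?a) \<bullet> ?h \<le> \<epsilon> * norm ?h"
        proof -
          have "(?e - (1 / norm ?a) *\<^sub>R ?a) \<bullet> ?h \<le> norm (?e - (1 / norm ?a) *\<^sub>R ?a) * norm ?h"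
            by (rule norm_cauchy_schwarz)
          also have "\<dots> \<le> \<epsilon> * norm ?h"
            using r' by (intro mult_right_mono) (auto simp: dist_norm norm_minus_commute)
          finally show ?thesis .
        qed
        ultimately show ?thesis by (simp add: inner_diff_left)
      qed
      ultimately show ?thesis by (simp add: abs_le_iff)
    qed
    moreover have "\<delta>' > 0" using \<delta> \<epsilon> dx by (simp add: \<delta>'_def)
    ultimately show "\<exists>\<delta>>0. \<forall>z. norm (z - x) < \<delta> \<longrightarrow> norm (d z - d x - ?e \<bullet> (z - x)) \<le> \<epsilon> * norm (z - x)" by blast
  qed
  then show ?thesis by (rule differentiableI)
qed

text \<open>A derivative would be a unit direction, along which the distance would still
  increase.\<close>

lemma max_not_differentiable:
  assumes x: "x \<in> \<Omega>" and max: "\<And>y. y \<in> \<Omega> \<Longrightarrow> d y \<le> d x"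
  shows "\<not> d differentiable (at x)"
proof
  assume diff: "d differentiable (at x)"
  note dx = dist_bd_pos[OF x]
  obtain y where y: "nearest x y" by (rule nearest_exists)
  let ?e = "direction x y"
  have e1: "norm ?e = 1" by (rule norm_direction[OF y dx])
  obtain \<delta> where \<delta>: "\<delta> > 0" "\<And>z. norm (z - x) < \<delta> \<Longrightarrow> norm (d z - d x - ?e \<bullet> (z - x)) \<le> (1 / 2) * norm (z - x)"
    using derivative_eq_direction[OF x diff y] unfolding has_derivative_at_alt
    by (metis half_gt_zero zero_less_one)
  define t where "t = min (\<delta> / 2) (d x / 2)"
  have t: "t > 0" "t < \<delta>" "t < d x" using \<delta> dx by (auto simp: t_def)
  have "ball x (d x) \<subseteq> \<Omega>" using x dx by (intro ball_subset[of x]) auto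
  moreover have "x + t *\<^sub>R ?e \<in> ball x (d x)" using t e1 by (simp add: dist_norm)
  ultimately have "d (x + t *\<^sub>R ?e) \<le> d x" by (intro max) blast
  moreover have "?e \<bullet> ?e = 1" using e1 by (simp add: norm_eq_1)
  then have "\<bar>d (x + t *\<^sub>R ?e) - d x - t\<bar> \<le> (1 / 2) * t"
    using \<delta>(2)[of "x + t *\<^sub>R ?e"] t e1 by simp
  ultimately show False using t by linarith
qed

text \<open>At a point with two nearest boundary points with directions \<open>e\<^sub>1 \<noteq> e\<^sub>2\<close>, the distance has a concave
  kink; the test function has gradient \<open>(e\<^sub>1 + 3 e\<^sub>2) / 4\<close>, which is not orthogonal to \<open>e\<^sub>1 - e\<^sub>2\<close>, and a
  large negative second derivative in the direction \<open>e\<^sub>1 - e\<^sub>2\<close>.\<close>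

lemma differentiable_if_subsolution:
  assumes R: "R > 0" and D: "open D" "D \<subseteq> \<Omega>" and w: "\<And>x. x \<in> D \<Longrightarrow> w x = d x / R"
    and sub: "inf_subsolution D w" and x: "x \<in> D"
  shows "d differentiable (at x)"
proof (rule ccontr)
  assume nd: "\<not> d differentiable (at x)"
  have x\<Omega>: "x \<in> \<Omega>" using x D by blast
  note dx = dist_bd_pos[OF x\<Omega>]
  obtain y1 where y1: "nearest x y1" by (rule nearest_exists)
  obtain y2 where y2: "nearest x y2" "y2 \<noteq> y1"
    using differentiable_if_unique_nearest[OF x\<Omega> y1] nd by blast
  define e1 where "e1 = direction x y1"
  define e2 where "e2 = direction x y2"
  have n1: "norm e1 = 1" "norm e2 = 1"
    unfolding e1_def e2_def using norm_direction y1 y2 dx by auto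
  have ne: "e1 \<noteq> e2"
    using nearest_eq[OF y1 dx] nearest_eq[OF y2(1) dx] y2(2) unfolding e1_def e2_def by metis
  define f where "f = e1 - e2"
  \<comment> \<open>Equal weights would make g orthogonal to f, since both directions have norm 1;
    the large negative curvature along f would then not be seen by the infinity Laplacian.\<close>
  define g where "g = (1 / 4) *\<^sub>R e1 + (3 / 4) *\<^sub>R e2"
  define c where "c = e1 \<bullet> e2"
  have ee: "e1 \<bullet> e1 = 1" "e2 \<bullet> e2 = 1" using n1 by (simp_all add: norm_eq_1)
  have "f \<bullet> f > 0" using ne by (simp add: f_def)
  then have c1: "c < 1" by (simp add: f_def inner_diff_left inner_diff_right ee c_def inner_commute)
  have fg: "f \<bullet> g = - ((1 - c) / 2)"
    by (simp add: f_def g_def inner_diff_left inner_add_right ee c_def[symmetric] inner_commute[of e2 e1] field_simps)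
  have "norm g \<le> norm ((1 / 4) *\<^sub>R e1) + norm ((3 / 4) *\<^sub>R e2)" unfolding g_def by (rule norm_triangle_ineq)
  then have g1: "norm g \<le> 1" by (simp add: n1)
  \<comment> \<open>Twice the coefficient in \<open>dist_bd_upper\<close>, so that the touching is
    strict.\<close>
  define C where "C = 1 / d x"
  have C: "C > 0" using dx by (simp add: C_def)
  \<comment> \<open>Makes 2 K (f . g)^2 equal to 4 C, against a positive contribution 2 C |g|^2
    \<le> 2 C.\<close>
  define K where "K = 8 * C / (1 - c)\<^sup>2"
  have K: "K > 0" using C c1 by (simp add: K_def)
  define A where "A = matrix (\<lambda>k. (- 2 * K / R * (f \<bullet> k)) *\<^sub>R f)"
  have "linear (\<lambda>k. (k0 * (f \<bullet> k)) *\<^sub>R f)" for k0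
    by (rule linearI) (simp_all add: inner_add_right distrib_left scaleR_left_distrib mult_ac)
  then have A: "A *v k = (- 2 * K / R * (f \<bullet> k)) *\<^sub>R f" for k
    unfolding A_def by (rule matrix_vector_mul(2)[THEN fun_cong])
  define \<phi> where "\<phi> = quartic (d x / R) ((1 / R) *\<^sub>R g) A (C / R) 0 x"
  have \<phi>_eq: "\<phi> z = (d x + g \<bullet> (z - x) - K * (f \<bullet> (z - x))\<^sup>2 + C * (norm (z - x))\<^sup>2) / R" for z
    using R by (simp add: \<phi>_def quartic_def A inner_commute[of "z - x" f] power2_eq_square field_simps)
  obtain r0 where r0: "r0 > 0" "ball x r0 \<subseteq> D" using D x openE by blast
  \<comment> \<open>As |f . h| \<le> 2 |h|, this radius gives K (f . h)^2 \<le> |f . h| / 4: the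
    concave kink dominates the parabola.\<close>
  define r where "r = min r0 (1 / (8 * K))"
  have r: "r > 0" "r \<le> r0" "r \<le> 1 / (8 * K)" using r0 K by (auto simp: r_def)
  have rD: "ball x r \<subseteq> D" using r r0 by (auto simp: subset_iff)
  have C2: "Ck_on 2 (ball x r) \<phi>"
    using smooth_quartic[of "d x / R" "(1 / R) *\<^sub>R g" A "C / R" 0 x] Ck_on_subset
    unfolding \<phi>_def smooth_fun_on_def by blast
  have touch: "\<phi> z - w z > 0" if z: "z \<in> ball x r - {x}" for z
  proof -
    let ?h = "z - x"
    define s where "s = f \<bullet> ?h"
    have h: "norm ?h > 0" "norm ?h < r" using z by (auto simp: dist_norm norm_minus_commute)
    have up: "d z \<le> d x + e1 \<bullet> ?h + (norm ?h)\<^sup>2 / (2 * d x)" "d z \<le> d x + e2 \<bullet> ?h + (norm ?h)\<^sup>2 / (2 * d x)"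
      using dist_bd_upper[OF y1 dx, of ?h] dist_bd_upper[OF y2(1) dx, of ?h] by (simp_all add: e1_def e2_def)
    have es: "e1 \<bullet> ?h = g \<bullet> ?h + 3 / 4 * s" "e2 \<bullet> ?h = g \<bullet> ?h - 1 / 4 * s"
      by (simp_all add: s_def f_def g_def inner_diff_left inner_add_left field_simps)
    \<comment> \<open>The upper bound used is the second for s \<ge> 0 and the first for s < 0;
      relative to g they carry -s/4 and 3 s/4.\<close>
    have "d z \<le> d x + g \<bullet> ?h - \<bar>s\<bar> / 4 + (norm ?h)\<^sup>2 / (2 * d x)"
      using up unfolding es by (cases "s \<ge> 0") auto
    moreover have "K * s\<^sup>2 \<le> \<bar>s\<bar> / 4"
    proof -
      have "\<bar>s\<bar> \<le> norm f * norm ?h" unfolding s_def by (rule Cauchy_Schwarz_ineq2)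
      also have "\<dots> \<le> 2 * norm ?h"
        using norm_triangle_ineq4[of e1 e2] n1 by (intro mult_right_mono) (auto simp: f_def)
      finally have "\<bar>s\<bar> \<le> 2 * (1 / (8 * K))" using h r by linarith
      then have "K * \<bar>s\<bar> \<le> 1 / 4" using K by (simp add: field_simps)
      then have "K * \<bar>s\<bar> * \<bar>s\<bar> \<le> 1 / 4 * \<bar>s\<bar>" by (rule mult_right_mono) simp
      then show ?thesis by (simp add: power2_eq_square mult.assoc)
    qed
    moreover have "(norm ?h)\<^sup>2 / (2 * d x) < C * (norm ?h)\<^sup>2"
      using h dx by (simp add: C_def field_simps)
    ultimately have "d z < d x + g \<bullet> ?h - K * s\<^sup>2 + C * (norm ?h)\<^sup>2" by linarith
    then have "d z / R < \<phi> z" unfolding \<phi>_eq s_def using R by (intro divide_strict_right_mono)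
    then show ?thesis using w[of z] z rD by auto
  qed
  have eq: "\<phi> x - w x = 0" using w[OF x] by (simp add: \<phi>_eq)
  have "- inf_laplacian \<phi> x \<le> 0"
    using sub x r(1) rD C2 touch eq unfolding inf_subsolution_def by blast
  moreover have "inf_laplacian \<phi> x = (2 * C * (norm g)\<^sup>2 - 2 * K * (f \<bullet> g)\<^sup>2) / R ^ 3"
    unfolding \<phi>_def quartic_derivatives(2) A
    using R by (simp add: inner_commute[of g f] power2_eq_square power3_eq_cube field_simps)
  moreover have "2 * C * (norm g)\<^sup>2 - 2 * K * (f \<bullet> g)\<^sup>2 < 0"
  proof -
    have fg2: "(f \<bullet> g)\<^sup>2 = (1 - c)\<^sup>2 / 4" unfolding fg by (simp add: power_divide)
    have "K * (1 - c)\<^sup>2 = 8 * C" using c1 by (simp add: K_def)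
    then have "2 * K * (f \<bullet> g)\<^sup>2 = 4 * C" unfolding fg2 by simp
    moreover have "(norm g)\<^sup>2 \<le> 1" using g1 by (simp add: power_le_one)
    then have "C * (norm g)\<^sup>2 \<le> C * 1" using C by (intro mult_left_mono) auto
    ultimately show ?thesis using C by linarith
  qed
  then have "(2 * C * (norm g)\<^sup>2 - 2 * K * (f \<bullet> g)\<^sup>2) / R ^ 3 < 0"
    using R by (intro divide_neg_pos zero_less_power)
  ultimately show False by linarith
qed

text \<open>A segment from the boundary along which the distance grows at unit speed can be prolonged
  past any point near which the distance is differentiable: a fixed point of
  \<open>x \<mapsto> z + t \<nabla>d(x)\<close>, which exists by Brouwer's theorem, lies on the prolongation.\<close>

lemma nearest_prolong:
  assumes z: "z \<in> \<Omega>" and y: "nearest z y" and U: "open U" "U \<subseteq> \<Omega>" "z \<in> U"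
    and diff: "\<And>x. x \<in> U \<Longrightarrow> d differentiable (at x)"
  obtains t where "t > 0" "z + t *\<^sub>R direction z y \<in> \<Omega>" "d (z + t *\<^sub>R direction z y) = d z + t"
proof -
  note dz = dist_bd_pos[OF z]
  obtain r where r: "r > 0" "cball z r \<subseteq> U" using U open_contains_cball by blast
  \<comment> \<open>Besides keeping the ball inside U, this gives 2 t < d z, hence d x > t for every
    x of the ball.\<close>
  define t where "t = min r (d z / 3)"
  have t: "t > 0" "t \<le> r" "2 * t < d z" using r dz by (auto simp: t_def min_def)
  have tU: "cball z t \<subseteq> U" using r t by (auto simp: subset_iff)
  define N where "N x = (SOME y. nearest x y)" for x
  have N: "nearest x (N x)" for x
  proof -
    obtain y where "nearest x y" by (rule nearest_exists)
    then show ?thesis unfolding N_def by (rule someI)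
  qed
  have dpos: "d x > 0" if "x \<in> cball z t" for x using that tU U by (intro dist_bd_pos) blast
  have "continuous_on (cball z t) N"
    unfolding continuous_on_iff
  proof (intro ballI allI impI)
    fix x e assume x: "x \<in> cball z t" and e: "(e::real) > 0"
    have "x \<in> U" using x tU by blast
    then have "nearest x y' \<Longrightarrow> y' = N x" for y'
      using nearest_unique[OF _ diff _ N] U by blast
    from nearest_continuous[OF this e] obtain \<delta> where "\<delta> > 0" "\<And>x' y'. dist x' x < \<delta> \<Longrightarrow> nearest x' y' \<Longrightarrow> dist y' (N x) < e"
      by blast
    then show "\<exists>\<delta>>0. \<forall>x'\<in>cball z t. dist x' x < \<delta> \<longrightarrow> dist (N x') (N x) < e" using N by blast
  qed
  then have bc: "continuous_on (cball z t) (\<lambda>x. z + t *\<^sub>R direction x (N x))"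
    unfolding direction_def using less_imp_neq[OF dpos, symmetric]
    by (intro continuous_intros continuous_on_dist_bd; blast)
  have bm: "(\<lambda>x. z + t *\<^sub>R direction x (N x)) \<in> cball z t \<rightarrow> cball z t"
  proof
    fix x assume "x \<in> cball z t"
    then have "d x > 0" by (rule dpos)
    then show "z + t *\<^sub>R direction x (N x) \<in> cball z t"
      using norm_direction[OF N, of x] t by (simp add: dist_norm)
  qed
  obtain x where x: "x \<in> cball z t" "z + t *\<^sub>R direction x (N x) = x"
    using brouwer_ball[OF t(1) bc bm] by blast
  have x\<Omega>: "x \<in> \<Omega>" using x tU U by blast
  note dx = dist_bd_pos[OF x\<Omega>]
  let ?e = "direction x (N x)"
  have e1: "norm ?e = 1" by (rule norm_direction[OF N dx])
  have "dist z x \<le> t" using x by simp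
  then have near: "\<bar>d z - d x\<bar> \<le> t" using dist_bd_lipschitz[of z x] by linarith
  \<comment> \<open>At the fixed point, z lies between N x and x at distance d x - t from N x. The
    Lipschitz bound makes d z equal to this, so N x is nearest to z as well and must be y.\<close>
  have zN: "z - N x = (d x - t) *\<^sub>R ?e"
  proof -
    have 1: "z = x - t *\<^sub>R ?e" using x(2) by (metis add_diff_cancel_right')
    have 2: "N x = x - d x *\<^sub>R ?e" by (rule nearest_eq[OF N dx])
    have "z - N x = (x - t *\<^sub>R ?e) - (x - d x *\<^sub>R ?e)" by (rule arg_cong2[OF 1 2])
    also have "\<dots> = (d x - t) *\<^sub>R ?e" by (simp add: algebra_simps)
    finally show ?thesis .
  qed
  have pos: "d x - t > 0" using near t by linarith
  have "dist z (N x) = d x - t" using e1 pos by (simp add: dist_norm zN)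
  moreover have "d z \<le> dist z (N x)" using N[of x] by (intro dist_bd_le) (simp add: nearest_def)
  ultimately have dzx: "d z = d x - t" using near by linarith
  then have "nearest z (N x)" using N[of x] \<open>dist z (N x) = d x - t\<close> by (simp add: nearest_def)
  then have "N x = y" using nearest_unique[OF z diff[OF U(3)] _ y] by blast
  then have "direction z y = ?e"
    unfolding direction_def[of z] using zN dzx pos by simp
  then have "z + t *\<^sub>R direction z y = x" using x(2) by simp
  then show thesis using that[of t] t x\<Omega> dzx by simp
qed

text \<open>Follow the ray from the nearest boundary point through x as long as the distance equals
  the arc length. At the last such point no prolongation exists, so it lies on the ridge; closedness
  of the ridge supplies the neighbourhood that prolongation would need.\<close>

lemma segment_to_ridge:
  assumes x: "x \<in> \<Omega>" and cl: "closedin (top_of_set \<Omega>) (dist_ridge_set \<Omega>)"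
  obtains y z where "y \<in> frontier \<Omega>" "z \<in> dist_ridge_set \<Omega>" "dist x y = d x" "dist z x = d z - d x"
proof -
  note dx = dist_bd_pos[OF x]
  obtain y where y: "nearest x y" by (rule nearest_exists)
  let ?e = "direction x y"
  have e1: "norm ?e = 1" by (rule norm_direction[OF y dx])
  obtain m where m: "m \<in> \<Omega>" "\<And>y. y \<in> closure \<Omega> \<Longrightarrow> d y \<le> d m" using dist_bd_max by blast
  let ?\<gamma> = "\<lambda>t. y + t *\<^sub>R ?e"
  have yx: "?\<gamma> (d x) = x" using nearest_eq[OF y dx] by (metis diff_add_cancel)
  \<comment> \<open>The distance to the frontier does not tell inside from outside; the point lies
    in the domain because the ball around it reaches x.\<close>
  have in\<Omega>: "?\<gamma> t \<in> \<Omega>" if "d (?\<gamma> t) = t" "t \<ge> d x" for t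
  proof -
    have "x - ?\<gamma> t = (d x - t) *\<^sub>R ?e" using yx by (metis add_diff_cancel_left scaleR_left_diff_distrib)
    then have "dist (?\<gamma> t) x = t - d x" using e1 that by (simp add: dist_norm norm_minus_commute)
    then have "ball (?\<gamma> t) t \<subseteq> \<Omega>" using dx that by (intro ball_subset[OF x]) auto
    then show ?thesis using dx that by (metis centre_in_ball less_le_trans subsetD)
  qed
  \<comment> \<open>The cap at the maximum of d makes the parameter set compact, and it excludes no
    point of the ray inside the domain with d equal to its parameter.\<close>
  define S where "S = {t \<in> {d x..d m}. d (?\<gamma> t) = t}"
  have xm: "d x \<le> d m" using m(2)[of x] x closure_subset by auto
  have "d x \<in> S" using xm unfolding S_def by (simp add: yx)
  moreover have "compact S"
  proof -
    have "continuous_on {d x..d m} (\<lambda>t. d (?\<gamma> t) - t)"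
      by (intro continuous_intros continuous_on_compose2[OF continuous_on_dist_bd[of UNIV]]) auto
    then have "closed ({d x..d m} \<inter> (\<lambda>t. d (?\<gamma> t) - t) -` {0})"
      by (intro continuous_closed_preimage) auto
    moreover have "S = {d x..d m} \<inter> (\<lambda>t. d (?\<gamma> t) - t) -` {0}" by (auto simp: S_def)
    ultimately have "closed S" by simp
    moreover have "S \<subseteq> {d x..d m}" by (auto simp: S_def)
    ultimately show ?thesis by (metis bounded_closed_interval bounded_subset compact_eq_bounded_closed)
  qed
  ultimately obtain T where T: "T \<in> S" "\<And>t. t \<in> S \<Longrightarrow> t \<le> T"
    using compact_attains_sup by (metis empty_iff)
  define z where "z = ?\<gamma> T"
  have Tx: "d x \<le> T" "d z = T" using T by (auto simp: S_def z_def)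
  have z\<Omega>: "z \<in> \<Omega>" using in\<Omega>[of T] Tx by (simp add: z_def)
  have "y \<in> frontier \<Omega>" using y by (simp add: nearest_def)
  then have nz: "nearest z y" using e1 Tx dx by (simp add: nearest_def z_def dist_norm)
  have zx: "z - x = (T - d x) *\<^sub>R ?e"
    using yx unfolding z_def by (metis add_diff_cancel_left scaleR_left_diff_distrib)
  have "z \<in> dist_ridge_set \<Omega>"
  proof (rule ccontr)
    assume "z \<notin> dist_ridge_set \<Omega>"
    then have zU: "z \<in> \<Omega> - dist_ridge_set \<Omega>" using z\<Omega> by blast
    have U: "open (\<Omega> - dist_ridge_set \<Omega>)"
    proof -
      obtain T where "closed T" "dist_ridge_set \<Omega> = \<Omega> \<inter> T" using cl unfolding closedin_closed by blast
      moreover from this(2) have "\<Omega> - dist_ridge_set \<Omega> = \<Omega> - T" by blast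
      ultimately show ?thesis using open_\<Omega> by (simp add: open_Diff)
    qed
    have "\<And>x. x \<in> \<Omega> - dist_ridge_set \<Omega> \<Longrightarrow> d differentiable (at x)" by (simp add: dist_ridge_set_def)
    from nearest_prolong[OF z\<Omega> nz U Diff_subset zU this]
    obtain t where t: "t > 0" "z + t *\<^sub>R direction z y \<in> \<Omega>" "d (z + t *\<^sub>R direction z y) = d z + t"
      by blast
    have "direction z y = ?e"
      using Tx dx unfolding direction_def[of z] by (simp add: z_def)
    then have eq: "z + t *\<^sub>R direction z y = ?\<gamma> (T + t)" by (simp add: z_def scaleR_left_distrib)
    have "T + t \<le> d m" using m(2)[of "?\<gamma> (T + t)"] t closure_subset unfolding eq Tx by auto
    then have "T + t \<in> S" using t Tx unfolding S_def eq by simp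
    then show False using T(2)[of "T + t"] t by simp
  qed
  moreover have "dist x y = d x" using y by (simp add: nearest_def)
  moreover have "dist z x = d z - d x" using e1 Tx by (simp add: dist_norm zx)
  ultimately show thesis using that \<open>y \<in> frontier \<Omega>\<close> by blast
qed

end

section \<open>Contact set, distance function and ridge\<close>

theorem theorem1p3:
  fixes \<Omega> M :: "(real^'n) set"
    and q :: "real \<Rightarrow> real"
    and u :: "real \<Rightarrow> real^'n \<Rightarrow> real"
    and p :: "nat \<Rightarrow> real"
    and u_inf :: "real^'n \<Rightarrow> real"
  assumes dim: "CARD('n) \<ge> 2"
    and dom: "bounded_smooth_domain \<Omega>"
    and q_ge: "\<And>s. s > real CARD('n) \<Longrightarrow> q s \<ge> 1"
    and extr: "\<And>s. s > real CARD('n) \<Longrightarrow> sobolev_extremal \<Omega> s (q s) (u s)"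
    and q_lim: "filterlim (\<lambda>s. q s / s) at_top at_top"
    and p_gt: "\<And>n. p n > real CARD('n)"
    and p_lim: "filterlim p at_top sequentially"
    and unif: "uniform_limit (closure \<Omega>) (\<lambda>n. u (p n)) u_inf sequentially"
    and u_C0: "u_inf \<in> C0_closure \<Omega>"
    and u_W: "u_inf \<in> W1_inf \<Omega>"
    and M: "M = {x\<in>\<Omega>. u_inf x = 1}"
  shows "viscosity_solution_problem \<Omega> M u_inf \<and>
    ((\<forall>x\<in>closure \<Omega>. u_inf x = dist_bd \<Omega> x / Linf_norm \<Omega> (dist_bd \<Omega>)) \<longleftrightarrow>
      M = dist_max_set \<Omega> \<and> dist_max_set \<Omega> = dist_ridge_set \<Omega>)"
proof -
  interpret bounded_open \<Omega>
    using dom by unfold_locales (auto simp: bounded_smooth_domain_def)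
  interpret L: infinity_limit \<Omega> p "\<lambda>n. q (p n)" "\<lambda>n. u (p n)" u_inf
    using extr[OF p_gt] filterlim_compose[OF q_lim p_lim] p_lim unif u_C0 bounded open_\<Omega>
    by unfold_locales auto
  have cl: "x \<in> closure \<Omega>" if "x \<in> \<Omega>" for x using that closure_subset by auto
  have uc: "continuous_on \<Omega> u_inf"
    using L.w_continuous closure_subset continuous_on_subset by blast
  have open_D: "open (\<Omega> - M)"
  proof -
    have "\<Omega> - M = \<Omega> \<inter> u_inf -` (- {1})" by (auto simp: M)
    moreover have "open (\<Omega> \<inter> u_inf -` (- {1}))" by (rule continuous_open_preimage[OF uc open_\<Omega>]) auto
    ultimately show ?thesis by simp
  qed
  have harmonic: "infinity_harmonic (\<Omega> - M) u_inf"
  proof (rule L.infinity_harmonic_limit)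
    show "u_inf x < 1" if "x \<in> \<Omega> - M" for x
      using L.w_le_1[of x] that cl by (auto simp: M less_le)
  qed auto
  have visc: "viscosity_solution_problem \<Omega> M u_inf"
    using L.w_continuous L.w_frontier open_D harmonic by (auto simp: viscosity_solution_problem_def M)
  obtain m where m: "m \<in> \<Omega>" "\<And>y. y \<in> closure \<Omega> \<Longrightarrow> d y \<le> d m" using dist_bd_max by blast
  define R where "R = d m"
  have R: "R > 0" unfolding R_def by (rule dist_bd_pos[OF m(1)])
  have max: "d y \<le> R" if "y \<in> \<Omega>" for y using m(2) cl[OF that] by (simp add: R_def)
  have Linf: "Linf_norm \<Omega> d = R" unfolding R_def using m cl by (intro Linf_norm_dist_bd) auto
  \<comment> \<open>The largest inscribed ball yields the Lipschitz constant 1/R for the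
    limit.\<close>
  have ball: "ball m R \<subseteq> \<Omega>" using m R by (intro ball_subset[of m]) (auto simp: R_def)
  have max_set: "dist_max_set \<Omega> = {x \<in> \<Omega>. d x = R}" by (simp add: dist_max_set_def Linf)
  have "M = dist_max_set \<Omega> \<and> dist_max_set \<Omega> = dist_ridge_set \<Omega>"
    if eq: "\<forall>x\<in>closure \<Omega>. u_inf x = d x / R"
  proof
    show M_eq: "M = dist_max_set \<Omega>" unfolding M max_set using eq cl R by (auto simp: divide_eq_1_iff)
    show "dist_max_set \<Omega> = dist_ridge_set \<Omega>"
    proof (intro equalityI subsetI)
      fix x assume "x \<in> dist_max_set \<Omega>"
      then show "x \<in> dist_ridge_set \<Omega>"
        using max_not_differentiable[of x] max unfolding max_set dist_ridge_set_def by auto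
    next
      fix x assume x: "x \<in> dist_ridge_set \<Omega>"
      show "x \<in> dist_max_set \<Omega>"
      proof (rule ccontr)
        assume "x \<notin> dist_max_set \<Omega>"
        then have "x \<in> \<Omega> - M" using x M_eq by (auto simp: dist_ridge_set_def)
        moreover have "u_inf y = d y / R" if "y \<in> \<Omega> - M" for y using eq cl that by blast
        moreover have "inf_subsolution (\<Omega> - M) u_inf" using harmonic by (simp add: infinity_harmonic_def)
        ultimately have "d differentiable (at x)"
          by (intro differentiable_if_subsolution[OF R open_D Diff_subset])
        then show False using x by (simp add: dist_ridge_set_def)
      qed
    qed
  qed
  moreover have "u_inf x = d x / R"
    if sets: "M = dist_max_set \<Omega>" "dist_max_set \<Omega> = dist_ridge_set \<Omega>" and x: "x \<in> closure \<Omega>" for x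
  proof (cases "x \<in> \<Omega>")
    case False
    then have "x \<in> frontier \<Omega>" using x open_\<Omega> by (simp add: frontier_def interior_open)
    then show ?thesis by (simp add: L.w_frontier dist_bd_frontier)
  next
    case True
    \<comment> \<open>By assumption the ridge is the set where d equals R; this is where its
      closedness comes from.\<close>
    have "closed {x. d x = R}" by (intro closed_Collect_eq continuous_on_dist_bd continuous_on_const)
    then have "closedin (top_of_set \<Omega>) (dist_ridge_set \<Omega>)"
      unfolding sets(2)[symmetric] max_set closedin_closed by (intro exI[of _ "{x. d x = R}"]) auto
    then obtain y z where yz: "y \<in> frontier \<Omega>" "z \<in> dist_ridge_set \<Omega>" "dist x y = d x" "dist z x = d z - d x"
      using segment_to_ridge[OF True] by blast
    have z: "z \<in> \<Omega>" "d z = R" using yz(2) sets(2) by (auto simp: max_set)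
    have "z \<in> M" using yz(2) sets by simp
    then have uz: "u_inf z = 1" by (simp add: M)
    have uy: "u_inf y = 0" by (rule L.w_frontier[OF yz(1)])
    have y: "y \<in> closure \<Omega>" using yz(1) by (simp add: frontier_def)
    \<comment> \<open>The segments from y to x and from x to z have total length R, while the limit
      climbs from 0 to 1. With slope at most 1/R both Lipschitz bounds must be equalities.\<close>
    have "u_inf x \<le> d x / R"
      using L.w_lipschitz[OF ball R x y] yz(3) by (simp add: uy dist_norm)
    moreover have "1 - u_inf x \<le> (R - d x) / R"
      using L.w_lipschitz[OF ball R cl[OF z(1)] x] yz(4) z(2) by (simp add: uz dist_norm)
    moreover have "(R - d x) / R = 1 - d x / R" using R by (simp add: diff_divide_distrib)
    ultimately show ?thesis by linarith
  qed
  ultimately show ?thesis using visc unfolding Linf by blast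
qed

end
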